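(* Let $\mathcal{C}\subseteq\mathbb{A}^n$ be a smooth algebraic curve having a rational parametric representation $\mathcal{P}=(g_1/h_1,\dots,g_n/h_n)$, with $g_i/h_i\in K(t)$, for which there is a non-empty Zariski open subset $\mathcal{U}\subseteq\mathbb{A}^1$ (on which $\mathcal{P}$ is defined) such that (P1) $\mathcal{P}:\mathcal{U}\to\mathcal{C}$ is injective, and (P2) the derivative $\mathcal{P}'(t)$ does not vanish for every $t\in\mathcal{U}$. Then $$\deg(T\mathcal{C})\le 3\deg(\mathcal{C})-2.$$
   Context: $K$ is an algebraically closed field of characteristic $0$ and $\mathbb{A}^n$ is $K^n$ with the Zariski topology. An algebraic variety is a Zariski closed subset. A curve $\mathcal{C}\subseteq\mathbb{A}^n$ has a rational parametric representation if there are rational functions $g_1/h_1,\dots,g_n/h_n\in K(t)$ such that $t\mapsto(g_1(t)/h_1(t),\dots,g_n(t)/h_n(t))$ defines a dominant (rational) map $\mathbb{A}^1\to\mathcal{C}$ (where defined, its image is contained in $\mathcal{C}$, and the image is Zariski dense in $\mathcal{C}$); such a curve is irreducible. Geometric degree: if $V\subseteq\mathbb{A}^n$ is irreducible of dimension $d$, then $\deg(V)$ is the cardinality of $V\cap L$ for a generic affine linear variety $L\subseteq \mathbb{A}^n$ of dimension $n-d$. Tangent bundle: for a smooth variety $V\subseteq \mathbb{A}^n$ with vanishing ideal $I(V)=(f_1,\dots,f_r)\subseteq K[x_1,\dots,x_n]$, $T_pV=\{y\in \mathbb{A}^n\mid \nabla f_i(p)\cdot y=0,\ 1\le i\le r\}$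 for $p\in V$, and $TV=\{(x,y)\in\mathbb{A}^{2n}\mid x\in V,\ y\in T_xV\}$. *)

theory Defs
  imports
    "HOL-Analysis.Analysis"
    "HOL-Computational_Algebra.Computational_Algebra"
    "HOL-Library.Poly_Mapping"
    "HOL-Library.Extended_Nat"
begin

section \<open>Multivariate polynomials\<close>

text \<open>Exponent vectors are finitely supported maps from variables to naturals, and polynomials are
  finitely supported maps from exponent vectors to coefficients, so that multiplication of
  polynomials is the convolution product supplied by the library.
  The set of variables may be infinite.\<close>

type_synonym ('v, 'a) mpoly = "('v \<Rightarrow>\<^sub>0 nat) \<Rightarrow>\<^sub>0 'a"

definition mono_eval :: "('v \<Rightarrow> 'a::comm_semiring_1) \<Rightarrow> ('v \<Rightarrow>\<^sub>0 nat) \<Rightarrow> 'a" where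
  "mono_eval x m = (\<Prod>i\<in>Poly_Mapping.keys m. x i ^ Poly_Mapping.lookup m i)"

definition mpoly_eval :: "('v \<Rightarrow> 'a::comm_semiring_1) \<Rightarrow> ('v, 'a) mpoly \<Rightarrow> 'a" where
  "mpoly_eval x f = (\<Sum>m\<in>Poly_Mapping.keys f. Poly_Mapping.lookup f m * mono_eval x m)"

definition mpoly_vars :: "('v, 'a::zero) mpoly \<Rightarrow> 'v set" where
  "mpoly_vars f = (\<Union>m\<in>Poly_Mapping.keys f. Poly_Mapping.keys m)"

text \<open>The subtraction of exponents is truncated, but the coefficient vanishes whenever the exponent
  of the variable is 0.\<close>

definition mpoly_deriv :: "'v \<Rightarrow> ('v, 'a::comm_semiring_1) mpoly \<Rightarrow> ('v, 'a) mpoly" where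
  "mpoly_deriv i f = (\<Sum>m\<in>Poly_Mapping.keys f.
     Poly_Mapping.single (m - Poly_Mapping.single i 1)
       (of_nat (Poly_Mapping.lookup m i) * Poly_Mapping.lookup f m))"


section \<open>Zariski closed subsets of affine space\<close>

definition zero_set :: "('n::finite, 'a::comm_semiring_1) mpoly set \<Rightarrow> ('a ^ 'n) set" where
  "zero_set S = {x. \<forall>f\<in>S. mpoly_eval (($) x) f = 0}"

definition zariski_closed :: "('a::comm_semiring_1 ^ 'n::finite) set \<Rightarrow> bool" where
  "zariski_closed V \<longleftrightarrow> (\<exists>S. V = zero_set S)"

definition vanishing_ideal :: "('a::comm_semiring_1 ^ 'n::finite) set \<Rightarrow> ('n, 'a) mpoly set" where
  "vanishing_ideal V = {f. \<forall>x\<in>V. mpoly_eval (($) x) f = 0}"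

definition zariski_irreducible :: "('a::comm_semiring_1 ^ 'n::finite) set \<Rightarrow> bool" where
  "zariski_irreducible V \<longleftrightarrow> V \<noteq> {} \<and>
     (\<forall>A B. zariski_closed A \<and> zariski_closed B \<and> V \<subseteq> A \<union> B \<longrightarrow> V \<subseteq> A \<or> V \<subseteq> B)"

text \<open>Topological (Krull) dimension: the supremum of the lengths of the strictly increasing chains of
  irreducible closed subsets. It is taken in \<^typ>\<open>enat\<close>, where every set has a supremum.\<close>

definition zariski_dim :: "('a::comm_semiring_1 ^ 'n::finite) set \<Rightarrow> enat" where
  "zariski_dim V = Sup {enat d | d. \<exists>Z :: nat \<Rightarrow> ('a ^ 'n) set.
     (\<forall>i\<le>d. zariski_closed (Z i) \<and> zariski_irreducible (Z i) \<and> Z i \<subseteq> V) \<and>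
     (\<forall>i<d. Z i \<subset> Z (Suc i))}"

text \<open>The largest dimension of an irreducible closed subset of \<open>V\<close> passing through \<open>p\<close>.\<close>

definition local_dim :: "('a::comm_semiring_1 ^ 'n::finite) set \<Rightarrow> 'a ^ 'n \<Rightarrow> enat" where
  "local_dim V p = Sup {zariski_dim Z | Z.
     zariski_closed Z \<and> zariski_irreducible Z \<and> Z \<subseteq> V \<and> p \<in> Z}"


section \<open>Tangent spaces and the tangent bundle\<close>

definition grad :: "('n::finite, 'a::comm_semiring_1) mpoly \<Rightarrow> 'a ^ 'n \<Rightarrow> 'a ^ 'n" where
  "grad f p = (\<chi> i. mpoly_eval (($) p) (mpoly_deriv i f))"

text \<open>All elements of the vanishing ideal are used instead of a chosen finite generating set;
  \<open>tangent_space_generators\<close> below shows that every generating set gives the same space.\<close>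

definition tangent_space :: "('a::comm_semiring_1 ^ 'n::finite) set \<Rightarrow> 'a ^ 'n \<Rightarrow> ('a ^ 'n) set" where
  "tangent_space V p = {y. \<forall>f\<in>vanishing_ideal V. (\<Sum>i\<in>UNIV. grad f p $ i * y $ i) = 0}"

definition zariski_smooth :: "('a::field ^ 'n::finite) set \<Rightarrow> bool" where
  "zariski_smooth V \<longleftrightarrow> (\<forall>p\<in>V. enat (vec.dim (tangent_space V p)) = local_dim V p)"

text \<open>Affine space of dimension \<open>2n\<close> is \<open>K\<^sup>n\<^sup>+\<^sup>n\<close>: the coordinates indexed by \<^const>\<open>Inl\<close> are those of
  the base point, the ones indexed by \<^const>\<open>Inr\<close> those of the tangent vector.\<close>

definition tangent_bundle ::
    "('a::comm_semiring_1 ^ 'n::finite) set \<Rightarrow> ('a ^ ('n + 'n)) set" where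
  "tangent_bundle V =
     {z. (\<chi> i. z $ Inl i) \<in> V \<and> (\<chi> i. z $ Inr i) \<in> tangent_space V (\<chi> i. z $ Inl i)}"


section \<open>Geometric degree\<close>

text \<open>A system of \<open>d\<close> linear equations \<open>\<Sum>\<^sub>j A\<^sub>i\<^sub>j x\<^sub>j = b\<^sub>i\<close> (for \<open>i < d\<close>) is given by a function \<open>c\<close> with
  \<open>A\<^sub>i\<^sub>j = c (i, Some j)\<close> and \<open>b\<^sub>i = c (i, None)\<close>; the values of \<open>c\<close> at \<open>(i, _)\<close> with \<open>i \<ge> d\<close> play no role.\<close>

definition linear_variety :: "nat \<Rightarrow> (nat \<times> 'n option \<Rightarrow> 'a) \<Rightarrow> ('a::field ^ 'n::finite) set" where
  "linear_variety d c = {x. \<forall>i<d. (\<Sum>j\<in>UNIV. c (i, Some j) * x $ j) = c (i, None)}"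

text \<open>The coefficient matrix has rank \<open>d\<close>, that is, \<^term>\<open>linear_variety d c\<close> is a nonempty affine
  linear variety of codimension \<open>d\<close>.\<close>

definition full_rank :: "nat \<Rightarrow> (nat \<times> 'n::finite option \<Rightarrow> 'a::field) \<Rightarrow> bool" where
  "full_rank d c \<longleftrightarrow> vec.dim ((\<lambda>i. \<chi> j. c (i, Some j)) ` {..<d}) = d"

text \<open>``Generic'' means: for all linear varieties of codimension \<open>d\<close> whose parameters lie in some
  nonempty Zariski open subset of the parameter space \<open>K\<^sup>d\<^sup>\<times>\<^sup>n \<times> K\<^sup>d\<close>. Every such subset contains the
  complement of the zero set of a single nonzero polynomial \<open>F\<close> in the parameters.
  Finiteness is required explicitly because the \<^const>\<open>card\<close> of an infinite set is 0.\<close>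

definition has_geom_degree :: "('a::field ^ 'n::finite) set \<Rightarrow> nat \<Rightarrow> bool" where
  "has_geom_degree V k \<longleftrightarrow> zariski_irreducible V \<and>
     (\<exists>d. zariski_dim V = enat d \<and>
       (\<exists>F :: (nat \<times> 'n option, 'a) mpoly. F \<noteq> 0 \<and> mpoly_vars F \<subseteq> {..<d} \<times> UNIV \<and>
         (\<forall>c. mpoly_eval c F \<noteq> 0 \<and> full_rank d c \<longrightarrow>
            finite (V \<inter> linear_variety d c) \<and> card (V \<inter> linear_variety d c) = k)))"

definition geom_degree :: "('a::field ^ 'n::finite) set \<Rightarrow> nat" where
  "geom_degree V = (THE k. has_geom_degree V k)"


section \<open>Rational parametric representations\<close>

text \<open>The affine line is identified with the field itself.\<close>

definition zariski_open_line :: "'a::comm_semiring_1 set \<Rightarrow> bool" where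
  "zariski_open_line U \<longleftrightarrow> (\<exists>S. U = - {t. \<forall>p\<in>S. poly p t = 0})"

definition param_domain :: "('n \<Rightarrow> 'a::field poly) \<Rightarrow> 'a set" where
  "param_domain h = {t. \<forall>i. poly (h i) t \<noteq> 0}"

definition param_map :: "('n::finite \<Rightarrow> 'a::field poly) \<Rightarrow> ('n \<Rightarrow> 'a poly) \<Rightarrow> 'a \<Rightarrow> 'a ^ 'n" where
  "param_map g h t = (\<chi> i. poly (g i) t / poly (h i) t)"

text \<open>The formal derivative of the rational functions, by the quotient rule.\<close>

definition param_deriv :: "('n::finite \<Rightarrow> 'a::field poly) \<Rightarrow> ('n \<Rightarrow> 'a poly) \<Rightarrow> 'a \<Rightarrow> 'a ^ 'n" where
  "param_deriv g h t =
     (\<chi> i. poly (pderiv (g i) * h i - g i * pderiv (h i)) t / poly (h i) t ^ 2)"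

definition rational_parametrization ::
    "('n::finite \<Rightarrow> 'a::field poly) \<Rightarrow> ('n \<Rightarrow> 'a poly) \<Rightarrow> ('a ^ 'n) set \<Rightarrow> bool" where
  "rational_parametrization g h C \<longleftrightarrow> (\<forall>i. h i \<noteq> 0) \<and>
     param_map g h ` param_domain h \<subseteq> C \<and>
     C \<subseteq> zariski_closed hull (param_map g h ` param_domain h)"


section \<open>Independence of the tangent space of the chosen generators\<close>

lemma mono_eval_superset:
  assumes "finite A" "Poly_Mapping.keys m \<subseteq> A"
  shows "mono_eval x m = (\<Prod>i\<in>A. x i ^ Poly_Mapping.lookup m i)"
  unfolding mono_eval_def using assms
  by (intro prod.mono_neutral_left) (auto simp: in_keys_iff)

lemma mono_eval_add: "mono_eval x (m + n) = mono_eval x m * mono_eval x n"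
proof -
  let ?A = "Poly_Mapping.keys m \<union> Poly_Mapping.keys n"
  have "Poly_Mapping.keys (m + n) \<subseteq> ?A"
    by (rule Poly_Mapping.keys_add)
  then show ?thesis
    by (simp add: mono_eval_superset[of ?A] lookup_add power_add prod.distrib)
qed

lemma mpoly_eval_superset:
  assumes "finite A" "Poly_Mapping.keys f \<subseteq> A"
  shows "mpoly_eval x f = (\<Sum>m\<in>A. Poly_Mapping.lookup f m * mono_eval x m)"
  unfolding mpoly_eval_def using assms
  by (intro sum.mono_neutral_left) (auto simp: in_keys_iff)

lemma mpoly_eval_0 [simp]: "mpoly_eval x 0 = 0"
  by (simp add: mpoly_eval_def)

lemma mpoly_eval_add: "mpoly_eval x (f + g) = mpoly_eval x f + mpoly_eval x g"
proof -
  let ?A = "Poly_Mapping.keys f \<union> Poly_Mapping.keys g"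
  have "Poly_Mapping.keys (f + g) \<subseteq> ?A"
    by (rule Poly_Mapping.keys_add)
  then show ?thesis
    by (simp add: mpoly_eval_superset[of ?A] lookup_add distrib_right sum.distrib)
qed

lemma mpoly_eval_sum: "mpoly_eval x (sum f A) = (\<Sum>a\<in>A. mpoly_eval x (f a))"
  by (induction A rule: infinite_finite_induct) (auto simp: mpoly_eval_add)

lemma mpoly_eval_single: "mpoly_eval x (Poly_Mapping.single m c) = c * mono_eval x m"
  by (simp add: mpoly_eval_def)

lemma mpoly_expand:
  "f = (\<Sum>m\<in>Poly_Mapping.keys f. Poly_Mapping.single m (Poly_Mapping.lookup f m))"
proof (rule poly_mapping_eqI)
  fix k
  show "Poly_Mapping.lookup f k =
    Poly_Mapping.lookup (\<Sum>m\<in>Poly_Mapping.keys f. Poly_Mapping.single m (Poly_Mapping.lookup f m)) k"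
    by (auto simp: lookup_sum lookup_single when_def in_keys_iff)
qed

lemma mpoly_eval_mult: "mpoly_eval x (f * g) = mpoly_eval x f * mpoly_eval x g"
proof -
  have "f * g = (\<Sum>m\<in>Poly_Mapping.keys f. \<Sum>n\<in>Poly_Mapping.keys g.
      Poly_Mapping.single (m + n) (Poly_Mapping.lookup f m * Poly_Mapping.lookup g n))"
    by (subst (1) mpoly_expand[of f], subst (1) mpoly_expand[of g])
      (simp add: sum_product mult_single)
  then show ?thesis
    by (simp add: mpoly_eval_sum mpoly_eval_single mono_eval_add)
      (simp add: mpoly_eval_def sum_product mult_ac)
qed

lemma mpoly_deriv_superset:
  assumes "finite A" "Poly_Mapping.keys f \<subseteq> A"
  shows "mpoly_deriv i f = (\<Sum>m\<in>A. Poly_Mapping.single (m - Poly_Mapping.single i 1)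
       (of_nat (Poly_Mapping.lookup m i) * Poly_Mapping.lookup f m))"
  unfolding mpoly_deriv_def using assms
  by (intro sum.mono_neutral_left) (auto simp: in_keys_iff)

lemma mpoly_deriv_0 [simp]: "mpoly_deriv i 0 = 0"
  by (simp add: mpoly_deriv_def)

lemma mpoly_deriv_add: "mpoly_deriv i (f + g) = mpoly_deriv i f + mpoly_deriv i g"
proof -
  let ?A = "Poly_Mapping.keys f \<union> Poly_Mapping.keys g"
  have "Poly_Mapping.keys (f + g) \<subseteq> ?A"
    by (rule Poly_Mapping.keys_add)
  then show ?thesis
    by (simp add: mpoly_deriv_superset[of ?A] lookup_add distrib_left single_add sum.distrib)
qed

lemma mpoly_deriv_sum: "mpoly_deriv i (sum f A) = (\<Sum>a\<in>A. mpoly_deriv i (f a))"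
  by (induction A rule: infinite_finite_induct) (auto simp: mpoly_deriv_add)

lemma mpoly_deriv_single:
  "mpoly_deriv i (Poly_Mapping.single m c) =
     Poly_Mapping.single (m - Poly_Mapping.single i 1) (of_nat (Poly_Mapping.lookup m i) * c)"
  by (simp add: mpoly_deriv_def)

lemma single_shift:
  fixes c :: "'a::comm_semiring_1" and m n :: "'v \<Rightarrow>\<^sub>0 nat"
  shows "Poly_Mapping.single (m + n - Poly_Mapping.single i 1) (of_nat (Poly_Mapping.lookup m i) * c) =
    Poly_Mapping.single (m - Poly_Mapping.single i 1 + n) (of_nat (Poly_Mapping.lookup m i) * c)"
proof (cases "Poly_Mapping.lookup m i = 0")
  case False
  then have "m + n - Poly_Mapping.single i 1 = m - Poly_Mapping.single i 1 + n"
    by (intro poly_mapping_eqI) (auto simp: lookup_add lookup_minus lookup_single when_def)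
  then show ?thesis by simp
qed simp

lemma mpoly_deriv_mult:
  "mpoly_deriv i (f * g) = mpoly_deriv i f * g + f * mpoly_deriv i g"
proof -
  let ?s = "\<lambda>f m. Poly_Mapping.single m (Poly_Mapping.lookup f m)"
  let ?F = "Poly_Mapping.keys f" and ?G = "Poly_Mapping.keys g"
  have rule: "mpoly_deriv i (Poly_Mapping.single m c * Poly_Mapping.single n d) =
      mpoly_deriv i (Poly_Mapping.single m c) * Poly_Mapping.single n d +
      Poly_Mapping.single m c * mpoly_deriv i (Poly_Mapping.single n d)"
    for m n :: "'a \<Rightarrow>\<^sub>0 nat" and c d :: 'b
    using single_shift[of m n i "c * d"] single_shift[of n m i "c * d"]
    by (simp add: mult_single mpoly_deriv_single lookup_add distrib_left distrib_right single_add
        add_ac mult_ac)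
  have "mpoly_deriv i ((\<Sum>m\<in>?F. ?s f m) * (\<Sum>n\<in>?G. ?s g n)) =
      mpoly_deriv i (\<Sum>m\<in>?F. ?s f m) * (\<Sum>n\<in>?G. ?s g n) +
      (\<Sum>m\<in>?F. ?s f m) * mpoly_deriv i (\<Sum>n\<in>?G. ?s g n)"
    by (simp add: sum_product mpoly_deriv_sum rule sum.distrib)
  then show ?thesis
    unfolding mpoly_expand[symmetric] .
qed

lemma grad_sum: "grad (sum f A) p = (\<Sum>a\<in>A. grad (f a) p)"
  by (simp add: grad_def mpoly_deriv_sum mpoly_eval_sum vec_eq_iff)

lemma grad_mult:
  "grad (f * g) p = mpoly_eval (($) p) f *s grad g p + mpoly_eval (($) p) g *s grad f p"
  by (simp add: grad_def mpoly_deriv_mult mpoly_eval_add mpoly_eval_mult vec_eq_iff algebra_simps)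

lemma tangent_space_generators:
  fixes V :: "('a::comm_semiring_1 ^ 'n::finite) set"
  assumes gen: "vanishing_ideal V = {\<Sum>f\<in>F. q f * f | q. True}"
    and "finite F" and "p \<in> V"
  shows "tangent_space V p = {y. \<forall>f\<in>F. (\<Sum>i\<in>UNIV. grad f p $ i * y $ i) = 0}"
proof -
  have F: "f \<in> vanishing_ideal V" if "f \<in> F" for f
  proof -
    have "(\<Sum>g\<in>F. (if g = f then 1 else 0) * g) = (\<Sum>g\<in>F. if g = f then g else 0)"
      by (intro sum.cong) auto
    then have "f = (\<Sum>g\<in>F. (if g = f then 1 else 0) * g)"
      using that \<open>finite F\<close> by simp
    then show ?thesis unfolding gen by (intro CollectI exI conjI TrueI)
  qed
  show ?thesis
  proof (intro subset_antisym subsetI)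
    fix y assume y: "y \<in> tangent_space V p"
    with y F show "y \<in> {y. \<forall>f\<in>F. (\<Sum>i\<in>UNIV. grad f p $ i * y $ i) = 0}"
      by (simp add: tangent_space_def)
  next
    fix y assume y: "y \<in> {y. \<forall>f\<in>F. (\<Sum>i\<in>UNIV. grad f p $ i * y $ i) = 0}"
    have van: "mpoly_eval (($) p) f = 0" if "f \<in> F" for f
      using F[OF that] \<open>p \<in> V\<close> by (simp add: vanishing_ideal_def)
    have "(\<Sum>i\<in>UNIV. grad (\<Sum>f\<in>F. q f * f) p $ i * y $ i) = 0" for q
    proof -
      have "(\<Sum>i\<in>UNIV. grad (\<Sum>f\<in>F. q f * f) p $ i * y $ i) =
          (\<Sum>i\<in>UNIV. \<Sum>f\<in>F. mpoly_eval (($) p) (q f) * (grad f p $ i * y $ i))"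
        by (simp add: grad_sum grad_mult van sum_distrib_right mult.assoc)
      also have "\<dots> = (\<Sum>f\<in>F. mpoly_eval (($) p) (q f) * (\<Sum>i\<in>UNIV. grad f p $ i * y $ i))"
        by (subst sum.swap) (simp add: sum_distrib_left)
      also have "\<dots> = 0" using y by simp
      finally show ?thesis .
    qed
    then show "y \<in> tangent_space V p"
      unfolding tangent_space_def gen by blast
  qed
qed

end

theory Submission
  imports Defs
begin

text \<open>Write the parametrization with a common denominator as \<open>P = G/H\<close>, with no common zero of \<open>H\<close> and the
  \<open>G\<^sub>i\<close>, and let \<open>D\<close> be the largest degree that occurs. The derivative is \<open>W/H\<^sup>2\<close> with
  \<open>W\<^sub>i = G\<^sub>i' H - G\<^sub>i H'\<close>, and \<open>W\<close> has degree at most \<open>2D - 2\<close> because the coefficients at \<open>2D - 1\<close> cancel.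

  A hyperplane \<open>a \<cdot> x = b\<close> meets the curve where \<open>a \<cdot> G - b H\<close> vanishes. By a Bertini argument some such
  polynomial has \<open>D\<close> distinct roots, and since \<open>P\<close> is injective on \<open>U\<close> the degree of the curve is at least \<open>D\<close>
  (lemma \<open>curve_degree\<close>).

  The tangent line at \<open>P(t)\<close> is spanned by \<open>W(t)\<close>, so a point of the tangent bundle is \<open>(P(t), s W(t))\<close>. On
  it two linear equations \<open>A\<^sub>k \<cdot> x + B\<^sub>k \<cdot> y = e\<^sub>k\<close> become affine in \<open>s\<close>, and eliminating \<open>s\<close> leaves
  \<open>(A\<^sub>0 \<cdot> G - e\<^sub>0 H) (B\<^sub>1 \<cdot> W) - (A\<^sub>1 \<cdot> G - e\<^sub>1 H) (B\<^sub>0 \<cdot> W) = 0\<close>, a polynomial in \<open>t\<close> of degree at most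
  \<open>D + (2D - 2)\<close>. Hence the tangent bundle has degree at most \<open>3D - 2\<close> (lemma \<open>tangent_bundle_degree\<close>),
  and the theorem follows.

  Three things have to be supplied for these counts to compute degrees. First, the number of points of a
  generic section must be constant: the number of distinct roots of a one-variable polynomial is lower
  semicontinuous in its coefficients (lemma \<open>many_roots_open\<close>), hence generically equal to its maximum.
  Second, the parametrization may miss finitely many points of the curve: all of them come from the
  excluded parameters and from the parameter at infinity, because the image of the projective line is
  closed (lemma \<open>curve_points\<close>), and a generic linear section avoids their fibres. Third, the tangent
  bundle must be irreducible of dimension 2. By smoothness the fibre over a missing point is a line,
  spanned by the limit of the neighbouring tangent directions, so polynomials that vanish on the
  parametrized part vanish on the whole bundle (lemma \<open>tangent_bundle_dense\<close>); this gives
  irreducibility, and the bound on the dimension because any three polynomials are algebraically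
  dependent on a set parametrized by two variables (lemma \<open>algebraic_dependence\<close>).\<close>

section \<open>Polynomial functions and generic properties\<close>

text \<open>A polynomial is represented by the function that it induces, together with a set \<open>V\<close> of variables
  that it may use. Closure properties are then plain introduction rules and substitution is composition
  of functions; over an infinite field nothing is lost.\<close>

inductive polyfun :: "'v set \<Rightarrow> (('v \<Rightarrow> 'a::comm_semiring_1) \<Rightarrow> 'a) \<Rightarrow> bool" for V where
  const: "polyfun V (\<lambda>c. a)"
| var: "v \<in> V \<Longrightarrow> polyfun V (\<lambda>c. c v)"
| add: "polyfun V f \<Longrightarrow> polyfun V g \<Longrightarrow> polyfun V (\<lambda>c. f c + g c)"
| mult: "polyfun V f \<Longrightarrow> polyfun V g \<Longrightarrow> polyfun V (\<lambda>c. f c * g c)"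

lemma polyfun_sum: "(\<And>i. i \<in> I \<Longrightarrow> polyfun V (f i)) \<Longrightarrow> polyfun V (\<lambda>c. \<Sum>i\<in>I. f i c)"
  by (induction I rule: infinite_finite_induct) (auto intro: polyfun.intros)

lemma polyfun_prod: "(\<And>i. i \<in> I \<Longrightarrow> polyfun V (f i)) \<Longrightarrow> polyfun V (\<lambda>c. \<Prod>i\<in>I. f i c)"
  by (induction I rule: infinite_finite_induct) (auto intro: polyfun.intros)

lemma polyfun_power: "polyfun V f \<Longrightarrow> polyfun V (\<lambda>c. f c ^ n)"
  by (induction n) (auto intro: polyfun.intros)

lemma polyfun_minus: "polyfun V f \<Longrightarrow> polyfun V (\<lambda>c. - f c :: 'a::comm_ring_1)"
  using polyfun.mult[OF polyfun.const[of V "-1"], of f] by simp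

lemma polyfun_diff:
  "polyfun V f \<Longrightarrow> polyfun V g \<Longrightarrow> polyfun V (\<lambda>c. f c - g c :: 'a::comm_ring_1)"
  using polyfun.add[OF _ polyfun_minus, of V f g] by simp

lemmas polyfun_intros = polyfun.intros polyfun_sum polyfun_prod polyfun_power polyfun_minus polyfun_diff

lemma polyfun_substitute:
  assumes "polyfun V f" "\<And>v. v \<in> V \<Longrightarrow> polyfun W (\<lambda>c. q c v)"
  shows "polyfun W (\<lambda>c. f (q c))"
  using assms by (induction rule: polyfun.induct) (auto intro: polyfun.intros)

lemma polyfun_mpoly_eval: "mpoly_vars f \<subseteq> V \<Longrightarrow> polyfun V (\<lambda>c. mpoly_eval c f)"
  unfolding mpoly_eval_def mono_eval_def mpoly_vars_def
  by (intro polyfun_intros) auto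

lemma polyfun_imp_mpoly:
  fixes \<phi> :: "('v \<Rightarrow> 'a::comm_semiring_1) \<Rightarrow> 'a"
  assumes "polyfun V \<phi>"
  shows "\<exists>f. mpoly_vars f \<subseteq> V \<and> \<phi> = (\<lambda>c. mpoly_eval c f)"
  using assms
proof (induction rule: polyfun.induct)
  case (const a)
  show ?case
    by (rule exI[of _ "Poly_Mapping.single 0 a"])
      (auto simp: mpoly_vars_def mpoly_eval_single mono_eval_def)
next
  case (var v)
  then show ?case
    by (intro exI[of _ "Poly_Mapping.single (Poly_Mapping.single v 1) 1"])
      (auto simp: mpoly_vars_def mpoly_eval_single mono_eval_def)
next
  case (add f g)
  then obtain p q where "mpoly_vars p \<subseteq> V" "f = (\<lambda>c. mpoly_eval c p)"
    "mpoly_vars q \<subseteq> V" "g = (\<lambda>c. mpoly_eval c q)" by blast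
  moreover have "mpoly_vars (p + q) \<subseteq> mpoly_vars p \<union> mpoly_vars q"
    using Poly_Mapping.keys_add[of p q] unfolding mpoly_vars_def by blast
  ultimately show ?case
    by (intro exI[of _ "p + q"]) (auto simp: mpoly_eval_add)
next
  case (mult f g)
  then obtain p q where pq: "mpoly_vars p \<subseteq> V" "f = (\<lambda>c. mpoly_eval c p)"
    "mpoly_vars q \<subseteq> V" "g = (\<lambda>c. mpoly_eval c q)" by blast
  have "mpoly_vars (p * q) \<subseteq> V"
  proof
    fix v assume "v \<in> mpoly_vars (p * q)"
    then obtain m where m: "m \<in> Poly_Mapping.keys (p * q)" "v \<in> Poly_Mapping.keys m"
      by (auto simp: mpoly_vars_def)
    then obtain a b where "m = a + b" "a \<in> Poly_Mapping.keys p" "b \<in> Poly_Mapping.keys q"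
      using keys_mult[of p q] by blast
    then show "v \<in> V"
      using m(2) pq(1,3) Poly_Mapping.keys_add[of a b] unfolding mpoly_vars_def by blast
  qed
  then show ?case using pq
    by (intro exI[of _ "p * q"]) (auto simp: mpoly_eval_mult)
qed

text \<open>\<open>P\<close> holds on a nonempty principal open subset of the affine space whose coordinates are the variables
  in \<open>V\<close>.\<close>

definition generically :: "'v set \<Rightarrow> (('v \<Rightarrow> 'a::comm_ring_1) \<Rightarrow> bool) \<Rightarrow> bool" where
  "generically V P \<longleftrightarrow> (\<exists>\<phi>. polyfun V \<phi> \<and> (\<exists>c. \<phi> c \<noteq> 0) \<and> (\<forall>c. \<phi> c \<noteq> 0 \<longrightarrow> P c))"

lemma genericallyI: "polyfun V \<phi> \<Longrightarrow> \<phi> c \<noteq> 0 \<Longrightarrow> (\<And>c. \<phi> c \<noteq> 0 \<Longrightarrow> P c) \<Longrightarrow> generically V P"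
  unfolding generically_def by blast

lemma generically_nonzero: "polyfun V \<phi> \<Longrightarrow> \<phi> c \<noteq> 0 \<Longrightarrow> generically V (\<lambda>c. \<phi> c \<noteq> 0)"
  by (rule genericallyI)

lemma generically_mono: "generically V P \<Longrightarrow> (\<And>c. P c \<Longrightarrow> Q c) \<Longrightarrow> generically V Q"
  unfolding generically_def by blast

lemma generically_ex: "generically V P \<Longrightarrow> \<exists>c. P c"
  unfolding generically_def by blast

lemma polyfun_subst_poly:
  fixes \<phi> :: "('v \<Rightarrow> 'a::comm_ring_1) \<Rightarrow> 'a"
  assumes "polyfun V \<phi>"
  shows "\<exists>p. \<forall>t. poly p t = \<phi> (\<lambda>v. poly (q v) t)"
  using assms
proof (induction rule: polyfun.induct)
  case (const a)
  show ?case by (rule exI[of _ "[:a:]"]) simp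
next
  case (add f g)
  then show ?case by (metis poly_add)
next
  case (mult f g)
  then show ?case by (metis poly_mult)
qed auto

lemma poly_eq_0_of_cofinite:
  fixes p :: "'a::{idom,ring_char_0} poly"
  assumes "finite Z" "\<And>t. t \<notin> Z \<Longrightarrow> poly p t = 0"
  shows "p = 0"
proof (rule ccontr)
  assume "p \<noteq> 0"
  then have "finite ({t. poly p t = 0} \<union> Z)" using poly_roots_finite assms(1) by blast
  moreover have "{t. poly p t = 0} \<union> Z = UNIV" using assms(2) by auto
  ultimately show False using infinite_UNIV_char_0[where 'a='a] by simp
qed

text \<open>Affine space is irreducible: on the line through a point where \<open>\<phi>\<close> does not vanish and one where \<open>\<psi>\<close>
  does not, both are nonzero one-variable polynomials, so all but finitely many points of that line
  serve for both.\<close>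

lemma generically_conj:
  fixes P Q :: "('v \<Rightarrow> 'a::{idom,ring_char_0}) \<Rightarrow> bool"
  assumes "generically V P" "generically V Q"
  shows "generically V (\<lambda>c. P c \<and> Q c)"
proof -
  obtain \<phi> a where \<phi>: "polyfun V \<phi>" "\<phi> a \<noteq> 0" "\<And>c. \<phi> c \<noteq> 0 \<Longrightarrow> P c"
    using assms(1) unfolding generically_def by blast
  obtain \<psi> b where \<psi>: "polyfun V \<psi>" "\<psi> b \<noteq> 0" "\<And>c. \<psi> c \<noteq> 0 \<Longrightarrow> Q c"
    using assms(2) unfolding generically_def by blast
  define l where "l t = (\<lambda>v. poly [:a v, b v - a v:] t)" for t
  obtain p q where p: "\<And>t. poly p t = \<phi> (l t)" and q: "\<And>t. poly q t = \<psi> (l t)"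
    using polyfun_subst_poly[OF \<phi>(1), of "\<lambda>v. [:a v, b v - a v:]"]
      polyfun_subst_poly[OF \<psi>(1), of "\<lambda>v. [:a v, b v - a v:]"] unfolding l_def by blast
  have "l 0 = a" "l 1 = b" by (auto simp: l_def)
  then have "p \<noteq> 0" "q \<noteq> 0" using p[of 0] q[of 1] \<phi>(2) \<psi>(2) by auto
  then have "p * q \<noteq> 0" by simp
  then obtain t where "poly (p * q) t \<noteq> 0"
    using poly_eq_0_of_cofinite[of "{}" "p * q"] by auto
  then have "\<phi> (l t) * \<psi> (l t) \<noteq> 0" by (simp add: p q)
  moreover have "polyfun V (\<lambda>c. \<phi> c * \<psi> c)" by (intro polyfun_intros \<phi> \<psi>)
  ultimately show ?thesis using \<phi>(3) \<psi>(3)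
    by (intro genericallyI[of V "\<lambda>c. \<phi> c * \<psi> c" "l t"]) auto
qed

lemma generically_True: "generically V (\<lambda>c :: 'v \<Rightarrow> 'a::comm_ring_1. True)"
  by (rule genericallyI[of V "\<lambda>c. 1"]) (auto intro: polyfun.intros)

lemma generically_ball:
  fixes P :: "'i \<Rightarrow> ('v \<Rightarrow> 'a::{idom,ring_char_0}) \<Rightarrow> bool"
  assumes "finite I" "\<And>i. i \<in> I \<Longrightarrow> generically V (P i)"
  shows "generically V (\<lambda>c. \<forall>i\<in>I. P i c)"
  using assms by (induction I rule: finite_induct) (auto simp: generically_True intro: generically_conj)

text \<open>A vector space over an infinite field is not a finite union of hyperplanes.\<close>

lemma ex_linear_form_nonzero_on_finite:
  fixes W :: "('i \<Rightarrow> 'a::{idom,ring_char_0}) set"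
  assumes "finite W" "finite I" "\<And>w. w \<in> W \<Longrightarrow> \<exists>i\<in>I. w i \<noteq> 0"
  shows "\<exists>a. \<forall>w\<in>W. (\<Sum>i\<in>I. a i * w i) \<noteq> 0"
proof -
  have "generically I (\<lambda>a. (\<Sum>i\<in>I. a i * w i) \<noteq> 0)" if "w \<in> W" for w
  proof -
    obtain i where i: "i \<in> I" "w i \<noteq> 0" using assms(3) \<open>w \<in> W\<close> by blast
    show ?thesis
    proof (rule generically_nonzero)
      show "polyfun I (\<lambda>a. \<Sum>i\<in>I. a i * w i)" by (intro polyfun_intros) auto
      have "(\<Sum>j\<in>I. (if j = i then 1 else 0) * w j) = (\<Sum>j\<in>I. if j = i then w j else 0)"
        by (rule sum.cong) auto
      then show "(\<Sum>j\<in>I. (if j = i then 1 else 0) * w j) \<noteq> 0" using i assms(2) by simp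
    qed
  qed
  then have "generically I (\<lambda>a. \<forall>w\<in>W. (\<Sum>i\<in>I. a i * w i) \<noteq> 0)"
    using assms(1) by (intro generically_ball)
  then show ?thesis by (rule generically_ex)
qed

section \<open>Distinct roots in families of polynomials\<close>

text \<open>One-variable polynomials that depend polynomially on parameters. Without the uniform degree bound the
  value at a fixed point would not have to be a polynomial function of the parameters.\<close>

definition poly_family :: "'v set \<Rightarrow> (('v \<Rightarrow> 'a::comm_ring_1) \<Rightarrow> 'a poly) \<Rightarrow> bool" where
  "poly_family V R \<longleftrightarrow> (\<forall>j. polyfun V (\<lambda>c. coeff (R c) j)) \<and> (\<exists>N. \<forall>c. degree (R c) \<le> N)"

lemma poly_family_const: "poly_family V (\<lambda>c. p)"
  by (auto simp: poly_family_def intro: polyfun_intros)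

lemma poly_family_smult:
  assumes "polyfun V f" "poly_family V R"
  shows "poly_family V (\<lambda>c. smult (f c) (R c))"
proof -
  obtain N where "\<And>c. degree (R c) \<le> N" using assms(2) unfolding poly_family_def by blast
  then have "degree (smult (f c) (R c)) \<le> N" for c using degree_smult_le order_trans by blast
  then show ?thesis using assms unfolding poly_family_def coeff_smult by (auto intro: polyfun.mult)
qed

lemma poly_family_add: "poly_family V R \<Longrightarrow> poly_family V S \<Longrightarrow> poly_family V (\<lambda>c. R c + S c)"
proof -
  assume a: "poly_family V R" "poly_family V S"
  obtain M N where "\<And>c. degree (R c) \<le> M" "\<And>c. degree (S c) \<le> N"
    using a unfolding poly_family_def by metis
  then have "degree (R c + S c) \<le> max M N" for c
    by (meson degree_add_le max.coboundedI1 max.coboundedI2)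
  then show ?thesis using a unfolding poly_family_def coeff_add by (auto intro: polyfun_intros)
qed

lemma poly_family_mult: "poly_family V R \<Longrightarrow> poly_family V S \<Longrightarrow> poly_family V (\<lambda>c. R c * S c)"
proof -
  assume a: "poly_family V R" "poly_family V S"
  obtain M N where "\<And>c. degree (R c) \<le> M" "\<And>c. degree (S c) \<le> N"
    using a unfolding poly_family_def by metis
  then have "degree (R c * S c) \<le> M + N" for c
    by (meson add_mono degree_mult_le order_trans)
  then show ?thesis using a unfolding poly_family_def coeff_mult by (auto intro!: polyfun_intros)
qed

lemma poly_family_diff: "poly_family V R \<Longrightarrow> poly_family V S \<Longrightarrow> poly_family V (\<lambda>c. R c - S c)"
  using poly_family_add[OF _ poly_family_smult[OF polyfun.const[of V "-1"]], of R S] by simp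

lemma poly_family_sum:
  "(\<And>i. i \<in> I \<Longrightarrow> poly_family V (R i)) \<Longrightarrow> poly_family V (\<lambda>c. \<Sum>i\<in>I. R i c)"
  by (induction I rule: infinite_finite_induct) (auto intro: poly_family_const poly_family_add)

lemma poly_family_pderiv:
  fixes R :: "('v \<Rightarrow> 'a::{idom,ring_char_0}) \<Rightarrow> 'a poly"
  assumes "poly_family V R" shows "poly_family V (\<lambda>c. pderiv (R c))"
  unfolding poly_family_def
proof (intro conjI allI)
  obtain N where "\<And>c. degree (R c) \<le> N" using assms unfolding poly_family_def by blast
  moreover have "degree (pderiv (R c)) \<le> degree (R c)" for c
    by (simp add: degree_pderiv)
  ultimately show "\<exists>N. \<forall>c. degree (pderiv (R c)) \<le> N" by (meson order_trans)
qed (use assms in \<open>auto simp: coeff_pderiv poly_family_def intro!: polyfun.mult polyfun.const\<close>)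

lemmas poly_family_intros = poly_family_const poly_family_smult poly_family_add poly_family_mult
  poly_family_diff poly_family_sum poly_family_pderiv

lemma polyfun_poly_family:
  assumes "poly_family V R" shows "polyfun V (\<lambda>c. poly (R c) t)"
proof -
  obtain N where "\<And>c. degree (R c) \<le> N" using assms unfolding poly_family_def by blast
  then have "poly (R c) t = (\<Sum>i\<le>N. coeff (R c) i * t ^ i)" for c
    using poly_as_sum_of_monoms'[of "R c" N] poly_sum[of "\<lambda>i. monom (coeff (R c) i) i" "{..N}" t]
    by (simp only: poly_monom)
  moreover have "polyfun V (\<lambda>c. \<Sum>i\<le>N. coeff (R c) i * t ^ i)"
    using assms unfolding poly_family_def by (intro polyfun_sum polyfun.mult polyfun.const) blast
  ultimately show ?thesis by simp
qed

lemma poly_family_subst: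
  assumes "poly_family V R" "\<And>v. v \<in> V \<Longrightarrow> polyfun W (\<lambda>c. q c v)"
  shows "poly_family W (\<lambda>c. R (q c))"
  unfolding poly_family_def
proof (intro conjI allI)
  fix j
  show "polyfun W (\<lambda>c. coeff (R (q c)) j)"
    by (rule polyfun_substitute[of V "\<lambda>c. coeff (R c) j"])
      (use assms in \<open>auto simp: poly_family_def\<close>)
qed (use assms in \<open>auto simp: poly_family_def\<close>)

text \<open>Having independent columns is an open condition. One step of fraction-free Gaussian elimination, with
  a pivot that is nonzero at \<open>c0\<close>, removes one column; the product of the pivots is the polynomial \<open>\<phi>\<close>.
  Compared with a nonvanishing minor this keeps the number of rows arbitrary, so that a row may be taken
  for every coefficient of a polynomial.\<close>

lemma generic_full_column_rank:
  fixes M :: "('v \<Rightarrow> 'a::field) \<Rightarrow> 'r \<Rightarrow> 's \<Rightarrow> 'a"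
  assumes "finite B" "\<And>i j. j \<in> B \<Longrightarrow> polyfun V (\<lambda>c. M c i j)"
    and "\<And>v. (\<And>i. (\<Sum>j\<in>B. M c0 i j * v j) = 0) \<Longrightarrow> \<forall>j\<in>B. v j = 0"
  shows "\<exists>\<phi>. polyfun V \<phi> \<and> \<phi> c0 \<noteq> 0 \<and>
     (\<forall>c v. \<phi> c \<noteq> 0 \<longrightarrow> (\<forall>i. (\<Sum>j\<in>B. M c i j * v j) = 0) \<longrightarrow> (\<forall>j\<in>B. v j = 0))"
  using assms
proof (induction B arbitrary: M rule: finite_induct)
  case empty
  show ?case by (rule exI[of _ "\<lambda>c. 1"]) (auto intro: polyfun_intros)
next
  case (insert b B)
  have "\<exists>a. M c0 a b \<noteq> 0"
  proof (rule ccontr)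
    assume "\<not> ?thesis"
    then have "(\<Sum>j\<in>insert b B. M c0 i j * (if j = b then 1 else 0)) = 0" for i
      by (auto intro!: sum.neutral)
    then show False using insert.prems(2)[of "\<lambda>j. if j = b then 1 else 0"] by auto
  qed
  then obtain a where a: "M c0 a b \<noteq> 0" by blast
  define N where "N c i j = M c a b * M c i j - M c i b * M c a j" for c i j
  have N_sum: "(\<Sum>j\<in>B. N c i j * v j) =
      M c a b * (\<Sum>j\<in>B. M c i j * v j) - M c i b * (\<Sum>j\<in>B. M c a j * v j)" for c i v
    by (simp add: N_def left_diff_distrib sum_subtractf sum_distrib_left mult.assoc)
  have "\<forall>j\<in>B. v j = 0" if v: "\<And>i. (\<Sum>j\<in>B. N c0 i j * v j) = 0" for v
  proof -
    \<comment> \<open>A kernel vector of the reduced matrix extends to one of the full matrix: solve the pivot row for the entry at \<open>b\<close>.\<close>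
    define w where "w j = (if j = b then - (\<Sum>j\<in>B. M c0 a j * v j) / M c0 a b else v j)" for j
    have "(\<Sum>j\<in>insert b B. M c0 i j * w j) = 0" for i
    proof -
      have "(\<Sum>j\<in>B. M c0 i j * w j) = (\<Sum>j\<in>B. M c0 i j * v j)"
        using insert.hyps by (intro sum.cong) (auto simp: w_def)
      then show ?thesis using insert.hyps v[of i] a unfolding N_sum
        by (simp add: w_def field_simps)
    qed
    then have "\<forall>j\<in>insert b B. w j = 0" using insert.prems(2) by blast
    then show ?thesis using insert.hyps by (metis insertI2 w_def)
  qed
  moreover have "polyfun V (\<lambda>c. N c i j)" if "j \<in> B" for i j
    unfolding N_def using insert.prems(1) that by (intro polyfun_intros) auto
  ultimately obtain \<psi> where \<psi>: "polyfun V \<psi>" "\<psi> c0 \<noteq> 0"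
    "\<And>c v. \<psi> c \<noteq> 0 \<Longrightarrow> (\<And>i. (\<Sum>j\<in>B. N c i j * v j) = 0) \<Longrightarrow> \<forall>j\<in>B. v j = 0"
    using insert.IH[of N] by blast
  show ?case
  proof (intro exI[of _ "\<lambda>c. M c a b * \<psi> c"] conjI allI impI)
    show "polyfun V (\<lambda>c. M c a b * \<psi> c)" using insert.prems(1) \<psi>(1) by (intro polyfun_intros) auto
    show "M c0 a b * \<psi> c0 \<noteq> 0" using a \<psi>(2) by simp
  next
    fix c v assume c: "M c a b * \<psi> c \<noteq> 0" and v: "\<forall>i. (\<Sum>j\<in>insert b B. M c i j * v j) = 0"
    have s: "(\<Sum>j\<in>B. M c i j * v j) = - M c i b * v b" for i
      using v[rule_format, of i] insert.hyps by (simp add: add_eq_0_iff)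
    have "(\<Sum>j\<in>B. N c i j * v j) = 0" for i by (simp add: N_sum s)
    then have 0: "\<forall>j\<in>B. v j = 0" using \<psi>(3) c by auto
    then have "M c a b * v b = 0" using s[of a] by simp
    then show "\<forall>j\<in>insert b B. v j = 0" using 0 c by auto
  qed
qed

text \<open>Over an algebraically closed field divisibility can be tested root by root.\<close>

lemma alg_closed_dvdI:
  fixes p q :: "'a::alg_closed_field poly"
  assumes "p \<noteq> 0" "q \<noteq> 0" "\<And>x. order x p \<le> order x q"
  shows "p dvd q"
  using assms
proof (induction "degree p" arbitrary: p q rule: less_induct)
  case less
  show ?case
  proof (cases "degree p = 0")
    case True
    then show ?thesis using less.prems(1) by (metis is_unit_iff_degree unit_imp_dvd)
  next
    case False
    then obtain x where x: "poly p x = 0" using alg_closed_imp_poly_has_root by blast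
    then have "poly q x = 0" using less.prems order_root by (metis le_zero_eq)
    then obtain p1 q1 where pq: "p = [:-x, 1:] * p1" "q = [:-x, 1:] * q1"
      using x by (metis dvdE poly_eq_0_iff_dvd)
    then have nz: "p1 \<noteq> 0" "q1 \<noteq> 0" using less.prems by auto
    have "degree p = Suc (degree p1)"
      unfolding pq(1) using nz by (subst degree_mult_eq) auto
    moreover have "order y p1 \<le> order y q1" for y
      using less.prems(3)[of y] less.prems(1,2) unfolding pq by (simp add: order_mult del: mult_pCons_left)
    ultimately have "p1 dvd q1" using less.hyps nz by simp
    then show ?thesis unfolding pq by (rule mult_dvd_mono[OF dvd_refl])
  qed
qed

definition roots :: "'a::comm_ring_1 poly \<Rightarrow> 'a set" where "roots p = {t. poly p t = 0}"

lemma finite_roots: "p \<noteq> 0 \<Longrightarrow> finite (roots (p :: 'a::idom poly))"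
  unfolding roots_def by (rule poly_roots_finite)

lemma card_roots_le: "p \<noteq> 0 \<Longrightarrow> card (roots (p :: 'a::idom poly)) \<le> degree p"
  unfolding roots_def by (rule card_poly_roots_bound)

lemma many_roots_imp_0: "R \<subseteq> roots p \<Longrightarrow> finite R \<Longrightarrow> degree p < card R \<Longrightarrow> (p :: 'a::idom poly) = 0"
  by (metis card_mono card_roots_le finite_roots leD order_trans)

lemma poly_as_monom_sum:
  fixes p :: "'a::comm_ring_1 poly"
  assumes "p = 0 \<or> degree p < n"
  shows "(\<Sum>i<n. monom (coeff p i) i) = p"
proof (rule poly_eqI)
  fix j
  have "coeff p j = 0" if "\<not> j < n" using that assms by (auto simp: coeff_eq_0)
  then show "coeff (\<Sum>i<n. monom (coeff p i) i) j = coeff p j"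
    by (auto simp: coeff_sum)
qed

lemma degree_monom_sum_less:
  fixes v :: "nat \<Rightarrow> 'a::comm_ring_1"
  assumes "n > 0"
  shows "degree (\<Sum>i<n. monom (v i) i) < n"
proof -
  have "degree (\<Sum>i<n. monom (v i) i) \<le> n - 1"
    by (intro degree_sum_le) (auto intro: order_trans[OF degree_monom_le])
  then show ?thesis using assms by linarith
qed

lemma coeff_monom_sum: "coeff (\<Sum>i<n. monom (v i) i) j = (if j < n then v j else 0)"
  by (auto simp: coeff_sum)

text \<open>The reduced relation between \<open>f\<close> and its derivative: take \<open>v = \<Prod>\<^sub>r (X - r)\<close> over the distinct roots. At
  every root the order of \<open>f'\<close> is one less than that of \<open>f\<close>, which \<open>v\<close> makes up for, so \<open>f\<close> divides
  \<open>v f'\<close>.\<close>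

lemma syzygy_of_few_roots:
  fixes f :: "'a::{alg_closed_field,field_char_0} poly"
  assumes "f \<noteq> 0"
  shows "\<exists>u v. u * f + v * pderiv f = 0 \<and> v \<noteq> 0 \<and> degree v = card (roots f) \<and>
           (u = 0 \<or> degree u < card (roots f))"
proof -
  define e where "e = (\<Prod>r\<in>roots f. [:-r, 1:])"
  have fin: "finite (roots f)" using assms by (rule finite_roots)
  have e: "e \<noteq> 0" "degree e = card (roots f)"
    unfolding e_def by (auto simp: degree_prod_eq_sum_degree fin)
  show ?thesis
  proof (cases "pderiv f = 0")
    case True
    then show ?thesis using e by (intro exI[of _ 0] exI[of _ e]) auto
  next
    case False
    have "f dvd e * pderiv f"
    proof (rule alg_closed_dvdI)
      fix x
      show "order x f \<le> order x (e * pderiv f)"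
      proof (cases "poly f x = 0")
        case True
        then have "poly e x = 0" unfolding e_def using fin by (auto simp: roots_def poly_prod)
        then have "order x e \<ge> 1" using e(1) by (metis One_nat_def Suc_leI gr0I order_root)
        then show ?thesis using order_pderiv[OF assms True] e(1) False by (simp add: order_mult)
      qed (simp add: order_0I)
    qed (use assms e False in auto)
    then obtain u where u: "e * pderiv f = f * u" by (rule dvdE)
    then have "u \<noteq> 0" using e False by auto
    then have "degree e + (degree f - 1) = degree f + degree u"
      using arg_cong[OF u, of degree] e False assms by (simp add: degree_mult_eq degree_pderiv)
    moreover have "degree f \<noteq> 0" using False by (metis pderiv_eq_0_iff)
    ultimately have "degree u < degree e" by linarith
    then show ?thesis using u e by (intro exI[of _ "-u"] exI[of _ e]) (auto simp: algebra_simps)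
  qed
qed

text \<open>Conversely every relation \<open>u f + v f' = 0\<close> forces \<open>v\<close> to vanish at all roots of \<open>f\<close>. The degree of the
  smallest nontrivial relation thus counts the distinct roots, however large their multiplicities.\<close>

lemma no_syzygy_of_many_roots:
  fixes f u v :: "'a::{idom,ring_char_0} poly"
  assumes "f \<noteq> 0" "u * f + v * pderiv f = 0" "degree v < card (roots f)"
  shows "u = 0 \<and> v = 0"
proof -
  have "roots f \<subseteq> roots v"
  proof
    fix r assume "r \<in> roots f"
    then have r: "poly f r = 0" by (simp add: roots_def)
    show "r \<in> roots v"
    proof (rule ccontr)
      assume "r \<notin> roots v"
      then have "v \<noteq> 0" "poly v r \<noteq> 0" by (auto simp: roots_def)
      have "f dvd v * pderiv f"
        using assms(2) by (metis add_eq_0_iff dvd_minus_iff dvd_triv_right minus_minus)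
      moreover have "pderiv f \<noteq> 0"
      proof
        assume "pderiv f = 0"
        then obtain a where "f = [:a:]" by (metis pderiv_eq_0_iff degree_eq_zeroE)
        then show False using r assms(1) by simp
      qed
      ultimately have "order r f \<le> order r v + order r (pderiv f)"
        using \<open>v \<noteq> 0\<close> by (metis dvd_imp_order_le mult_eq_0_iff order_mult)
      also have "order r v = 0" using \<open>poly v r \<noteq> 0\<close> by (rule order_0I)
      finally show False using order_pderiv[OF assms(1) r] by simp
    qed
  qed
  then have "v = 0" using many_roots_imp_0 assms finite_roots by blast
  then show ?thesis using assms by simp
qed

text \<open>Having at least \<open>k\<close> distinct roots means that there is no nontrivial relation \<open>u f + v f' = 0\<close> with
  \<open>deg u < k - 1\<close> and \<open>deg v < k\<close>, that is, that the polynomials \<open>X\<^sup>i f\<close> and \<open>X\<^sup>j f'\<close> in that range are linearly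
  independent. This is an open condition by \<open>generic_full_column_rank\<close>.\<close>

lemma many_roots_open:
  fixes R :: "('v \<Rightarrow> 'a::{alg_closed_field,field_char_0}) \<Rightarrow> 'a poly"
  assumes R: "poly_family V R" and "R c0 \<noteq> 0" and k: "k \<le> card (roots (R c0))"
  shows "\<exists>\<phi>. polyfun V \<phi> \<and> \<phi> c0 \<noteq> 0 \<and> (\<forall>c. \<phi> c \<noteq> 0 \<longrightarrow> R c \<noteq> 0 \<and> k \<le> card (roots (R c)))"
proof (cases "k = 0")
  case True
  obtain t where "coeff (R c0) t \<noteq> 0" using assms(2) by (metis coeff_0 poly_eqI)
  then show ?thesis using True R unfolding poly_family_def
    by (intro exI[of _ "\<lambda>c. coeff (R c) t"]) auto
next
  case False
  \<comment> \<open>The columns are the coefficient vectors of the products \<open>X\<^sup>i f\<close> and \<open>X\<^sup>j f'\<close>; a vector \<open>w\<close> of scalars stands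
    for the pair \<open>(u w, v w)\<close>.\<close>
  define B :: "(nat + nat) set" where "B = {..<k-1} <+> {..<k}"
  define M where "M c m j = coeff (case j of Inl i \<Rightarrow> monom 1 i * R c
      | Inr i \<Rightarrow> monom 1 i * pderiv (R c)) m" for c m j
  define u where "u w = (\<Sum>i<k-1. monom (w (Inl i)) i)" for w :: "nat + nat \<Rightarrow> 'a"
  define v where "v w = (\<Sum>i<k. monom (w (Inr i)) i)" for w :: "nat + nat \<Rightarrow> 'a"
  have sum: "(\<Sum>j\<in>B. M c m j * w j) = coeff (u w * R c + v w * pderiv (R c)) m" for c m w
  proof -
    have 1: "monom a i * p = smult a (monom 1 i * p)" for a i and p :: "'a poly"
      by (metis mult_smult_left mult.right_neutral smult_monom)
    have "(\<Sum>j\<in>B. M c m j * w j) =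
        (\<Sum>i<k-1. coeff (monom (w (Inl i)) i * R c) m) +
        (\<Sum>i<k. coeff (monom (w (Inr i)) i * pderiv (R c)) m)"
      unfolding B_def by (subst sum.Plus) (simp_all add: M_def 1[of "w _" _ "R c"] 1[of "w _" _ "pderiv (R c)"]
        mult.commute[of "coeff _ _"])
    then show ?thesis by (simp add: u_def v_def sum_distrib_right coeff_sum)
  qed
  have deg: "degree (v w) < k" for w unfolding v_def using False by (intro degree_monom_sum_less) auto
  have fin: "finite B" by (simp add: B_def)
  have coeffs: "w (Inl i) = coeff (u w) i" if "i < k - 1" for w i
    using that by (simp add: u_def coeff_monom_sum)
  have coeffs': "w (Inr i) = coeff (v w) i" if "i < k" for w i
    using that by (simp add: v_def coeff_monom_sum)
  \<comment> \<open>Independence at \<open>c0\<close>, where there are enough roots.\<close>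
  have inj: "\<forall>j\<in>B. w j = 0" if w: "\<And>m. (\<Sum>j\<in>B. M c0 m j * w j) = 0" for w
  proof -
    have "u w * R c0 + v w * pderiv (R c0) = 0" using w unfolding sum by (simp add: poly_eq_iff)
    then have "u w = 0 \<and> v w = 0"
      using assms(2) deg[of w] k by (intro no_syzygy_of_many_roots) auto
    then have "w (Inl i) = 0" if "i < k - 1" for i using coeffs[OF that, of w] by simp
    moreover have "w (Inr i) = 0" if "i < k" for i
      using coeffs'[OF that, of w] \<open>u w = 0 \<and> v w = 0\<close> by simp
    ultimately show ?thesis by (auto simp: B_def)
  qed
  have "polyfun V (\<lambda>c. M c m j)" for m j
  proof -
    have "poly_family V (\<lambda>c. case j of Inl i \<Rightarrow> monom 1 i * R c | Inr i \<Rightarrow> monom 1 i * pderiv (R c))"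
      using R by (cases j) (auto intro!: poly_family_intros)
    then show ?thesis unfolding M_def poly_family_def by blast
  qed
  then obtain \<phi> where \<phi>: "polyfun V \<phi>" "\<phi> c0 \<noteq> 0"
    "\<And>c w. \<phi> c \<noteq> 0 \<Longrightarrow> (\<And>i. (\<Sum>j\<in>B. M c i j * w j) = 0) \<Longrightarrow> \<forall>j\<in>B. w j = 0"
    using generic_full_column_rank[OF fin, of V M c0] inj by blast
  have "R c \<noteq> 0 \<and> k \<le> card (roots (R c))" if c: "\<phi> c \<noteq> 0" for c
  proof -
    have inj: "q = 0" if pq: "p * R c + q * pderiv (R c) = 0"
      "p = 0 \<or> degree p < k - 1" "degree q < k" for p q
    proof -
      define w where "w j = (case j of Inl i \<Rightarrow> coeff p i | Inr i \<Rightarrow> coeff q i)" for j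
      have "u w = p" "v w = q" unfolding u_def v_def w_def using pq poly_as_monom_sum by auto
      then have "\<forall>j\<in>B. w j = 0" using \<phi>(3)[OF c, of w] pq(1) by (simp add: sum)
      then have "coeff q i = 0" if "i < k" for i using that by (force simp: B_def w_def)
      then show "q = 0" using pq(3) by (metis leading_coeff_0_iff)
    qed
    have nz: "R c \<noteq> 0" using inj[of 0 1] False by auto
    moreover have "k \<le> card (roots (R c))"
    proof (rule ccontr)
      assume "\<not> ?thesis"
      moreover obtain p q where "p * R c + q * pderiv (R c) = 0" "q \<noteq> 0"
        "degree q = card (roots (R c))" "p = 0 \<or> degree p < card (roots (R c))"
        using syzygy_of_few_roots[OF nz] by blast
      ultimately show False using inj[of p q] by linarith
    qed
    ultimately show ?thesis by simp
  qed
  then show ?thesis using \<phi> by blast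
qed

text \<open>The maximal number of distinct roots is attained somewhere, hence on an open set.\<close>

lemma generic_number_of_roots:
  fixes R :: "('v \<Rightarrow> 'a::{alg_closed_field,field_char_0}) \<Rightarrow> 'a poly"
  assumes R: "poly_family V R" and "R c0 \<noteq> 0"
  obtains k where "generically V (\<lambda>c. R c \<noteq> 0 \<and> card (roots (R c)) = k)"
    "\<And>c. R c \<noteq> 0 \<Longrightarrow> card (roots (R c)) \<le> k"
proof -
  define S where "S = {card (roots (R c)) | c. R c \<noteq> 0}"
  obtain N where N: "\<And>c. degree (R c) \<le> N" using R unfolding poly_family_def by blast
  have "S \<subseteq> {..N}" using N card_roots_le unfolding S_def by (fastforce intro: order_trans)
  then have fin: "finite S" by (rule finite_subset) simp
  have "S \<noteq> {}" using assms(2) by (auto simp: S_def)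
  then have "Max S \<in> S" using fin by (rule Max_in[rotated])
  then obtain c1 where c1: "R c1 \<noteq> 0" "card (roots (R c1)) = Max S" by (auto simp: S_def)
  have le: "card (roots (R c)) \<le> Max S" if "R c \<noteq> 0" for c
    using fin that by (intro Max_ge) (auto simp: S_def)
  obtain \<phi> where "polyfun V \<phi>" "\<phi> c1 \<noteq> 0" "\<And>c. \<phi> c \<noteq> 0 \<Longrightarrow> R c \<noteq> 0 \<and> Max S \<le> card (roots (R c))"
    using many_roots_open[OF R c1(1), of "Max S"] c1(2) by auto
  then have "generically V (\<lambda>c. R c \<noteq> 0 \<and> card (roots (R c)) = Max S)"
    using le by (intro genericallyI[of V \<phi> c1]) (auto intro: antisym)
  then show ?thesis using le by (rule that)
qed

text \<open>A point of \<open>Z\<close> is either a root of every member of the family or generically not a root.\<close>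

lemma generic_number_of_roots_off_finite:
  fixes R :: "('v \<Rightarrow> 'a::{alg_closed_field,field_char_0}) \<Rightarrow> 'a poly"
  assumes R: "poly_family V R" and "R c0 \<noteq> 0" and Z: "finite Z"
  obtains k where "generically V (\<lambda>c. R c \<noteq> 0 \<and> card (roots (R c) - Z) = k)"
proof -
  obtain k where k: "generically V (\<lambda>c. R c \<noteq> 0 \<and> card (roots (R c)) = k)"
    by (rule generic_number_of_roots[OF R assms(2)])
  define Y where "Y = {z\<in>Z. \<forall>c. poly (R c) z = 0}"
  have "generically V (\<lambda>c. \<forall>z\<in>Z - Y. poly (R c) z \<noteq> 0)"
  proof (intro generically_ball)
    fix z assume "z \<in> Z - Y"
    then obtain c where "poly (R c) z \<noteq> 0" by (auto simp: Y_def)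
    then show "generically V (\<lambda>c. poly (R c) z \<noteq> 0)"
      using polyfun_poly_family[OF R] by (intro generically_nonzero)
  qed (use Z in auto)
  then have "generically V (\<lambda>c. (R c \<noteq> 0 \<and> card (roots (R c)) = k) \<and> (\<forall>z\<in>Z - Y. poly (R c) z \<noteq> 0))"
    by (intro generically_conj k)
  then have "generically V (\<lambda>c. R c \<noteq> 0 \<and> card (roots (R c) - Z) = k - card Y)"
  proof (rule generically_mono, safe)
    fix c assume c: "R c \<noteq> 0" "\<forall>z\<in>Z - Y. poly (R c) z \<noteq> 0" 
    have "roots (R c) - Z = roots (R c) - Y" using c(2) by (auto simp: roots_def Y_def)
    moreover have "Y \<subseteq> roots (R c)" by (auto simp: roots_def Y_def)
    moreover have "finite Y" using Z by (simp add: Y_def)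
    ultimately show "card (roots (R c) - Z) = card (roots (R c)) - card Y"
      by (simp add: card_Diff_subset)
  qed
  then show ?thesis by (rule that)
qed

text \<open>The number of common roots outside \<open>Z\<close> is the number of roots of \<open>R\<close>, plus that of \<open>S\<close>, minus that of
  \<open>R S\<close>, hence generically constant. So it is generically 0 as soon as it is 0 at some point of each
  nonempty open set.\<close>

lemma generic_no_common_root:
  fixes R S :: "('v \<Rightarrow> 'a::{alg_closed_field,field_char_0}) \<Rightarrow> 'a poly"
  assumes R: "poly_family V R" and S: "poly_family V S" and Z: "finite Z"
    and ex: "\<And>\<phi>. polyfun V \<phi> \<Longrightarrow> \<exists>c. \<phi> c \<noteq> 0 \<Longrightarrow>
       \<exists>c. \<phi> c \<noteq> 0 \<and> R c \<noteq> 0 \<and> S c \<noteq> 0 \<and> roots (R c) \<inter> roots (S c) \<subseteq> Z"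
  shows "generically V (\<lambda>c. roots (R c) \<inter> roots (S c) \<subseteq> Z)"
proof -
  obtain c0 where c0: "R c0 \<noteq> 0" "S c0 \<noteq> 0" using ex[OF polyfun.const[of V 1]] by auto
  have RS: "poly_family V (\<lambda>c. R c * S c)" by (intro poly_family_intros R S)
  obtain k where k: "generically V (\<lambda>c. R c \<noteq> 0 \<and> card (roots (R c) - Z) = k)"
    by (rule generic_number_of_roots_off_finite[OF R c0(1) Z])
  obtain l where l: "generically V (\<lambda>c. S c \<noteq> 0 \<and> card (roots (S c) - Z) = l)"
    by (rule generic_number_of_roots_off_finite[OF S c0(2) Z])
  obtain m where m: "generically V (\<lambda>c. R c * S c \<noteq> 0 \<and> card (roots (R c * S c) - Z) = m)"
    by (rule generic_number_of_roots_off_finite[OF RS _ Z, of c0]) (use c0 in auto)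
  let ?com = "\<lambda>c. roots (R c) \<inter> roots (S c) - Z"
  have "generically V (\<lambda>c. R c \<noteq> 0 \<and> S c \<noteq> 0 \<and> card (?com c) + m = k + l)"
    using generically_conj[OF k generically_conj[OF l m]]
  proof (rule generically_mono, safe)
    fix c assume c: "R c \<noteq> 0" "S c \<noteq> 0"
    have "roots (R c * S c) - Z = (roots (R c) - Z) \<union> (roots (S c) - Z)"
      by (auto simp: roots_def)
    moreover have "?com c = (roots (R c) - Z) \<inter> (roots (S c) - Z)" by auto
    ultimately show "card (?com c) + card (roots (R c * S c) - Z) =
        card (roots (R c) - Z) + card (roots (S c) - Z)"
      using card_Un_Int[of "roots (R c) - Z" "roots (S c) - Z"] finite_roots[OF c(1)] finite_roots[OF c(2)]
      by simp
  qed
  then obtain \<phi> where \<phi>: "polyfun V \<phi>" "\<exists>c. \<phi> c \<noteq> 0"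
    "\<And>c. \<phi> c \<noteq> 0 \<Longrightarrow> R c \<noteq> 0 \<and> S c \<noteq> 0 \<and> card (?com c) + m = k + l"
    unfolding generically_def by blast
  obtain c1 where c1: "\<phi> c1 \<noteq> 0" "?com c1 = {}" using ex[OF \<phi>(1,2)] by blast
  then have "m = k + l" using \<phi>(3)[OF c1(1)] by (metis add_0 card.empty)
  have "roots (R c) \<inter> roots (S c) \<subseteq> Z" if "\<phi> c \<noteq> 0" for c
  proof -
    have "card (?com c) = 0" using \<phi>(3)[OF that] \<open>m = k + l\<close> by linarith
    moreover have "finite (?com c)" using \<phi>(3)[OF that] finite_roots[of "R c"] by blast
    ultimately show ?thesis by (simp add: card_eq_0_iff)
  qed
  then show ?thesis
    unfolding generically_def using \<phi>(1) c1(1) by (intro exI[of _ \<phi>] conjI exI[of _ c1] allI impI)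
qed

section \<open>Pencils and linear systems on the line\<close>

lemma card_roots_squarefree:
  fixes p :: "'a::{alg_closed_field,field_char_0} poly"
  assumes sqf: "\<And>t. poly p t = 0 \<Longrightarrow> poly (pderiv p) t \<noteq> 0"
  shows "card (roots p) = degree p"
proof (rule antisym)
  have "rsquarefree p" unfolding rsquarefree_roots using sqf by blast
  then have nz: "p \<noteq> 0" and ord: "\<And>a. order a p = 0 \<or> order a p = 1"
    by (auto simp: rsquarefree_def)
  show "card (roots p) \<le> degree p" using nz by (rule card_roots_le)
  define e where "e = (\<Prod>r\<in>roots p. [:-r, 1:])"
  have fin: "finite (roots p)" using nz by (rule finite_roots)
  have e: "e \<noteq> 0" "degree e = card (roots p)"
    unfolding e_def by (auto simp: degree_prod_eq_sum_degree fin)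
  have "p dvd e"
  proof (rule alg_closed_dvdI)
    fix x
    show "order x p \<le> order x e"
    proof (cases "poly p x = 0")
      case True
      then have "poly e x = 0" unfolding e_def using fin by (auto simp: roots_def poly_prod)
      then have "order x e \<ge> 1" using e(1) by (metis One_nat_def Suc_leI gr0I order_root)
      then show ?thesis using ord[of x] by auto
    qed (simp add: order_0I)
  qed (use nz e in auto)
  then show "degree p \<le> card (roots p)" using e dvd_imp_degree_le by metis
qed

text \<open>In characteristic 0 differentiation lowers the order of \<open>p\<close> at \<open>r\<close> by one, so the two sides of the
  equation would have different orders at \<open>r\<close>. This is the statement that \<open>p/q\<close> is constant if its
  derivative vanishes.\<close>

lemma wronskian_eq_0_imp_eq_0:
  fixes p q :: "'a::{idom,ring_char_0} poly"
  assumes eq: "pderiv p * q = p * pderiv q" and r: "poly p r = 0" "poly q r \<noteq> 0"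
  shows "p = 0"
proof (rule ccontr)
  assume p: "p \<noteq> 0"
  have q: "q \<noteq> 0" using r by auto
  have p': "pderiv p \<noteq> 0"
  proof
    assume "pderiv p = 0"
    then obtain a where "p = [:a:]" by (metis pderiv_eq_0_iff degree_eq_zeroE)
    then show False using r p by simp
  qed
  then have "pderiv q \<noteq> 0" using eq p q by auto
  then have "order r p \<le> order r (p * pderiv q)" using p by (simp add: order_mult)
  also have "\<dots> = order r (pderiv p) + order r q"
    unfolding eq[symmetric] using p' q by (simp add: order_mult)
  also have "order r q = 0" using r(2) by (rule order_0I)
  finally show False using order_pderiv[OF p r(1)] by simp
qed

text \<open>Bertini's theorem for a pencil without base points: at a multiple root \<open>t\<close> of \<open>F - b E\<close> the value \<open>b\<close> is
  the value of \<open>F/E\<close> at one of its finitely many critical points. Besides these only the \<open>b\<close> for which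
  the degree drops has to be excluded.\<close>

lemma pencil_distinct_roots:
  fixes F E :: "'a::{alg_closed_field,field_char_0} poly"
  assumes cop: "\<And>t. poly F t = 0 \<Longrightarrow> poly E t \<noteq> 0"
    and deg: "degree F = D" "degree E \<le> D" and "D > 0"
  shows "finite {b. card (roots (F - smult b E)) \<noteq> D}"
proof -
  define W where "W = pderiv F * E - F * pderiv E"
  obtain r where r: "poly F r = 0" using alg_closed_imp_poly_has_root[of F] deg \<open>D > 0\<close> by auto
  have nz: "F \<noteq> 0" using deg \<open>D > 0\<close> by auto
  have "W \<noteq> 0" using wronskian_eq_0_imp_eq_0[of F E, OF _ r cop[OF r]] nz by (auto simp: W_def)
  have *: "card (roots (F - smult b E)) = D"
    if b: "b * coeff E D \<noteq> coeff F D" "b \<notin> (\<lambda>t. poly F t / poly E t) ` roots W" for b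
  proof -
    let ?p = "F - smult b E"
    have "degree ?p \<le> D" using deg by (intro degree_diff_le) (auto intro: order_trans[OF degree_smult_le])
    moreover have "coeff ?p D \<noteq> 0" using b(1) by simp
    ultimately have "degree ?p = D" by (metis antisym le_degree)
    moreover have "poly (pderiv ?p) t \<noteq> 0" if t: "poly ?p t = 0" for t
    proof
      assume t': "poly (pderiv ?p) t = 0"
      have E: "poly E t \<noteq> 0" using t cop[of t] by auto
      have "poly W t = 0" using t t' by (simp add: W_def pderiv_diff pderiv_smult)
      moreover have "b = poly F t / poly E t" using t E by (simp add: field_simps)
      ultimately show False using b(2) by (auto simp: roots_def)
    qed
    ultimately show ?thesis using card_roots_squarefree[of ?p] by simp
  qed
  have "finite {b. b * coeff E D = coeff F D}"
  proof (cases "coeff E D = 0")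
    case True
    then show ?thesis using deg nz by auto
  next
    case False
    then have "{b. b * coeff E D = coeff F D} = {coeff F D / coeff E D}" by (auto simp: field_simps)
    then show ?thesis by simp
  qed
  then have "finite ({b. b * coeff E D = coeff F D} \<union> (\<lambda>t. poly F t / poly E t) ` roots W)"
    using finite_roots[OF \<open>W \<noteq> 0\<close>] by simp
  then show ?thesis by (rule finite_subset[rotated]) (use * in auto)
qed

text \<open>The coefficient condition says that infinity is not a base point either. The two combinations are
  members of one pencil without base points, so they have no common root.\<close>

lemma base_point_free_system:
  fixes f :: "'i \<Rightarrow> 'a::{alg_closed_field,field_char_0} poly"
  assumes I: "finite I" and deg: "\<And>i. i \<in> I \<Longrightarrow> degree (f i) \<le> D" and "D > 0"
    and top: "i0 \<in> I" "coeff (f i0) D \<noteq> 0"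
    and free: "\<And>t. \<exists>i\<in>I. poly (f i) t \<noteq> 0"
  obtains a b where
    "card (roots (\<Sum>i\<in>I. smult (a i) (f i))) = D" "card (roots (\<Sum>i\<in>I. smult (b i) (f i))) = D"
    "roots (\<Sum>i\<in>I. smult (a i) (f i)) \<inter> roots (\<Sum>i\<in>I. smult (b i) (f i)) = {}"
proof -
  define F where "F = f i0"
  have F: "degree F = D" using deg top unfolding F_def by (meson antisym le_degree)
  then have "F \<noteq> 0" using \<open>D > 0\<close> by auto
  have "\<exists>e. \<forall>w\<in>(\<lambda>r i. poly (f i) r) ` roots F. (\<Sum>i\<in>I. e i * w i) \<noteq> 0"
    using finite_roots[OF \<open>F \<noteq> 0\<close>] I free by (intro ex_linear_form_nonzero_on_finite) auto
  then obtain e where e: "\<And>r. poly F r = 0 \<Longrightarrow> (\<Sum>i\<in>I. e i * poly (f i) r) \<noteq> 0"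
    unfolding roots_def by auto
  define E where "E = (\<Sum>i\<in>I. smult (e i) (f i))"
  have E: "poly E r \<noteq> 0" if "poly F r = 0" for r
    using e[OF that] by (simp add: E_def poly_sum)
  have "degree E \<le> D"
    unfolding E_def using I deg by (intro degree_sum_le) (auto intro: order_trans[OF degree_smult_le])
  define B where "B = {b. card (roots (F - smult b E)) \<noteq> D}"
  have fin: "finite B"
    unfolding B_def by (rule pencil_distinct_roots[OF E F]) (use \<open>degree E \<le> D\<close> \<open>D > 0\<close> in auto)
  obtain b where b: "b \<notin> B" using ex_new_if_finite[OF infinite_UNIV_char_0 fin] by blast
  obtain b' where b': "b' \<notin> insert b B"
    using ex_new_if_finite[OF infinite_UNIV_char_0, of "insert b B"] fin by auto
  define a where "a b i = (if i = i0 then 1 else 0) - b * e i" for b i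
  have comb: "(\<Sum>i\<in>I. smult (a b i) (f i)) = F - smult b E" for b
  proof -
    have "(\<Sum>i\<in>I. smult (if i = i0 then 1 else 0) (f i)) = (\<Sum>i\<in>I. if i = i0 then f i else 0)"
      by (rule sum.cong) auto
    also have "\<dots> = F" using I top by (simp add: F_def)
    moreover have "smult b E = (\<Sum>i\<in>I. smult (b * e i) (f i))"
      using sum_distrib_left[of "[:b:]" "\<lambda>i. smult (e i) (f i)" I] by (simp add: E_def mult.commute)
    ultimately show ?thesis
      by (simp add: a_def smult_diff_left sum_subtractf)
  qed
  show ?thesis
  proof (rule that[of "a b" "a b'"]; unfold comb)
    show "card (roots (F - smult b E)) = D" "card (roots (F - smult b' E)) = D"
      using b b' by (auto simp: B_def)
    have False if t: "poly (F - smult b E) t = 0" "poly (F - smult b' E) t = 0" for t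
    proof -
      have "(b - b') * poly E t = 0" using t by (simp add: algebra_simps)
      then have "poly E t = 0" using b' by auto
      then show False using t E[of t] by simp
    qed
    then show "roots (F - smult b E) \<inter> roots (F - smult b' E) = {}" unfolding roots_def by blast
  qed
qed

section \<open>Zariski closed and irreducible sets\<close>

lemma polyfun_subst_rational:
  fixes \<phi> :: "('v \<Rightarrow> 'a::field) \<Rightarrow> 'a"
  assumes "polyfun V \<phi>"
  shows "\<exists>p N. \<forall>t. poly d t \<noteq> 0 \<longrightarrow> \<phi> (\<lambda>v. poly (n v) t / poly d t) * poly d t ^ N = poly p t"
  using assms
proof (induction rule: polyfun.induct)
  case (const a)
  show ?case by (rule exI[of _ "[:a:]"], rule exI[of _ 0]) simp
next
  case (var v)
  show ?case by (rule exI[of _ "n v"], rule exI[of _ 1]) simp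
next
  case (add f g)
  then obtain p N q M where
    "\<forall>t. poly d t \<noteq> 0 \<longrightarrow> f (\<lambda>v. poly (n v) t / poly d t) * poly d t ^ N = poly p t"
    "\<forall>t. poly d t \<noteq> 0 \<longrightarrow> g (\<lambda>v. poly (n v) t / poly d t) * poly d t ^ M = poly q t" by blast
  then have "(f (\<lambda>v. poly (n v) t / poly d t) + g (\<lambda>v. poly (n v) t / poly d t)) *
      poly d t ^ (N + M) = poly (p * d ^ M + q * d ^ N) t" if "poly d t \<noteq> 0" for t
    using that by (simp add: power_add distrib_right mult.assoc[symmetric] mult.commute[of "poly d t ^ N"])
  then show ?case by blast
next
  case (mult f g)
  then obtain p N q M where
    "\<forall>t. poly d t \<noteq> 0 \<longrightarrow> f (\<lambda>v. poly (n v) t / poly d t) * poly d t ^ N = poly p t"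
    "\<forall>t. poly d t \<noteq> 0 \<longrightarrow> g (\<lambda>v. poly (n v) t / poly d t) * poly d t ^ M = poly q t" by blast
  then have "(f (\<lambda>v. poly (n v) t / poly d t) * g (\<lambda>v. poly (n v) t / poly d t)) *
      poly d t ^ (N + M) = poly (p * q) t" if "poly d t \<noteq> 0" for t
    unfolding power_add mult.assoc mult.left_commute[of "g _"]
    unfolding mult.assoc[symmetric] using that by simp
  then show ?case by blast
qed

text \<open>A polynomial that vanishes along almost all of a rational curve vanishes along all of it. This is the
  substitute for passing to a limit.\<close>

lemma polyfun_vanish_continuation:
  fixes \<phi> :: "('v \<Rightarrow> 'a::field_char_0) \<Rightarrow> 'a"
  assumes "polyfun V \<phi>" and Z: "finite Z" "\<And>t. t \<notin> Z \<Longrightarrow> poly d t \<noteq> 0 \<Longrightarrow> \<phi> (\<lambda>v. poly (n v) t / poly d t) = 0"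
    and t0: "poly d t0 \<noteq> 0"
  shows "\<phi> (\<lambda>v. poly (n v) t0 / poly d t0) = 0"
proof -
  obtain p N where p: "\<And>t. poly d t \<noteq> 0 \<Longrightarrow>
      \<phi> (\<lambda>v. poly (n v) t / poly d t) * poly d t ^ N = poly p t"
    using polyfun_subst_rational[OF assms(1), of d n] by blast
  have "d \<noteq> 0" using t0 by auto
  then have "finite (Z \<union> roots d)" using Z(1) finite_roots by blast
  then have "p = 0"
    by (rule poly_eq_0_of_cofinite) (use p Z(2) in \<open>force simp: roots_def\<close>)
  then show ?thesis using p[OF t0] t0 by simp
qed

lemma zariski_closed_iff:
  fixes V :: "('a::comm_semiring_1 ^ 'n::finite) set"
  shows "zariski_closed V \<longleftrightarrow> (\<exists>\<Phi>. (\<forall>\<phi>\<in>\<Phi>. polyfun UNIV \<phi>) \<and> V = {x. \<forall>\<phi>\<in>\<Phi>. \<phi> (vec_nth x) = 0})"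
proof
  assume "zariski_closed V"
  then obtain S where S: "V = zero_set S" unfolding zariski_closed_def by blast
  have "\<forall>\<phi>\<in>(\<lambda>f c. mpoly_eval c f) ` S. polyfun UNIV \<phi>" by (auto intro: polyfun_mpoly_eval)
  moreover have "V = {x. \<forall>\<phi>\<in>(\<lambda>f c. mpoly_eval c f) ` S. \<phi> (vec_nth x) = 0}"
    by (auto simp: S zero_set_def)
  ultimately show "\<exists>\<Phi>. (\<forall>\<phi>\<in>\<Phi>. polyfun UNIV \<phi>) \<and> V = {x. \<forall>\<phi>\<in>\<Phi>. \<phi> (vec_nth x) = 0}" by blast
next
  assume "\<exists>\<Phi>. (\<forall>\<phi>\<in>\<Phi>. polyfun UNIV \<phi>) \<and> V = {x. \<forall>\<phi>\<in>\<Phi>. \<phi> (vec_nth x) = 0}"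
  then obtain \<Phi> where \<Phi>: "\<And>\<phi>. \<phi> \<in> \<Phi> \<Longrightarrow> polyfun UNIV \<phi>" "V = {x. \<forall>\<phi>\<in>\<Phi>. \<phi> (vec_nth x) = 0}" by blast
  have "V = zero_set {f. (\<lambda>c. mpoly_eval c f) \<in> \<Phi>}"
  proof (intro set_eqI iffI)
    fix x assume "x \<in> V"
    then show "x \<in> zero_set {f. (\<lambda>c. mpoly_eval c f) \<in> \<Phi>}" unfolding \<Phi>(2) zero_set_def by auto
  next
    fix x assume x: "x \<in> zero_set {f. (\<lambda>c. mpoly_eval c f) \<in> \<Phi>}"
    have "\<phi> (vec_nth x) = 0" if \<phi>: "\<phi> \<in> \<Phi>" for \<phi>
    proof -
      obtain f where f: "\<phi> = (\<lambda>c. mpoly_eval c f)" using polyfun_imp_mpoly[OF \<Phi>(1)[OF \<phi>]] by blast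
      then show ?thesis using x \<phi> unfolding zero_set_def by auto
    qed
    then show "x \<in> V" unfolding \<Phi>(2) by blast
  qed
  then show "zariski_closed V" unfolding zariski_closed_def by blast
qed

lemma zariski_closed_zeros:
  "(\<And>\<phi>. \<phi> \<in> \<Phi> \<Longrightarrow> polyfun UNIV \<phi>) \<Longrightarrow> zariski_closed {x. \<forall>\<phi>\<in>\<Phi>. \<phi> (vec_nth x) = 0}"
  unfolding zariski_closed_iff by blast

lemma zariski_closed_Int:
  fixes A B :: "('a::comm_semiring_1 ^ 'n::finite) set"
  assumes "zariski_closed A" "zariski_closed B" shows "zariski_closed (A \<inter> B)"
proof -
  obtain S T where "A = zero_set S" "B = zero_set T" using assms unfolding zariski_closed_def by blast
  then have "A \<inter> B = zero_set (S \<union> T)" by (auto simp: zero_set_def)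
  then show ?thesis unfolding zariski_closed_def by blast
qed

lemma separating_polyfun:
  fixes A :: "('a::comm_semiring_1 ^ 'n::finite) set"
  assumes "zariski_closed A" "\<not> V \<subseteq> A"
  obtains \<phi> x where "polyfun UNIV \<phi>" "\<And>y. y \<in> A \<Longrightarrow> \<phi> (vec_nth y) = 0" "x \<in> V" "\<phi> (vec_nth x) \<noteq> 0"
proof -
  obtain \<Phi> where \<Phi>: "\<forall>\<phi>\<in>\<Phi>. polyfun UNIV \<phi>" "A = {x. \<forall>\<phi>\<in>\<Phi>. \<phi> (vec_nth x) = 0}"
    using assms(1) unfolding zariski_closed_iff by blast
  then obtain x \<phi> where "x \<in> V" "\<phi> \<in> \<Phi>" "\<phi> (vec_nth x) \<noteq> 0" using assms(2) by blast
  then show ?thesis using that \<Phi> by blast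
qed

text \<open>Irreducibility in the form in which it is proved below: the complements of two zero sets that both meet
  \<open>V\<close> meet inside \<open>V\<close>.\<close>

lemma zariski_irreducibleI:
  fixes V :: "('a::idom ^ 'n::finite) set"
  assumes "V \<noteq> {}"
    and *: "\<And>\<phi> \<psi> x y. polyfun UNIV \<phi> \<Longrightarrow> polyfun UNIV \<psi> \<Longrightarrow> x \<in> V \<Longrightarrow> \<phi> (vec_nth x) \<noteq> 0 \<Longrightarrow>
       y \<in> V \<Longrightarrow> \<psi> (vec_nth y) \<noteq> 0 \<Longrightarrow> \<exists>z\<in>V. \<phi> (vec_nth z) \<noteq> 0 \<and> \<psi> (vec_nth z) \<noteq> 0"
  shows "zariski_irreducible V"
  unfolding zariski_irreducible_def
proof (intro conjI allI impI)
  fix A B assume AB: "zariski_closed A \<and> zariski_closed B \<and> V \<subseteq> A \<union> B"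
  show "V \<subseteq> A \<or> V \<subseteq> B"
  proof (rule ccontr)
    assume n: "\<not> ?thesis"
    obtain \<phi> x where \<phi>: "polyfun UNIV \<phi>" "\<And>y. y \<in> A \<Longrightarrow> \<phi> (vec_nth y) = 0" "x \<in> V" "\<phi> (vec_nth x) \<noteq> 0"
      using separating_polyfun AB n by metis
    obtain \<psi> y where \<psi>: "polyfun UNIV \<psi>" "\<And>y. y \<in> B \<Longrightarrow> \<psi> (vec_nth y) = 0" "y \<in> V" "\<psi> (vec_nth y) \<noteq> 0"
      using separating_polyfun AB n by metis
    obtain z where "z \<in> V" "\<phi> (vec_nth z) \<noteq> 0" "\<psi> (vec_nth z) \<noteq> 0"
      using *[OF \<phi>(1) \<psi>(1) \<phi>(3,4) \<psi>(3,4)] by blast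
    then show False using AB \<phi>(2) \<psi>(2) by blast
  qed
qed (use assms in simp)

lemma zariski_irreducibleD:
  fixes V :: "('a::idom ^ 'n::finite) set"
  assumes V: "zariski_irreducible V" and \<phi>: "polyfun UNIV \<phi>" and \<psi>: "polyfun UNIV \<psi>"
    and "\<And>x. x \<in> V \<Longrightarrow> \<phi> (vec_nth x) * \<psi> (vec_nth x) = 0"
    and "x \<in> V" "\<phi> (vec_nth x) \<noteq> 0" "y \<in> V"
  shows "\<psi> (vec_nth y) = 0"
proof -
  let ?A = "{x. \<forall>\<phi>\<in>{\<phi>}. \<phi> (vec_nth x) = 0}" and ?B = "{x. \<forall>\<phi>\<in>{\<psi>}. \<phi> (vec_nth x) = 0}"
  have "zariski_closed ?A" by (rule zariski_closed_zeros) (use \<phi> in simp)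
  moreover have "zariski_closed ?B" by (rule zariski_closed_zeros) (use \<psi> in simp)
  moreover have "V \<subseteq> ?A \<union> ?B" using assms(4) by auto
  ultimately have "V \<subseteq> ?A \<or> V \<subseteq> ?B" using V unfolding zariski_irreducible_def by blast
  then show ?thesis using assms by auto
qed

lemma zariski_irreducible_singleton: "zariski_irreducible {x :: 'a::idom ^ 'n::finite}"
  by (rule zariski_irreducibleI) auto

lemma zariski_closed_singleton: "zariski_closed {p :: 'a::comm_ring_1 ^ 'n::finite}"
proof -
  have "{p} = {x. \<forall>\<phi>\<in>range (\<lambda>i c. c i - p $ i). \<phi> (vec_nth x) = 0}" by (auto simp: vec_eq_iff)
  moreover have "zariski_closed \<dots>" by (rule zariski_closed_zeros) (auto intro!: polyfun_intros)
  ultimately show ?thesis by simp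
qed

section \<open>Uniqueness of the geometric degree\<close>

text \<open>The exponents of Kronecker's substitution: digits to a base that exceeds all of them.\<close>

lemma separating_weights:
  fixes K :: "('v \<Rightarrow> nat) set"
  assumes "finite A" "finite K"
  shows "\<exists>w :: 'v \<Rightarrow> nat. \<forall>m\<in>K. \<forall>m'\<in>K. (\<Sum>v\<in>A. w v * m v) = (\<Sum>v\<in>A. w v * m' v) \<longrightarrow> (\<forall>v\<in>A. m v = m' v)"
  using assms(1)
proof (induction A rule: finite_induct)
  case (insert b A)
  then obtain w where w: "\<And>m m'. m \<in> K \<Longrightarrow> m' \<in> K \<Longrightarrow>
      (\<Sum>v\<in>A. w v * m v) = (\<Sum>v\<in>A. w v * m' v) \<Longrightarrow> \<forall>v\<in>A. m v = m' v" by blast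
  define N where "N = Suc (\<Sum>m\<in>K. m b)"
  have less: "m b < N" if "m \<in> K" for m
    using member_le_sum[OF that, of "\<lambda>m. m b"] assms(2) by (auto simp: N_def)
  define w' where "w' v = (if v = b then 1 else N * w v)" for v
  have sum: "(\<Sum>v\<in>insert b A. w' v * m v) = m b + N * (\<Sum>v\<in>A. w v * m v)" for m
  proof -
    have "(\<Sum>v\<in>A. w' v * m v) = (\<Sum>v\<in>A. N * (w v * m v))"
      using insert.hyps by (intro sum.cong) (auto simp: w'_def)
    then show ?thesis using insert.hyps by (simp add: w'_def sum_distrib_left)
  qed
  show ?case
  proof (intro exI[of _ w'] ballI impI; unfold sum)
    fix m m' v assume m: "m \<in> K" "m' \<in> K" and v: "v \<in> insert b A"
      and eq: "m b + N * (\<Sum>v\<in>A. w v * m v) = m' b + N * (\<Sum>v\<in>A. w v * m' v)"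
    have b: "m b = m' b" using arg_cong[OF eq, of "\<lambda>x. x mod N"] less m by simp
    moreover have "N > 0" by (simp add: N_def)
    ultimately have "(\<Sum>v\<in>A. w v * m v) = (\<Sum>v\<in>A. w v * m' v)" using eq by simp
    then show "m v = m' v" using w[OF m] b v by auto
  qed
qed simp

text \<open>Kronecker's substitution \<open>x\<^sub>v = t^w\<^sub>v\<close> maps the monomials of \<open>F\<close> to distinct powers of \<open>t\<close>, so a nonzero
  \<open>F\<close> becomes a nonzero one-variable polynomial.\<close>

lemma mpoly_nonzero_imp_eval_nonzero:
  fixes F :: "('v, 'a::{idom,ring_char_0}) mpoly"
  assumes "F \<noteq> 0"
  shows "\<exists>c. mpoly_eval c F \<noteq> 0"
proof -
  define A where "A = mpoly_vars F"
  have A: "finite A" by (simp add: A_def mpoly_vars_def)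
  obtain w where w: "\<And>m m'. m \<in> Poly_Mapping.keys F \<Longrightarrow> m' \<in> Poly_Mapping.keys F \<Longrightarrow>
      (\<Sum>v\<in>A. w v * Poly_Mapping.lookup m v) = (\<Sum>v\<in>A. w v * Poly_Mapping.lookup m' v) \<Longrightarrow>
      (\<forall>v\<in>A. Poly_Mapping.lookup m v = Poly_Mapping.lookup m' v)"
    using separating_weights[OF A, of "Poly_Mapping.lookup ` Poly_Mapping.keys F"] by auto
  define e where "e m = (\<Sum>v\<in>A. w v * Poly_Mapping.lookup m v)" for m
  have inj: "m = m'" if m: "m \<in> Poly_Mapping.keys F" "m' \<in> Poly_Mapping.keys F" "e m = e m'" for m m'
  proof (rule poly_mapping_eqI)
    fix v
    show "Poly_Mapping.lookup m v = Poly_Mapping.lookup m' v"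
    proof (cases "v \<in> A")
      case False
      then have "v \<notin> Poly_Mapping.keys m" "v \<notin> Poly_Mapping.keys m'"
        using m unfolding A_def mpoly_vars_def by auto
      then show ?thesis by (simp add: in_keys_iff)
    qed (use w[OF m(1,2)] m(3) in \<open>simp add: e_def\<close>)
  qed
  define p where "p = (\<Sum>m\<in>Poly_Mapping.keys F. monom (Poly_Mapping.lookup F m) (e m))"
  obtain m0 where m0: "m0 \<in> Poly_Mapping.keys F" using assms by (metis keys_eq_empty ex_in_conv)
  have "coeff p (e m0) = (\<Sum>m\<in>Poly_Mapping.keys F. if m = m0 then Poly_Mapping.lookup F m else 0)"
    unfolding p_def coeff_sum coeff_monom using inj m0 by (intro sum.cong) auto
  also have "\<dots> = Poly_Mapping.lookup F m0" using m0 by simp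
  finally have "p \<noteq> 0" using m0 by (auto simp: in_keys_iff)
  then obtain t where t: "poly p t \<noteq> 0" using poly_eq_0_of_cofinite[of "{}" p] by auto
  have "mpoly_eval (\<lambda>v. t ^ w v) F = poly p t"
    unfolding mpoly_eval_def p_def poly_sum poly_monom
  proof (intro sum.cong refl arg_cong2[of _ _ _ _ "(*)"])
    fix m assume "m \<in> Poly_Mapping.keys F"
    then have "Poly_Mapping.keys m \<subseteq> A" by (auto simp: A_def mpoly_vars_def)
    then show "mono_eval (\<lambda>v. t ^ w v) m = t ^ e m"
      by (simp add: mono_eval_superset[OF A] e_def power_sum power_mult)
  qed
  then show ?thesis using t by metis
qed

lemma has_geom_degreeI:
  fixes V :: "('a::field ^ 'n::finite) set"
  assumes "zariski_irreducible V" "zariski_dim V = enat d"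
    "generically ({..<d} \<times> UNIV)
       (\<lambda>c. finite (V \<inter> linear_variety d c) \<and> card (V \<inter> linear_variety d c) = k)"
  shows "has_geom_degree V k"
proof -
  obtain \<phi> c0 where \<phi>: "polyfun ({..<d} \<times> UNIV) \<phi>" "\<phi> c0 \<noteq> 0"
    "\<And>c. \<phi> c \<noteq> 0 \<Longrightarrow> finite (V \<inter> linear_variety d c) \<and> card (V \<inter> linear_variety d c) = k"
    using assms(3) unfolding generically_def by blast
  obtain F where F: "mpoly_vars F \<subseteq> {..<d} \<times> UNIV" "\<phi> = (\<lambda>c. mpoly_eval c F)"
    using polyfun_imp_mpoly[OF \<phi>(1)] by blast
  then have "F \<noteq> 0" using \<phi>(2) by auto
  then show ?thesis unfolding has_geom_degree_def
    using assms(1,2) F \<phi>(3) by (intro conjI exI[of _ d] exI[of _ F]) auto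
qed

text \<open>The generic number of points is unique since two nonempty open sets of parameters always meet, and
  meet the set of parameters of full rank.\<close>

lemma geom_degree_eqI:
  fixes V :: "('a::field_char_0 ^ 'n::finite) set"
  assumes "zariski_irreducible V" "zariski_dim V = enat d"
    "generically ({..<d} \<times> UNIV)
       (\<lambda>c. finite (V \<inter> linear_variety d c) \<and> card (V \<inter> linear_variety d c) = k)"
    and fr: "generically ({..<d} \<times> UNIV) (\<lambda>c :: nat \<times> 'n option \<Rightarrow> 'a. full_rank d c)"
  shows "geom_degree V = k"
  unfolding geom_degree_def
proof (rule the_equality)
  show "has_geom_degree V k" by (rule has_geom_degreeI) (use assms in auto)
  fix l assume "has_geom_degree V l"
  then obtain F :: "(nat \<times> 'n option, 'a) mpoly" where F: "F \<noteq> 0" "mpoly_vars F \<subseteq> {..<d} \<times> UNIV"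
    "\<And>c. mpoly_eval c F \<noteq> 0 \<Longrightarrow> full_rank d c \<Longrightarrow> card (V \<inter> linear_variety d c) = l"
    using assms(2) unfolding has_geom_degree_def by auto
  obtain c0 where "mpoly_eval c0 F \<noteq> 0" using mpoly_nonzero_imp_eval_nonzero[OF F(1)] by blast
  then have "generically ({..<d} \<times> UNIV) (\<lambda>c. mpoly_eval c F \<noteq> 0)"
    using polyfun_mpoly_eval[OF F(2)] by (intro generically_nonzero)
  from generically_ex[OF generically_conj[OF this generically_conj[OF fr assms(3)]]]
  obtain c where "mpoly_eval c F \<noteq> 0" "full_rank d c" "card (V \<inter> linear_variety d c) = k" by blast
  then show "l = k" using F(3) by simp
qed

lemma generically_full_rank_1:
  "generically ({..<1} \<times> UNIV) (\<lambda>c :: nat \<times> 'n::finite option \<Rightarrow> 'a::field. full_rank 1 c)"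
proof (rule genericallyI)
  show "polyfun ({..<1} \<times> UNIV) (\<lambda>c :: nat \<times> 'n option \<Rightarrow> 'a. c (0, Some undefined))"
    by (rule polyfun.var) auto
  show "(\<lambda>c :: nat \<times> 'n option \<Rightarrow> 'a. c (0, Some undefined)) (\<lambda>v. 1) \<noteq> 0" by simp
  fix c :: "nat \<times> 'n option \<Rightarrow> 'a" assume c: "c (0, Some undefined) \<noteq> 0"
  have "(\<chi> j. c (0, Some j)) \<noteq> 0" using c by (auto simp: vec_eq_iff)
  moreover have "{..<1 :: nat} = {0}" by auto
  ultimately show "full_rank 1 c"
    unfolding full_rank_def using vec.dim_eq_card_independent[of "{\<chi> j. c (0, Some j)}"]
    by (simp add: vec.independent_insert)
qed

lemma generically_full_rank_2:
  fixes i j :: "'n::finite"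
  assumes "i \<noteq> j"
  shows "generically ({..<2} \<times> UNIV) (\<lambda>c :: nat \<times> 'n option \<Rightarrow> 'a::field. full_rank 2 c)"
proof (rule genericallyI)
  let ?\<phi> = "\<lambda>c :: nat \<times> 'n option \<Rightarrow> 'a.
     c (0, Some i) * c (1, Some j) - c (0, Some j) * c (1, Some i)"
  show "polyfun ({..<2} \<times> UNIV) ?\<phi>" by (intro polyfun_intros) auto
  show "?\<phi> (\<lambda>v. if v = (0, Some i) \<or> v = (1, Some j) then 1 else 0) \<noteq> 0" using assms by auto
  fix c :: "nat \<times> 'n option \<Rightarrow> 'a" assume c: "?\<phi> c \<noteq> 0"
  define r where "r k = (\<chi> j. c (k, Some j))" for k
  have "r 1 \<noteq> 0"
  proof
    assume "r 1 = 0"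
    then have "c (1, Some l) = 0" for l by (simp add: r_def vec_eq_iff)
    then show False using c by simp
  qed
  moreover have "r 0 \<notin> vec.span {r 1}"
  proof
    assume "r 0 \<in> vec.span {r 1}"
    then obtain k where "r 0 = k *s r 1" by (auto simp: vec.span_singleton)
    then have "c (0, Some l) = k * c (1, Some l)" for l by (simp add: r_def vec_eq_iff)
    then show False using c by simp
  qed
  moreover from this have "r 0 \<noteq> r 1" using vec.span_base by blast
  ultimately have "vec.independent {r 0, r 1}" "card {r 0, r 1} = 2"
    by (auto simp: vec.independent_insert)
  moreover have "{..<2 :: nat} = {0, 1}" by auto
  ultimately show "full_rank 2 c"
    unfolding full_rank_def r_def[symmetric] using vec.dim_eq_card_independent[of "{r 0, r 1}"]
    by (simp add: r_def)
qed

section \<open>The degree of a rational curve\<close>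

lemma not_zero_of_finite_roots: "card (roots p) > 0 \<Longrightarrow> (p :: 'a::{idom,ring_char_0} poly) \<noteq> 0"
  using infinite_UNIV_char_0[where 'a='a] by (auto simp: roots_def)

text \<open>The common root is counted only once.\<close>

lemma card_roots_mult_common:
  fixes p q :: "'a::idom poly"
  assumes "p \<noteq> 0" "q \<noteq> 0" "poly p t = 0" "poly q t = 0"
  shows "card (roots (p * q)) < degree p + degree q"
proof -
  have "roots (p * q) = roots p \<union> roots q" by (auto simp: roots_def)
  moreover have "card (roots p \<union> roots q) + card (roots p \<inter> roots q) = card (roots p) + card (roots q)"
    using card_Un_Int[of "roots p" "roots q"] finite_roots assms by metis
  moreover have "card (roots p \<inter> roots q) > 0"
    using assms finite_roots[of p] by (auto simp: card_gt_0_iff roots_def)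
  moreover have "card (roots p) \<le> degree p" "card (roots q) \<le> degree q"
    using card_roots_le assms by auto
  ultimately show ?thesis by simp
qed

definition frac_point :: "('n::finite \<Rightarrow> 'a::field poly) \<Rightarrow> 'a poly \<Rightarrow> 'a \<Rightarrow> 'a ^ 'n" where
  "frac_point G H t = (\<chi> i. poly (G i) t / poly H t)"

lemma vec_nth_frac_point: "vec_nth (frac_point G H t) = (\<lambda>i. poly (G i) t / poly H t)"
  by (auto simp: frac_point_def)

text \<open>The numerator of the derivative of \<open>G\<^sub>i/H\<close>.\<close>

definition wronskian :: "('n \<Rightarrow> 'a::idom poly) \<Rightarrow> 'a poly \<Rightarrow> 'n \<Rightarrow> 'a poly" where
  "wronskian G H i = pderiv (G i) * H - G i * pderiv H"

text \<open>A curve with a parametrization \<open>G/H\<close> in lowest terms. The assumptions \<open>free\<close> and \<open>top\<close> say that the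
  forms of degree \<open>D\<close> given by \<open>H\<close> and the \<open>G\<^sub>i\<close> have no common zero on the projective line, \<open>top\<close> being
  the case of the point at infinity; \<open>dense\<close> says that the curve is the closure of the image of \<open>U\<close>.\<close>

locale parametrized_curve =
  fixes C :: "('a::{alg_closed_field, field_char_0} ^ 'n::finite) set"
    and G :: "'n \<Rightarrow> 'a poly" and H :: "'a poly" and D :: nat and U :: "'a set"
  assumes closed: "zariski_closed C"
    and dim_1: "zariski_dim C = 1"
    and free: "\<And>t. poly H t = 0 \<Longrightarrow> \<exists>i. poly (G i) t \<noteq> 0"
    and deg_H: "degree H \<le> D" and deg_G: "\<And>i. degree (G i) \<le> D"
    and top: "coeff H D = 0 \<Longrightarrow> \<exists>i. coeff (G i) D \<noteq> 0"
    and cofinite: "finite (- U)"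
    and defined: "\<And>t. t \<in> U \<Longrightarrow> poly H t \<noteq> 0"
    and on_curve: "\<And>t. t \<in> U \<Longrightarrow> frac_point G H t \<in> C"
    and dense: "\<And>\<phi> x. polyfun UNIV \<phi> \<Longrightarrow> (\<And>t. t \<in> U \<Longrightarrow> \<phi> (vec_nth (frac_point G H t)) = 0) \<Longrightarrow>
       x \<in> C \<Longrightarrow> \<phi> (vec_nth x) = 0"
    and inj: "inj_on (frac_point G H) U"
    and immersed: "\<And>t. t \<in> U \<Longrightarrow> \<exists>i. poly (wronskian G H i) t \<noteq> 0"
begin

abbreviation "P \<equiv> frac_point G H"

lemma U_nonempty: obtains t where "t \<in> U"
  using ex_new_if_finite[OF infinite_UNIV_char_0 cofinite] by blast

lemma D_pos: "D > 0"
proof (rule ccontr)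
  assume "\<not> ?thesis"
  then have "pderiv H = 0" "\<And>i. pderiv (G i) = 0" using deg_H deg_G by (auto simp: pderiv_eq_0_iff)
  then have "wronskian G H i = 0" for i by (simp add: wronskian_def)
  then show False using immersed U_nonempty by (metis poly_0)
qed

lemma curve_irreducible: "zariski_irreducible C"
proof (rule zariski_irreducibleI)
  show "C \<noteq> {}" using on_curve U_nonempty by blast
  fix \<phi> \<psi> x y
  assume \<phi>: "polyfun UNIV \<phi>" "x \<in> C" "\<phi> (vec_nth x) \<noteq> 0" and \<psi>: "polyfun UNIV \<psi>" "y \<in> C" "\<psi> (vec_nth y) \<noteq> 0"
  obtain s where s: "s \<in> U" "\<phi> (vec_nth (P s)) \<noteq> 0" using dense[OF \<phi>(1)] \<phi>(2,3) by blast
  obtain t where t: "t \<in> U" "\<psi> (vec_nth (P t)) \<noteq> 0" using dense[OF \<psi>(1)] \<psi>(2,3) by blast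
  obtain p N where p: "\<And>t. poly H t \<noteq> 0 \<Longrightarrow> \<phi> (vec_nth (P t)) * poly H t ^ N = poly p t"
    using polyfun_subst_rational[OF \<phi>(1), of H G] unfolding vec_nth_frac_point by blast
  obtain q M where q: "\<And>t. poly H t \<noteq> 0 \<Longrightarrow> \<psi> (vec_nth (P t)) * poly H t ^ M = poly q t"
    using polyfun_subst_rational[OF \<psi>(1), of H G] unfolding vec_nth_frac_point by blast
  have "p \<noteq> 0" "q \<noteq> 0" using p[OF defined[OF s(1)]] q[OF defined[OF t(1)]] s t defined by auto
  then obtain r where r: "r \<in> U" "poly (p * q) r \<noteq> 0"
    using poly_eq_0_of_cofinite[OF cofinite, of "p * q"] by auto
  then show "\<exists>z\<in>C. \<phi> (vec_nth z) \<noteq> 0 \<and> \<psi> (vec_nth z) \<noteq> 0"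
    using p[OF defined[OF r(1)]] q[OF defined[OF r(1)]] on_curve[OF r(1)] by (auto intro!: bexI[of _ "P r"])
qed

definition point_at_infinity :: "'a ^ 'n" where
  "point_at_infinity = (\<chi> i. coeff (G i) D / coeff H D)"

text \<open>The image of the projective line is closed. The point \<open>x\<close> is in the image iff the polynomials
  \<open>x\<^sub>i H - G\<^sub>i\<close> have a common zero on the projective line. If they do not, two combinations of them have
  \<open>D\<close> distinct roots each and none in common, so their product has \<open>2D\<close> distinct roots. This is an open
  condition on \<open>x\<close>, and it fails at \<open>P(t)\<close>, where both factors vanish at \<open>t\<close>. So a polynomial that is
  nonzero at \<open>x\<close> vanishes on the image of \<open>U\<close>.\<close>

lemma curve_points:
  assumes x: "x \<in> C"
  shows "(\<exists>t. poly H t \<noteq> 0 \<and> x = P t) \<or> (coeff H D \<noteq> 0 \<and> x = point_at_infinity)"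
proof -
  define f where "f z i = smult (z i) H - G i" for z :: "'n \<Rightarrow> 'a" and i
  have deg: "degree (f z i) \<le> D" for z i
    unfolding f_def using deg_H deg_G by (intro degree_diff_le) (auto intro: order_trans[OF degree_smult_le])
  consider t where "\<And>i. poly (f (vec_nth x) i) t = 0" | "\<And>i. coeff (f (vec_nth x) i) D = 0"
    | i0 where "\<And>t. \<exists>i. poly (f (vec_nth x) i) t \<noteq> 0" "coeff (f (vec_nth x) i0) D \<noteq> 0" by blast
  then show ?thesis
  proof cases
    case 1
    then have eq: "x $ i * poly H t = poly (G i) t" for i by (simp add: f_def)
    then have "poly H t \<noteq> 0" using free[of t] by (metis mult_zero_right)
    moreover from this have "x = P t" using eq by (auto simp: vec_eq_iff frac_point_def field_simps)
    ultimately show ?thesis by blast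
  next
    case 2
    then have eq: "x $ i * coeff H D = coeff (G i) D" for i by (simp add: f_def)
    then have "coeff H D \<noteq> 0" using top by (metis mult_zero_right)
    moreover from this have "x = point_at_infinity"
      using eq by (auto simp: vec_eq_iff point_at_infinity_def field_simps)
    ultimately show ?thesis by blast
  next
    case 3
    define K where "K a z = (\<Sum>i\<in>UNIV. smult (a i) (f z i))" for a z
    obtain a b where ab: "card (roots (K a (vec_nth x))) = D" "card (roots (K b (vec_nth x))) = D"
      "roots (K a (vec_nth x)) \<inter> roots (K b (vec_nth x)) = {}"
      unfolding K_def
      by (rule base_point_free_system[of UNIV "f (vec_nth x)" D i0]) (use deg D_pos 3 in auto)
    define R where "R z = K a z * K b z" for z
    have fam: "poly_family UNIV R"
      unfolding R_def K_def f_def by (intro poly_family_intros) (auto intro: polyfun_intros)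
    have nz: "K a (vec_nth x) \<noteq> 0" "K b (vec_nth x) \<noteq> 0"
      using ab D_pos by (auto intro!: not_zero_of_finite_roots)
    have "roots (R (vec_nth x)) = roots (K a (vec_nth x)) \<union> roots (K b (vec_nth x))"
      by (auto simp: roots_def R_def)
    then have "card (roots (R (vec_nth x))) = 2 * D"
      using ab nz by (simp add: card_Un_disjoint finite_roots)
    then obtain \<phi> where \<phi>: "polyfun UNIV \<phi>" "\<phi> (vec_nth x) \<noteq> 0"
      "\<And>z. \<phi> z \<noteq> 0 \<Longrightarrow> R z \<noteq> 0 \<and> 2 * D \<le> card (roots (R z))"
      using many_roots_open[OF fam, of "vec_nth x" "2 * D"] nz by (auto simp: R_def)
    have degK: "degree (K c z) \<le> D" for c z
      unfolding K_def using deg by (intro degree_sum_le) (auto intro: order_trans[OF degree_smult_le])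
    have "\<phi> (vec_nth (P t)) = 0" if t: "t \<in> U" for t
    proof (rule ccontr)
      assume "\<phi> (vec_nth (P t)) \<noteq> 0"
      then have *: "R (vec_nth (P t)) \<noteq> 0" "2 * D \<le> card (roots (R (vec_nth (P t))))" using \<phi>(3) by auto
      have "poly (f (vec_nth (P t)) i) t = 0" for i
        using defined[OF t] by (simp add: f_def frac_point_def)
      then have "poly (K c (vec_nth (P t))) t = 0" for c by (simp add: K_def poly_sum)
      then have "card (roots (R (vec_nth (P t)))) < degree (K a (vec_nth (P t))) + degree (K b (vec_nth (P t)))"
        unfolding R_def using *(1) by (intro card_roots_mult_common) (auto simp: R_def)
      then show False using *(2) degK[of a "vec_nth (P t)"] degK[of b "vec_nth (P t)"] by linarith
    qed
    then show ?thesis using dense[OF \<phi>(1) _ x] \<phi>(2) by blast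
  qed
qed

lemma finite_missing: "finite (C - P ` U)"
proof (rule finite_subset)
  show "C - P ` U \<subseteq> insert point_at_infinity (P ` (- U))" using curve_points by blast
qed (use cofinite in simp)

text \<open>The numerator of the equation of a hyperplane, restricted to the curve.\<close>

definition hyperplane_poly :: "(nat \<times> 'n option \<Rightarrow> 'a) \<Rightarrow> 'a poly" where
  "hyperplane_poly c = (\<Sum>j\<in>UNIV. smult (c (0, Some j)) (G j)) - smult (c (0, None)) H"

lemma poly_family_hyperplane_poly: "poly_family ({..<1} \<times> UNIV) hyperplane_poly"
  unfolding hyperplane_poly_def[abs_def] by (intro poly_family_intros) (auto intro!: polyfun_intros)

lemma hyperplane_section: "t \<in> U \<Longrightarrow> P t \<in> linear_variety 1 c \<longleftrightarrow> t \<in> roots (hyperplane_poly c)"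
proof -
  assume t: "t \<in> U"
  have "(\<Sum>j\<in>UNIV. c (0, Some j) * P t $ j) = (\<Sum>j\<in>UNIV. c (0, Some j) * poly (G j) t) / poly H t"
    by (simp add: frac_point_def sum_divide_distrib)
  then show ?thesis using defined[OF t]
    by (simp add: linear_variety_def roots_def hyperplane_poly_def poly_sum nonzero_divide_eq_eq)
qed

lemma ex_hyperplane_poly_many_roots: "\<exists>c. card (roots (hyperplane_poly c)) = D"
proof -
  define f where "f m = (case m of Some i \<Rightarrow> G i | None \<Rightarrow> - H)" for m
  have nz: "\<exists>i\<in>UNIV. poly (f i) t \<noteq> 0" for t
  proof (cases "poly H t = 0")
    case True
    then obtain i where "poly (G i) t \<noteq> 0" using free by blast
    then show ?thesis by (intro bexI[of _ "Some i"]) (auto simp: f_def)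
  next
    case False
    then show ?thesis by (intro bexI[of _ None]) (auto simp: f_def)
  qed
  obtain i0 where i0: "coeff (f i0) D \<noteq> 0"
  proof (cases "coeff H D = 0")
    case True
    then obtain i where "coeff (G i) D \<noteq> 0" using top by blast
    then show ?thesis by (intro that[of "Some i"]) (auto simp: f_def)
  next
    case False
    then show ?thesis by (intro that[of None]) (auto simp: f_def)
  qed
  have "degree (f i) \<le> D" for i using deg_G deg_H by (auto simp: f_def split: option.splits)
  then obtain a where a: "card (roots (\<Sum>i\<in>UNIV. smult (a i) (f i))) = D"
    using base_point_free_system[of UNIV f D i0, OF _ _ D_pos _ i0 nz] by auto
  have "(\<Sum>i\<in>UNIV. smult (a i) (f i)) = hyperplane_poly (a \<circ> snd)"
    by (simp add: UNIV_option_conv sum.reindex hyperplane_poly_def f_def)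
  then show ?thesis using a by metis
qed

text \<open>The degree is in fact the generic, that is, the maximal number of distinct roots of a hyperplane
  polynomial, and one with \<open>D\<close> distinct roots exists.\<close>

lemma curve_degree: "D \<le> geom_degree C"
proof -
  let ?V = "{..<1::nat} \<times> (UNIV :: 'n option set)"
  obtain c0 where c0: "card (roots (hyperplane_poly c0)) = D" using ex_hyperplane_poly_many_roots by blast
  then have nz: "hyperplane_poly c0 \<noteq> 0" using D_pos by (intro not_zero_of_finite_roots) simp
  obtain k where k: "generically ?V (\<lambda>c. hyperplane_poly c \<noteq> 0 \<and> card (roots (hyperplane_poly c)) = k)"
    "\<And>c. hyperplane_poly c \<noteq> 0 \<Longrightarrow> card (roots (hyperplane_poly c)) \<le> k"
    by (rule generic_number_of_roots[OF poly_family_hyperplane_poly nz]) (rule that)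
  have 1: "generically ?V (\<lambda>c. \<forall>z\<in>- U. poly (hyperplane_poly c) z \<noteq> 0)"
  proof (rule generically_ball[OF cofinite])
    fix z
    have "\<exists>c. poly (hyperplane_poly c) z \<noteq> 0"
    proof (cases "poly H z = 0")
      case True
      then obtain i where i: "poly (G i) z \<noteq> 0" using free by blast
      show ?thesis
        by (rule exI[of _ "\<lambda>v. if v = (0, Some i) then 1 else 0"])
          (use i in \<open>simp add: hyperplane_poly_def poly_sum if_distrib[of "\<lambda>x. smult x _"] if_distribR cong: if_cong\<close>)
    next
      case False
      then show ?thesis
        by (intro exI[of _ "\<lambda>v. if v = (0, None) then 1 else 0"]) (simp add: hyperplane_poly_def poly_sum)
    qed
    then show "generically ?V (\<lambda>c. poly (hyperplane_poly c) z \<noteq> 0)"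
      using generically_nonzero[OF polyfun_poly_family[OF poly_family_hyperplane_poly]] by blast
  qed
  have 2: "generically ?V (\<lambda>c. \<forall>p\<in>C - P ` U. (\<Sum>j\<in>UNIV. c (0, Some j) * p $ j) - c (0, None) \<noteq> 0)"
    by (intro generically_ball[OF finite_missing] generically_nonzero[where c = "\<lambda>v. if v = (0, None) then 1 else 0"])
      (auto intro!: polyfun_intros)
  have "geom_degree C = k"
  proof (rule geom_degree_eqI[OF curve_irreducible, of 1])
    show "zariski_dim C = enat 1" using dim_1 by (simp add: one_enat_def)
    show "generically ?V (full_rank 1 :: _ \<Rightarrow> bool)" by (rule generically_full_rank_1)
    show "generically ?V (\<lambda>c. finite (C \<inter> linear_variety 1 c) \<and> card (C \<inter> linear_variety 1 c) = k)"
      using generically_conj[OF k(1) generically_conj[OF 1 2]]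
    proof (rule generically_mono)
      fix c assume c: "(hyperplane_poly c \<noteq> 0 \<and> card (roots (hyperplane_poly c)) = k) \<and>
        (\<forall>z\<in>- U. poly (hyperplane_poly c) z \<noteq> 0) \<and>
        (\<forall>p\<in>C - P ` U. (\<Sum>j\<in>UNIV. c (0, Some j) * p $ j) - c (0, None) \<noteq> 0)"
      have sub: "roots (hyperplane_poly c) \<subseteq> U" using c by (auto simp: roots_def)
      have "C \<inter> linear_variety 1 c = P ` roots (hyperplane_poly c)"
      proof (intro set_eqI iffI)
        fix x assume x: "x \<in> C \<inter> linear_variety 1 c"
        then have "x \<in> P ` U" using c by (auto simp: linear_variety_def)
        then show "x \<in> P ` roots (hyperplane_poly c)" using x hyperplane_section by blast
      next
        fix x assume "x \<in> P ` roots (hyperplane_poly c)"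
        then show "x \<in> C \<inter> linear_variety 1 c" using sub hyperplane_section on_curve by blast
      qed
      moreover have "inj_on P (roots (hyperplane_poly c))" using inj sub by (rule inj_on_subset)
      ultimately show "finite (C \<inter> linear_variety 1 c) \<and> card (C \<inter> linear_variety 1 c) = k"
        using c finite_roots[of "hyperplane_poly c"] by (simp add: card_image)
    qed
  qed
  then show ?thesis using k(2)[OF nz] c0 by simp
qed

end

section \<open>Tangent directions along a rational curve\<close>

lemma mpoly_induct [case_names const var add mult]:
  fixes f :: "('v, 'a::comm_semiring_1) mpoly"
  assumes const: "\<And>a. Q (Poly_Mapping.single 0 a)"
    and var: "\<And>i. Q (Poly_Mapping.single (Poly_Mapping.single i 1) 1)"
    and add: "\<And>f g. Q f \<Longrightarrow> Q g \<Longrightarrow> Q (f + g)"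
    and mult: "\<And>f g. Q f \<Longrightarrow> Q g \<Longrightarrow> Q (f * g)"
  shows "Q f"
proof -
  have pow: "Q (Poly_Mapping.single (Poly_Mapping.single i k) 1)" for i k
  proof (induction k)
    case 0
    then show ?case using const[of 1] by simp
  next
    case (Suc k)
    then show ?case using mult[OF var Suc, of i]
      by (simp add: mult_single single_add[symmetric])
  qed
  have mono: "Q (Poly_Mapping.single m a)" for m a
  proof (induction m rule: update_induct)
    case const
    then show ?case using assms(1) .
  next
    case (update m i k)
    have "Poly_Mapping.update i k m = m + Poly_Mapping.single i k"
      using update(1) by (intro poly_mapping_eqI)
        (auto simp: lookup_update lookup_add lookup_single when_def in_keys_iff)
    then show ?case using mult[OF update(3) pow, of i k] by (simp add: mult_single)
  qed
  have "Q (\<Sum>m\<in>K. Poly_Mapping.single m (Poly_Mapping.lookup f m))" if "finite K" for K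
    using that by (induction K) (use const[of 0] add mono in auto)
  then show ?thesis using mpoly_expand[of f] by (metis finite_keys)
qed

text \<open>With \<open>p/H\<^sup>N\<close> for the restriction of \<open>f\<close> to the curve, the second equation says that the gradient of \<open>f\<close>
  at \<open>P(t)\<close> applied to \<open>P'(t) = W(t)/H(t)\<^sup>2\<close> is the derivative of \<open>p/H\<^sup>N\<close>. It is cleared of denominators
  so that it can be proved by induction as a polynomial identity, without a theory of rational functions.\<close>

lemma mpoly_chain_rule:
  fixes f :: "('n::finite, 'a::field_char_0) mpoly" and G :: "'n \<Rightarrow> 'a poly" and H :: "'a poly"
  defines "val \<equiv> \<lambda>f t. mpoly_eval (vec_nth (frac_point G H t)) f"
    and "dot \<equiv> \<lambda>f t. \<Sum>i\<in>UNIV. grad f (frac_point G H t) $ i * poly (wronskian G H i) t"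
  shows "\<exists>p N. \<forall>t. poly H t \<noteq> 0 \<longrightarrow> val f t * poly H t ^ N = poly p t \<and>
     dot f t * poly H t ^ N = poly (H * (H * pderiv p - of_nat N * (p * pderiv H))) t"
proof (induction f rule: mpoly_induct)
  case (const a)
  show ?case
    by (rule exI[of _ "[:a:]"], rule exI[of _ 0])
      (simp add: val_def dot_def grad_def mpoly_deriv_single mpoly_eval_single mono_eval_def)
next
  case (var i)
  have "mpoly_eval x (mpoly_deriv j (Poly_Mapping.single (Poly_Mapping.single i 1) 1)) =
      (if j = i then 1 else 0)" for x :: "'n \<Rightarrow> 'a" and j
    by (auto simp: mpoly_deriv_single mpoly_eval_single mono_eval_def lookup_single when_def)
  then have "dot (Poly_Mapping.single (Poly_Mapping.single i 1) 1) t = (\<Sum>j\<in>UNIV. if j = i then poly (wronskian G H j) t else 0)" for t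
    unfolding dot_def grad_def by (intro sum.cong) auto
  then have dot: "dot (Poly_Mapping.single (Poly_Mapping.single i 1) 1) t = poly (wronskian G H i) t" for t by simp
  have val: "val (Poly_Mapping.single (Poly_Mapping.single i 1) 1) t = poly (G i) t / poly H t" for t
    by (simp add: val_def mpoly_eval_single mono_eval_def frac_point_def)
  show ?case unfolding dot val
    by (intro exI[of _ "G i"] exI[of _ 1]) (simp add: wronskian_def algebra_simps)
next
  case (add f g)
  from add(1) obtain p N where p: "\<forall>t. poly H t \<noteq> 0 \<longrightarrow> val f t * poly H t ^ N = poly p t \<and>
     dot f t * poly H t ^ N = poly (H * (H * pderiv p - of_nat N * (p * pderiv H))) t" by (elim exE)
  from add(2) obtain q M where q: "\<forall>t. poly H t \<noteq> 0 \<longrightarrow> val g t * poly H t ^ M = poly q t \<and>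
     dot g t * poly H t ^ M = poly (H * (H * pderiv q - of_nat M * (q * pderiv H))) t" by (elim exE)
  have pow: "H * pderiv (H ^ n) = of_nat n * (H ^ n * pderiv H)" for n
    by (induction n) (simp_all add: pderiv_mult algebra_simps)
  have "H * pderiv (p * H ^ M + q * H ^ N) =
      H ^ M * (H * pderiv p) + p * (H * pderiv (H ^ M)) + H ^ N * (H * pderiv q) + q * (H * pderiv (H ^ N))"
    by (simp add: pderiv_add pderiv_mult algebra_simps)
  then have *: "H * (H * pderiv (p * H ^ M + q * H ^ N) - of_nat (N + M) * ((p * H ^ M + q * H ^ N) * pderiv H)) =
      H ^ M * (H * (H * pderiv p - of_nat N * (p * pderiv H))) +
      H ^ N * (H * (H * pderiv q - of_nat M * (q * pderiv H)))"
    unfolding pow by (simp add: algebra_simps)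
  show ?case
  proof (rule exI[of _ "p * H ^ M + q * H ^ N"], rule exI[of _ "N + M"], intro allI impI, unfold *)
    fix t assume t: "poly H t \<noteq> 0"
    have dot: "dot (f + g) t = dot f t + dot g t"
      by (simp add: dot_def grad_def mpoly_deriv_add mpoly_eval_add distrib_right sum.distrib)
    have val: "val (f + g) t = val f t + val g t" by (simp add: val_def mpoly_eval_add)
    have distr: "(a + b) * poly H t ^ (N + M) =
        poly H t ^ M * (a * poly H t ^ N) + poly H t ^ N * (b * poly H t ^ M)" for a b
      by (simp add: power_add algebra_simps)
    show "val (f + g) t * poly H t ^ (N + M) = poly (p * H ^ M + q * H ^ N) t \<and>
      dot (f + g) t * poly H t ^ (N + M) =
        poly (H ^ M * (H * (H * pderiv p - of_nat N * (p * pderiv H))) +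
          H ^ N * (H * (H * pderiv q - of_nat M * (q * pderiv H)))) t"
      unfolding dot val distr using p[rule_format, OF t] q[rule_format, OF t]
      by (simp only: poly_add poly_mult[of "H ^ _"] poly_mult[of p] poly_mult[of q] poly_power) (simp add: mult.commute)
  qed
next
  case (mult f g)
  from mult(1) obtain p N where p: "\<forall>t. poly H t \<noteq> 0 \<longrightarrow> val f t * poly H t ^ N = poly p t \<and>
     dot f t * poly H t ^ N = poly (H * (H * pderiv p - of_nat N * (p * pderiv H))) t" by (elim exE)
  from mult(2) obtain q M where q: "\<forall>t. poly H t \<noteq> 0 \<longrightarrow> val g t * poly H t ^ M = poly q t \<and>
     dot g t * poly H t ^ M = poly (H * (H * pderiv q - of_nat M * (q * pderiv H))) t" by (elim exE)
  have *: "H * (H * pderiv (p * q) - of_nat (N + M) * ((p * q) * pderiv H)) =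
      p * (H * (H * pderiv q - of_nat M * (q * pderiv H))) +
      q * (H * (H * pderiv p - of_nat N * (p * pderiv H)))"
    by (simp add: pderiv_mult algebra_simps)
  show ?case
  proof (rule exI[of _ "p * q"], rule exI[of _ "N + M"], intro allI impI, unfold *)
    fix t assume t: "poly H t \<noteq> 0"
    have dot: "dot (f * g) t = val f t * dot g t + val g t * dot f t"
      by (simp add: grad_mult dot_def val_def sum_distrib_left distrib_right sum.distrib mult.assoc)
    have val: "val (f * g) t = val f t * val g t" by (simp add: val_def mpoly_eval_mult)
    have distr: "(a * b + c * d) * poly H t ^ (N + M) =
        (a * poly H t ^ N) * (b * poly H t ^ M) + (c * poly H t ^ M) * (d * poly H t ^ N)" for a b c d
      by (simp add: power_add algebra_simps)
    have distr': "(a * b) * poly H t ^ (N + M) = (a * poly H t ^ N) * (b * poly H t ^ M)" for a b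
      by (simp add: power_add algebra_simps)
    show "val (f * g) t * poly H t ^ (N + M) = poly (p * q) t \<and>
      dot (f * g) t * poly H t ^ (N + M) =
        poly (p * (H * (H * pderiv q - of_nat M * (q * pderiv H))) +
          q * (H * (H * pderiv p - of_nat N * (p * pderiv H)))) t"
      unfolding dot val distr distr' using p[rule_format, OF t] q[rule_format, OF t]
      by (simp only: poly_add poly_mult[of p] poly_mult[of q])
  qed
qed

text \<open>The velocity of a curve in \<open>V\<close> is tangent to \<open>V\<close>.\<close>

lemma grad_wronskian_eq_0:
  fixes V :: "('a::field_char_0 ^ 'n::finite) set"
  assumes f: "f \<in> vanishing_ideal V" and "finite Z"
    and on: "\<And>t. t \<notin> Z \<Longrightarrow> poly H t \<noteq> 0 \<Longrightarrow> frac_point G H t \<in> V"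
    and t: "poly H t \<noteq> 0"
  shows "(\<Sum>i\<in>UNIV. grad f (frac_point G H t) $ i * poly (wronskian G H i) t) = 0"
proof -
  from mpoly_chain_rule[of H G f] obtain p N where p: "\<forall>t. poly H t \<noteq> 0 \<longrightarrow>
     mpoly_eval (vec_nth (frac_point G H t)) f * poly H t ^ N = poly p t \<and>
     (\<Sum>i\<in>UNIV. grad f (frac_point G H t) $ i * poly (wronskian G H i) t) * poly H t ^ N =
       poly (H * (H * pderiv p - of_nat N * (p * pderiv H))) t"
    by (elim exE)
  have "H \<noteq> 0" using t by auto
  then have "finite (Z \<union> roots H)" using assms(2) finite_roots by blast
  then have "p = 0"
  proof (rule poly_eq_0_of_cofinite)
    fix t assume "t \<notin> Z \<union> roots H"
    then have t: "t \<notin> Z" "poly H t \<noteq> 0" by (auto simp: roots_def)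
    then show "poly p t = 0" using p[rule_format, OF t(2)] f on[OF t] by (auto simp: vanishing_ideal_def)
  qed
  then show ?thesis using p[rule_format, OF t] t by simp
qed

lemma wronskian_nonzero:
  fixes G :: "'n::finite \<Rightarrow> 'a::field_char_0 poly"
  assumes "poly H s \<noteq> 0" "poly H t \<noteq> 0" "frac_point G H s \<noteq> frac_point G H t"
  shows "\<exists>i. wronskian G H i \<noteq> 0"
proof (rule ccontr)
  assume 0: "\<not> ?thesis"
  have "poly (G i) t / poly H t = poly (G i) s / poly H s" for i
  proof -
    define a where "a = poly (G i) s / poly H s"
    have "G i - smult a H = 0"
    proof (rule wronskian_eq_0_imp_eq_0)
      show "pderiv (G i - smult a H) * H = (G i - smult a H) * pderiv H"
        using 0 by (simp add: wronskian_def pderiv_diff pderiv_smult algebra_simps)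
      show "poly (G i - smult a H) s = 0" using assms(1) by (simp add: a_def)
    qed (fact assms(1))
    then have "G i = smult a H" by simp
    then show ?thesis using assms(1,2) by simp
  qed
  then show False using assms(3) by (simp add: frac_point_def)
qed

text \<open>Dividing by the common power of \<open>X - t0\<close> turns a vector of polynomials that may vanish at \<open>t0\<close> into one
  that does not, without changing directions elsewhere.\<close>

lemma cancel_common_zero:
  fixes W :: "'n::finite \<Rightarrow> 'a::idom poly"
  assumes "W j \<noteq> 0"
  shows "\<exists>m w i. (\<forall>i. W i = [:-t0, 1:] ^ m * w i) \<and> poly (w i) t0 \<noteq> 0"
proof -
  define S where "S = (\<lambda>i. order t0 (W i)) ` {i. W i \<noteq> 0}"
  have S: "finite S" "S \<noteq> {}" using assms by (auto simp: S_def)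
  define m where "m = Min S"
  have "m \<in> S" using Min_in[OF S] by (simp add: m_def)
  then obtain i where i: "W i \<noteq> 0" "order t0 (W i) = m" unfolding S_def by blast
  have "[:-t0, 1:] ^ m dvd W i" for i
  proof (cases "W i = 0")
    case False
    then have "m \<le> order t0 (W i)" unfolding m_def using S(1) by (intro Min_le) (auto simp: S_def)
    then show ?thesis by (simp add: order_divides)
  qed simp
  then obtain w where w: "\<And>i. W i = [:-t0, 1:] ^ m * w i" unfolding dvd_def by metis
  have "poly (w i) t0 \<noteq> 0"
  proof
    assume "poly (w i) t0 = 0"
    moreover have "w i \<noteq> 0" using w[of i] i(1) by auto
    ultimately have "order t0 (w i) \<noteq> 0" by (simp add: order_root)
    moreover have "order t0 (W i) = m + order t0 (w i)"
      using i(1) unfolding w[of i] by (simp add: order_mult order_power_n_n)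
    ultimately show False using i(2) by simp
  qed
  then show ?thesis using w by blast
qed

section \<open>The tangent bundle and its irreducibility\<close>

lemma subspace_dim_1:
  fixes S :: "('a::field ^ 'n::finite) set"
  assumes "vec.subspace S" "vec.dim S = 1" "v \<in> S" "v \<noteq> 0"
  shows "S = range (\<lambda>s. s *s v)"
proof
  have "S \<subseteq> vec.span {v}"
    using assms by (intro vec.card_ge_dim_independent) (auto simp: vec.independent_insert)
  then show "S \<subseteq> range (\<lambda>s. s *s v)" by (simp add: vec.span_singleton)
  show "range (\<lambda>s. s *s v) \<subseteq> S" using assms vec.subspace_scale by blast
qed

lemma subspace_tangent_space:
  fixes V :: "('a::field ^ 'n::finite) set"
  shows "vec.subspace (tangent_space V p)"
proof (rule vec.subspaceI)
  show "0 \<in> tangent_space V p" by (simp add: tangent_space_def)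
next
  fix x y assume "x \<in> tangent_space V p" "y \<in> tangent_space V p"
  then show "x + y \<in> tangent_space V p"
    by (simp add: tangent_space_def distrib_left sum.distrib)
next
  fix c x assume "x \<in> tangent_space V p"
  moreover have "(\<Sum>i\<in>UNIV. grad f p $ i * (c *s x) $ i) = c * (\<Sum>i\<in>UNIV. grad f p $ i * x $ i)" for f
    by (simp add: sum_distrib_left mult.left_commute)
  ultimately show "c *s x \<in> tangent_space V p" by (simp add: tangent_space_def)
qed

definition join_vec :: "'a ^ 'n::finite \<Rightarrow> 'a ^ 'n \<Rightarrow> 'a ^ ('n + 'n)" where
  "join_vec x y = (\<chi> v. case v of Inl i \<Rightarrow> x $ i | Inr i \<Rightarrow> y $ i)"

lemma join_vec_nth [simp]: "join_vec x y $ Inl i = x $ i" "join_vec x y $ Inr i = y $ i"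
  by (simp_all add: join_vec_def)

lemma vec_nth_join_vec: "vec_nth (join_vec x y) = case_sum (vec_nth x) (vec_nth y)"
  by (auto simp: join_vec_def fun_eq_iff split: sum.splits)

lemma join_vec_in_tangent_bundle:
  "join_vec x y \<in> tangent_bundle V \<longleftrightarrow> x \<in> V \<and> y \<in> tangent_space V x"
  by (simp add: tangent_bundle_def)

lemma tangent_bundle_cases:
  assumes "z \<in> tangent_bundle V"
  obtains x y where "z = join_vec x y" "x \<in> V" "y \<in> tangent_space V x"
proof
  show "z = join_vec (\<chi> i. z $ Inl i) (\<chi> i. z $ Inr i)"
    by (auto simp: join_vec_def vec_eq_iff split: sum.splits)
qed (use assms in \<open>auto simp: tangent_bundle_def\<close>)

text \<open>The tangent bundle is cut out by the equations of \<open>V\<close> in the base point and, for every \<open>f\<close> in the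
  vanishing ideal, by the differential of \<open>f\<close>.\<close>

lemma tangent_bundle_closed:
  fixes V :: "('a::comm_semiring_1 ^ 'n::finite) set"
  assumes "zariski_closed V"
  shows "zariski_closed (tangent_bundle V)"
proof -
  obtain S where S: "V = zero_set S" using assms unfolding zariski_closed_def by blast
  define \<Phi> where "\<Phi> = (\<lambda>f c. mpoly_eval (\<lambda>i. c (Inl i)) f) ` S \<union>
     (\<lambda>f c. \<Sum>i\<in>UNIV. mpoly_eval (\<lambda>i. c (Inl i)) (mpoly_deriv i f) * c (Inr i)) ` vanishing_ideal V"
  have "polyfun UNIV \<phi>" if "\<phi> \<in> \<Phi>" for \<phi> :: "('n + 'n \<Rightarrow> 'a) \<Rightarrow> 'a"
    using that unfolding \<Phi>_def
    by (auto intro!: polyfun_sum polyfun.mult polyfun.var polyfun_substitute[OF polyfun_mpoly_eval[OF subset_UNIV]])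
  then have "zariski_closed {z :: 'a ^ ('n + 'n). \<forall>\<phi>\<in>\<Phi>. \<phi> (vec_nth z) = 0}" by (rule zariski_closed_zeros)
  also have "{z. \<forall>\<phi>\<in>\<Phi>. \<phi> (vec_nth z) = 0} = tangent_bundle V"
    by (auto simp: \<Phi>_def tangent_bundle_def tangent_space_def S zero_set_def grad_def vec_lambda_inverse)
  finally show ?thesis .
qed

text \<open>The polynomial \<open>X\<^sup>d p(1/X)\<close>, which describes a form of degree \<open>d\<close> in the coordinate at infinity.\<close>

definition reverse_poly :: "nat \<Rightarrow> 'a::comm_ring_1 poly \<Rightarrow> 'a poly" where
  "reverse_poly d p = (\<Sum>k\<le>d. monom (coeff p k) (d - k))"

lemma poly_reverse_poly:
  fixes p :: "'a::field poly"
  assumes "degree p \<le> d" "t \<noteq> 0"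
  shows "poly (reverse_poly d p) t = t ^ d * poly p (1 / t)"
proof -
  have "poly p (1 / t) = (\<Sum>k\<le>d. coeff p k * (1 / t) ^ k)"
    using poly_as_sum_of_monoms'[OF assms(1)] poly_sum[of "\<lambda>i. monom (coeff p i) i" "{..d}" "1 / t"]
    by (simp only: poly_monom)
  moreover have "t ^ d * (a * (1 / t) ^ k) = a * t ^ (d - k)" if "k \<le> d" for a k
    using assms(2) that by (simp add: power_diff power_divide)
  then have "(\<Sum>k\<le>d. t ^ d * (coeff p k * (1 / t) ^ k)) = (\<Sum>k\<le>d. coeff p k * t ^ (d - k))"
    by (intro sum.cong) auto
  ultimately show ?thesis
    by (simp only: reverse_poly_def poly_sum poly_monom sum_distrib_left)
qed

lemma poly_reverse_poly_0: "poly (reverse_poly d p) 0 = coeff p d"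
proof -
  have "(\<Sum>k\<le>d. coeff p k * 0 ^ (d - k)) = (\<Sum>k\<le>d. if k = d then coeff p k else 0)"
    by (rule sum.cong) (auto simp: power_0_left)
  then show ?thesis by (simp add: reverse_poly_def poly_sum poly_monom)
qed

text \<open>For an irreducible curve smoothness says that every tangent space is a line.\<close>

locale smooth_parametrized_curve = parametrized_curve C G H D U
  for C :: "('a::{alg_closed_field, field_char_0} ^ 'n::finite) set" and G H D U +
  assumes tangent_dim: "\<And>p. p \<in> C \<Longrightarrow> vec.dim (tangent_space C p) = 1"
begin

abbreviation "W \<equiv> wronskian G H"

text \<open>The multiple \<open>H\<^sup>2 P'\<close> of the derivative, which is polynomial and spans the same line.\<close>

definition velocity :: "'a \<Rightarrow> 'a ^ 'n" where
  "velocity t = (\<chi> i. poly (W i) t)"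

lemma velocity_nonzero: "t \<in> U \<Longrightarrow> velocity t \<noteq> 0"
  using immersed[of t] by (auto simp: velocity_def vec_eq_iff)

lemma tangent_space_eq: "p \<in> C \<Longrightarrow> v \<in> tangent_space C p \<Longrightarrow> v \<noteq> 0 \<Longrightarrow> tangent_space C p = range (\<lambda>s. s *s v)"
  using subspace_dim_1[OF subspace_tangent_space] tangent_dim by blast

lemma tangent_space_P: "t \<in> U \<Longrightarrow> tangent_space C (P t) = range (\<lambda>s. s *s velocity t)"
proof (rule tangent_space_eq)
  assume t: "t \<in> U"
  show "velocity t \<in> tangent_space C (P t)"
    using grad_wronskian_eq_0[OF _ cofinite _ defined[OF t]] on_curve
    by (auto simp: tangent_space_def velocity_def)
qed (use on_curve velocity_nonzero in auto)

text \<open>The vanishing of \<open>\<phi>\<close> extends to the fibre over a limit point of the parametrized part. The velocity of the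
  rational curve \<open>A/B\<close>, divided by the power of \<open>X - t0\<close> that it contains, is a nonzero tangent vector
  at almost every parameter; continuation shows that it is tangent at \<open>t0\<close> as well. There the tangent
  space is a line, so this limit direction spans it, and \<open>\<phi>\<close> vanishes on the line by continuation.\<close>

lemma limit_in_closure:
  assumes \<phi>: "polyfun UNIV \<phi>"
    and van: "\<And>t y. t \<in> U \<Longrightarrow> y \<in> tangent_space C (P t) \<Longrightarrow> \<phi> (vec_nth (join_vec (P t) y)) = 0"
    and Z: "finite Z" "\<And>t. t \<notin> Z \<Longrightarrow> poly B t \<noteq> 0 \<Longrightarrow> frac_point A B t \<in> P ` U"
    and nonconst: "poly B s1 \<noteq> 0" "poly B s2 \<noteq> 0" "frac_point A B s1 \<noteq> frac_point A B s2"
    and t0: "poly B t0 \<noteq> 0" "frac_point A B t0 \<in> C"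
    and y: "y \<in> tangent_space C (frac_point A B t0)"
  shows "\<phi> (vec_nth (join_vec (frac_point A B t0) y)) = 0"
proof -
  let ?Q = "frac_point A B"
  obtain j where "wronskian A B j \<noteq> 0" using wronskian_nonzero[OF nonconst] by blast
  then obtain m w i0 where w: "\<And>i. wronskian A B i = [:-t0, 1:] ^ m * w i" and i0: "poly (w i0) t0 \<noteq> 0"
    using cancel_common_zero[of "wronskian A B" j t0] by metis
  define d where "d t = (\<chi> i. poly (w i) t)" for t
  have tangent: "d t \<in> tangent_space C (?Q t)" if t: "t \<noteq> t0" "poly B t \<noteq> 0" for t
    unfolding tangent_space_def
  proof (intro CollectI ballI)
    fix f assume f: "f \<in> vanishing_ideal C"
    have "(\<Sum>i\<in>UNIV. grad f (?Q t) $ i * poly (wronskian A B i) t) = 0"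
      using f Z(1) subsetD[OF image_subsetI[OF on_curve] Z(2)] t(2) by (rule grad_wronskian_eq_0)
    then have "(t - t0) ^ m * (\<Sum>i\<in>UNIV. grad f (?Q t) $ i * d t $ i) = 0"
      by (simp add: w d_def sum_distrib_left mult.left_commute)
    then show "(\<Sum>i\<in>UNIV. grad f (?Q t) $ i * d t $ i) = 0" using t(1) by simp
  qed
  define n where "n s v = (case v of Inl i \<Rightarrow> A i | Inr i \<Rightarrow> smult s (w i) * B)" for s and v :: "'n + 'n"
  have join: "vec_nth (join_vec (?Q t) (s *s d t)) = (\<lambda>v. poly (n s v) t / poly B t)"
    if "poly B t \<noteq> 0" for s t
    using that by (auto simp: fun_eq_iff vec_nth_join_vec n_def d_def frac_point_def split: sum.splits)
  have "d t0 \<in> tangent_space C (?Q t0)"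
    unfolding tangent_space_def
  proof (intro CollectI ballI)
    fix f assume f: "f \<in> vanishing_ideal C"
    define \<psi> where "\<psi> c = (\<Sum>i\<in>UNIV. mpoly_eval (\<lambda>i. c (Inl i)) (mpoly_deriv i f) * c (Inr i))"
      for c :: "'n + 'n \<Rightarrow> 'a"
    have \<psi>: "\<psi> (vec_nth (join_vec x y)) = (\<Sum>i\<in>UNIV. grad f x $ i * y $ i)" for x y
      by (simp add: \<psi>_def grad_def vec_nth_join_vec)
    have "\<psi> (\<lambda>v. poly (n 1 v) t0 / poly B t0) = 0"
    proof (rule polyfun_vanish_continuation[where Z = "insert t0 Z" and V = UNIV and \<phi> = \<psi> and d = B])
      show "polyfun UNIV \<psi>" unfolding \<psi>_def
        by (intro polyfun_sum polyfun.mult polyfun.var polyfun_substitute[OF polyfun_mpoly_eval[OF subset_UNIV]]) auto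
      fix t assume t: "t \<notin> insert t0 Z" "poly B t \<noteq> 0"
      then have "(\<Sum>i\<in>UNIV. grad f (?Q t) $ i * d t $ i) = 0"
        using tangent[of t] f by (auto simp: tangent_space_def)
      then show "\<psi> (\<lambda>v. poly (n 1 v) t / poly B t) = 0"
        using \<psi>[of "?Q t" "1 *s d t"] join[OF t(2), of 1] by simp
    qed (use Z t0 in auto)
    then show "(\<Sum>i\<in>UNIV. grad f (?Q t0) $ i * d t0 $ i) = 0"
      using \<psi>[of "?Q t0" "1 *s d t0"] join[OF t0(1), of 1] by simp
  qed
  moreover have "d t0 \<noteq> 0" using i0 by (auto simp: d_def vec_eq_iff)
  ultimately obtain s where s: "y = s *s d t0" using tangent_space_eq[OF t0(2)] y by blast
  have "\<phi> (\<lambda>v. poly (n s v) t0 / poly B t0) = 0"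
  proof (rule polyfun_vanish_continuation[where Z = "insert t0 Z", OF \<phi>])
    fix t assume t: "t \<notin> insert t0 Z" "poly B t \<noteq> 0"
    then obtain u where u: "u \<in> U" "?Q t = P u" using Z(2) by blast
    have "s *s d t \<in> tangent_space C (?Q t)"
      using tangent[of t] t vec.subspace_scale[OF subspace_tangent_space] by auto
    then show "\<phi> (\<lambda>v. poly (n s v) t / poly B t) = 0"
      using van[OF u(1), of "s *s d t"] u(2) join[OF t(2), of s] by simp
  qed (use Z t0 in auto)
  then show ?thesis using join[OF t0(1), of s] s by simp
qed

text \<open>Every point of the curve is the value of \<open>G/H\<close> at a parameter, or at infinity; in the latter case the
  reversed polynomials move it to the parameter 0.\<close>

lemma tangent_bundle_dense:
  assumes \<phi>: "polyfun UNIV \<phi>"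
    and van: "\<And>t s. t \<in> U \<Longrightarrow> \<phi> (vec_nth (join_vec (P t) (s *s velocity t))) = 0"
    and z: "z \<in> tangent_bundle C"
  shows "\<phi> (vec_nth z) = 0"
proof -
  have van': "\<phi> (vec_nth (join_vec (P t) y)) = 0" if "t \<in> U" "y \<in> tangent_space C (P t)" for t y
    using that van tangent_space_P by auto
  obtain x y where xy: "z = join_vec x y" "x \<in> C" "y \<in> tangent_space C x"
    using z by (rule tangent_bundle_cases)
  obtain u1 where u1: "u1 \<in> U" "u1 \<noteq> 0"
    using ex_new_if_finite[OF infinite_UNIV_char_0, of "insert 0 (- U)"] cofinite by auto
  obtain u2 where u2: "u2 \<in> U" "u2 \<noteq> 0" "u2 \<noteq> u1"
    using ex_new_if_finite[OF infinite_UNIV_char_0, of "{0, u1} \<union> - U"] cofinite by auto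
  have P12: "P u1 \<noteq> P u2" using inj u1 u2 by (metis inj_onD)
  consider t where "poly H t \<noteq> 0" "x = P t" | "coeff H D \<noteq> 0" "x = point_at_infinity"
    using curve_points[OF xy(2)] by blast
  then show ?thesis
  proof cases
    case 1
    show ?thesis unfolding xy(1) 1(2)
    proof (rule limit_in_closure[OF \<phi> van' cofinite _ defined defined P12])
      show "P t \<in> C" "y \<in> tangent_space C (P t)" using xy 1 by auto
    qed (use 1 u1 u2 in auto)
  next
    case 2
    define A where "A i = reverse_poly D (G i)" for i
    define B where "B = reverse_poly D H"
    have AB: "frac_point A B t = P (1 / t)" "poly B t \<noteq> 0 \<longleftrightarrow> poly H (1 / t) \<noteq> 0" if "t \<noteq> 0" for t
      using that deg_G deg_H by (auto simp: A_def B_def frac_point_def poly_reverse_poly)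
    have x: "frac_point A B 0 = x"
      by (simp add: 2 A_def B_def frac_point_def point_at_infinity_def poly_reverse_poly_0)
    have fin: "finite (insert 0 ((\<lambda>u. 1 / u) ` (- U)))" using cofinite by simp
    \<comment> \<open>The value at 0 of the reversed parametrization is the point at infinity; the parameter 0 and the inverses of the
      excluded parameters are exceptional.\<close>
    show ?thesis unfolding xy(1) x[symmetric]
    proof (rule limit_in_closure[OF \<phi> van' fin, of B A "1 / u1" "1 / u2"])
      fix t assume t: "t \<notin> insert 0 ((\<lambda>u. 1 / u) ` (- U))"
      have "t = 1 / (1 / t)" by simp
      then have "1 / t \<in> U" using t by blast
      then show "frac_point A B t \<in> P ` U" using AB t by auto
    next
      show "poly B 0 \<noteq> 0" using 2 by (simp add: B_def poly_reverse_poly_0)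
    qed (use AB u1 u2 P12 defined xy x in auto)
  qed
qed

lemma velocity_tangent: "t \<in> U \<Longrightarrow> join_vec (P t) (s *s velocity t) \<in> tangent_bundle C"
  using on_curve tangent_space_P by (auto simp: join_vec_in_tangent_bundle)

text \<open>The bundle is the closure of the image of pairs \<open>(t, s)\<close>. Two of these, at which \<open>\<phi>\<close> and \<open>\<psi>\<close>
  do not vanish, are joined by a line in the parameter plane, on which both functions are nonzero
  rational functions.\<close>

lemma tangent_bundle_irreducible: "zariski_irreducible (tangent_bundle C)"
proof (rule zariski_irreducibleI)
  show "tangent_bundle C \<noteq> {}" using velocity_tangent U_nonempty by blast
  fix \<phi> \<psi> z z'
  assume \<phi>: "polyfun UNIV \<phi>" "z \<in> tangent_bundle C" "\<phi> (vec_nth z) \<noteq> 0"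
    and \<psi>: "polyfun UNIV \<psi>" "z' \<in> tangent_bundle C" "\<psi> (vec_nth z') \<noteq> 0"
  let ?z = "\<lambda>t s. join_vec (P t) (s *s velocity t)"
  obtain t1 s1 where 1: "t1 \<in> U" "\<phi> (vec_nth (?z t1 s1)) \<noteq> 0"
    using tangent_bundle_dense[OF \<phi>(1) _ \<phi>(2)] \<phi>(3) by blast
  obtain t2 s2 where 2: "t2 \<in> U" "\<psi> (vec_nth (?z t2 s2)) \<noteq> 0"
    using tangent_bundle_dense[OF \<psi>(1) _ \<psi>(2)] \<psi>(3) by blast
  define t where "t = [:t1, t2 - t1:]"
  define s where "s = [:s1, s2 - s1:]"
  define n where "n v = (case v of Inl i \<Rightarrow> G i \<circ>\<^sub>p t | Inr i \<Rightarrow> s * (W i \<circ>\<^sub>p t) * (H \<circ>\<^sub>p t))" for v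
  have line: "vec_nth (?z (poly t l) (poly s l)) = (\<lambda>v. poly (n v) l / poly (H \<circ>\<^sub>p t) l)"
    if "poly H (poly t l) \<noteq> 0" for l
    using that by (auto simp: fun_eq_iff vec_nth_join_vec n_def velocity_def frac_point_def poly_pcompose
        split: sum.splits)
  obtain p N where p: "\<And>l. poly H (poly t l) \<noteq> 0 \<Longrightarrow>
      \<phi> (vec_nth (?z (poly t l) (poly s l))) * poly H (poly t l) ^ N = poly p l"
    using polyfun_subst_rational[OF \<phi>(1), of "H \<circ>\<^sub>p t" n] line unfolding poly_pcompose by auto
  obtain q M where q: "\<And>l. poly H (poly t l) \<noteq> 0 \<Longrightarrow>
      \<psi> (vec_nth (?z (poly t l) (poly s l))) * poly H (poly t l) ^ M = poly q l"
    using polyfun_subst_rational[OF \<psi>(1), of "H \<circ>\<^sub>p t" n] line unfolding poly_pcompose by auto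
  \<comment> \<open>The point to be chosen on the line must also have its parameter in \<open>U\<close>, that is, outside the zeros of \<open>u\<close>.\<close>
  define u where "u = (\<Prod>r\<in>- U. [:-r, 1:])"
  have u: "poly u a = 0 \<longleftrightarrow> a \<notin> U" for a
    unfolding u_def poly_prod using cofinite by auto
  have ends: "poly t 0 = t1" "poly s 0 = s1" "poly t 1 = t2" "poly s 1 = s2" by (auto simp: t_def s_def)
  have "p \<noteq> 0" using p[of 0] 1 defined by (auto simp: ends)
  moreover have "q \<noteq> 0" using q[of 1] 2 defined by (auto simp: ends)
  moreover have "u \<circ>\<^sub>p t \<noteq> 0" using u[of t1] 1(1) ends(1) by (metis poly_pcompose poly_0)
  ultimately have "p * q * (u \<circ>\<^sub>p t) \<noteq> 0" by simp
  then obtain l where l: "poly (p * q * (u \<circ>\<^sub>p t)) l \<noteq> 0"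
    using poly_eq_0_of_cofinite[of "{}" "p * q * (u \<circ>\<^sub>p t)"] by auto
  then have U: "poly t l \<in> U" using u by (simp add: poly_pcompose)
  then show "\<exists>z\<in>tangent_bundle C. \<phi> (vec_nth z) \<noteq> 0 \<and> \<psi> (vec_nth z) \<noteq> 0"
    using p[OF defined[OF U]] q[OF defined[OF U]] l velocity_tangent[OF U]
    by (intro bexI[of _ "?z (poly t l) (poly s l)"]) auto
qed

end

section \<open>The dimension of the tangent bundle\<close>

text \<open>Gaussian elimination: more unknowns than equations.\<close>

lemma underdetermined_system:
  fixes M :: "'j \<Rightarrow> 'i \<Rightarrow> 'a::field"
  assumes "finite J" "finite I" "card J < card I"
  shows "\<exists>c. (\<exists>i\<in>I. c i \<noteq> 0) \<and> (\<forall>j\<in>J. (\<Sum>i\<in>I. M j i * c i) = 0)"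
  using assms
proof (induction J arbitrary: I M rule: finite_induct)
  case empty
  then have "I \<noteq> {}" by auto
  then show ?case by (intro exI[of _ "\<lambda>_. 1"]) auto
next
  case (insert j J)
  show ?case
  proof (cases "\<forall>i\<in>I. M j i = 0")
    case True
    have "card J < card I" using insert.prems insert.hyps by simp
    then obtain c where "\<exists>i\<in>I. c i \<noteq> 0" "\<forall>j\<in>J. (\<Sum>i\<in>I. M j i * c i) = 0"
      using insert.IH[of I M] insert.prems(1) by blast
    then show ?thesis using True by (intro exI[of _ c]) auto
  next
    case False
    then obtain b where b: "b \<in> I" "M j b \<noteq> 0" by blast
    define N where "N k i = M k i - M k b * M j i / M j b" for k i
    have "card J < card (I - {b})" using insert b by (simp add: card_Diff_singleton)
    then obtain c where c: "\<exists>i\<in>I - {b}. c i \<noteq> 0" "\<And>k. k \<in> J \<Longrightarrow> (\<Sum>i\<in>I - {b}. N k i * c i) = 0"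
      using insert.IH[of "I - {b}" N] insert.prems by auto
    define d where "d i = (if i = b then - (\<Sum>i\<in>I - {b}. M j i * c i) / M j b else c i)" for i
    have sum: "(\<Sum>i\<in>I. M k i * d i) = (\<Sum>i\<in>I - {b}. M k i * c i) - M k b * (\<Sum>i\<in>I - {b}. M j i * c i) / M j b" for k
    proof -
      have "(\<Sum>i\<in>I. M k i * d i) = M k b * d b + (\<Sum>i\<in>I - {b}. M k i * d i)"
        using insert.prems b by (simp add: sum.remove)
      also have "(\<Sum>i\<in>I - {b}. M k i * d i) = (\<Sum>i\<in>I - {b}. M k i * c i)"
        by (intro sum.cong) (auto simp: d_def)
      finally show ?thesis by (simp add: d_def)
    qed
    have "(\<Sum>i\<in>I. M k i * d i) = 0" if "k \<in> insert j J" for k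
    proof (cases "k = j")
      case True
      then show ?thesis using b by (simp add: sum)
    next
      case False
      have "(\<Sum>i\<in>I - {b}. N k i * c i) =
          (\<Sum>i\<in>I - {b}. M k i * c i) - M k b * (\<Sum>i\<in>I - {b}. M j i * c i) / M j b"
        by (simp add: N_def left_diff_distrib sum_subtractf sum_distrib_left sum_divide_distrib mult.assoc)
      then show ?thesis using False that c(2)[of k] by (simp add: sum)
    qed
    moreover have "\<exists>i\<in>I. d i \<noteq> 0" using c(1) by (auto simp: d_def)
    ultimately show ?thesis by blast
  qed
qed

text \<open>A bound on the degree in each variable separately. Sums and products are easy to bound in this form,
  and it is enough to test vanishing on a grid, so no coefficients of two-variable polynomials are needed.\<close>

definition bipoly :: "nat \<Rightarrow> ('a \<Rightarrow> 'a \<Rightarrow> 'a::comm_ring_1) \<Rightarrow> bool" where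
  "bipoly d X \<longleftrightarrow> (\<forall>s. \<exists>p. degree p \<le> d \<and> (\<forall>t. X t s = poly p t)) \<and>
     (\<forall>t. \<exists>p. degree p \<le> d \<and> (\<forall>s. X t s = poly p s))"

lemma bipoly_mono: "bipoly d X \<Longrightarrow> d \<le> e \<Longrightarrow> bipoly e X"
  unfolding bipoly_def by (meson order_trans)

lemma bipoly_const: "bipoly 0 (\<lambda>t s. a)"
  unfolding bipoly_def by (intro conjI allI exI[of _ "[:a:]"]) auto

lemma bipoly_fst: "bipoly (degree p) (\<lambda>t s. poly p t)"
  unfolding bipoly_def
proof (intro conjI allI)
  show "\<exists>q. degree q \<le> degree p \<and> (\<forall>t. poly p t = poly q t)" by (intro exI[of _ p]) auto
  show "\<exists>q. degree q \<le> degree p \<and> (\<forall>s. poly p t = poly q s)" for t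
    by (intro exI[of _ "[:poly p t:]"]) auto
qed

lemma bipoly_snd: "bipoly 1 (\<lambda>t s. s :: 'a::comm_ring_1)"
  unfolding bipoly_def
proof (intro conjI allI)
  show "\<exists>q. degree q \<le> 1 \<and> (\<forall>t. s = poly q t)" for s :: 'a by (intro exI[of _ "[:s:]"]) auto
  show "\<exists>q. degree q \<le> 1 \<and> (\<forall>s :: 'a. s = poly q s)" by (intro exI[of _ "[:0, 1 :: 'a:]"]) auto
qed

lemma bipoly_add:
  assumes "bipoly d X" "bipoly d Y" shows "bipoly d (\<lambda>t s. X t s + Y t s)"
  unfolding bipoly_def
proof (intro conjI allI)
  fix s
  obtain p q where "degree p \<le> d" "\<forall>t. X t s = poly p t" "degree q \<le> d" "\<forall>t. Y t s = poly q t"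
    using assms unfolding bipoly_def by meson
  then show "\<exists>p. degree p \<le> d \<and> (\<forall>t. X t s + Y t s = poly p t)"
    by (intro exI[of _ "p + q"]) (auto intro: degree_add_le)
next
  fix t
  obtain p q where "degree p \<le> d" "\<forall>s. X t s = poly p s" "degree q \<le> d" "\<forall>s. Y t s = poly q s"
    using assms unfolding bipoly_def by meson
  then show "\<exists>p. degree p \<le> d \<and> (\<forall>s. X t s + Y t s = poly p s)"
    by (intro exI[of _ "p + q"]) (auto intro: degree_add_le)
qed

lemma bipoly_mult:
  assumes "bipoly d X" "bipoly e Y" shows "bipoly (d + e) (\<lambda>t s. X t s * Y t s)"
  unfolding bipoly_def
proof (intro conjI allI)
  fix s
  obtain p q where "degree p \<le> d" "\<forall>t. X t s = poly p t" "degree q \<le> e" "\<forall>t. Y t s = poly q t"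
    using assms unfolding bipoly_def by meson
  then show "\<exists>p. degree p \<le> d + e \<and> (\<forall>t. X t s * Y t s = poly p t)"
    by (intro exI[of _ "p * q"]) (auto intro: order_trans[OF degree_mult_le] add_mono)
next
  fix t
  obtain p q where "degree p \<le> d" "\<forall>s. X t s = poly p s" "degree q \<le> e" "\<forall>s. Y t s = poly q s"
    using assms unfolding bipoly_def by meson
  then show "\<exists>p. degree p \<le> d + e \<and> (\<forall>s. X t s * Y t s = poly p s)"
    by (intro exI[of _ "p * q"]) (auto intro: order_trans[OF degree_mult_le] add_mono)
qed

lemma bipoly_power: "bipoly d X \<Longrightarrow> bipoly (n * d) (\<lambda>t s. X t s ^ n)"
proof (induction n)
  case 0
  show ?case using bipoly_const[of 1] by simp
next
  case (Suc n)
  then show ?case using bipoly_mult[of d X "n * d" "\<lambda>t s. X t s ^ n"] by simp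
qed

lemma bipoly_sum:
  "(\<And>i. i \<in> I \<Longrightarrow> bipoly d (X i)) \<Longrightarrow> bipoly d (\<lambda>t s. \<Sum>i\<in>I. X i t s)"
proof (induction I rule: infinite_finite_induct)
  case (insert i I)
  then show ?case using bipoly_add[of d "X i"] by simp
qed (use bipoly_mono[OF bipoly_const[of 0]] in auto)

lemma bipoly_vanish_on_grid:
  fixes X :: "'a \<Rightarrow> 'a \<Rightarrow> 'a::idom"
  assumes X: "bipoly d X" and A: "finite A" "card A > d"
    and 0: "\<And>t s. t \<in> A \<Longrightarrow> s \<in> A \<Longrightarrow> X t s = 0"
  shows "X t s = 0"
proof -
  have row: "X t s = 0" if s: "s \<in> A" for t s
  proof -
    obtain p where p: "degree p \<le> d" "\<And>t. X t s = poly p t" using X unfolding bipoly_def by meson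
    have "p = 0"
      by (rule many_roots_imp_0[of A]) (use A 0[OF _ s] p in \<open>auto simp: roots_def\<close>)
    then show ?thesis using p(2) by simp
  qed
  obtain p where p: "degree p \<le> d" "\<And>s. X t s = poly p s" using X unfolding bipoly_def by meson
  have "p = 0"
    by (rule many_roots_imp_0[of A]) (use A row[of _ t] p in \<open>auto simp: roots_def\<close>)
  then show ?thesis using p(2) by simp
qed

text \<open>Three rational functions in two variables are algebraically dependent. The monomials in \<open>x\<close>, \<open>y\<close>, \<open>z\<close> with
  exponents up to \<open>N\<close> number \<open>(N + 1)\<^sup>3\<close>; multiplied by a common denominator they have degree \<open>O(N)\<close> in
  each variable, so that \<open>O(N\<^sup>2)\<close> values on a grid determine a linear combination of them. The
  relation is nested as a polynomial in \<open>z\<close> over polynomials in \<open>y\<close> over polynomials in \<open>x\<close>, the form in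
  which \<open>no_chain_of_length_3\<close> takes it apart.\<close>

lemma algebraic_dependence:
  fixes x y z :: "'a \<Rightarrow> 'a \<Rightarrow> 'a::field_char_0"
  assumes x: "bipoly d X" "\<And>t s. poly h t \<noteq> 0 \<Longrightarrow> x t s * poly h t ^ a = X t s"
    and y: "bipoly e Y" "\<And>t s. poly h t \<noteq> 0 \<Longrightarrow> y t s * poly h t ^ b = Y t s"
    and z: "bipoly f Z" "\<And>t s. poly h t \<noteq> 0 \<Longrightarrow> z t s * poly h t ^ c = Z t s"
  shows "\<exists>N r. (\<exists>i\<le>N. \<exists>j\<le>N. \<exists>k\<le>N. r i j k \<noteq> 0) \<and> (\<forall>t s. poly h t \<noteq> 0 \<longrightarrow>
     (\<Sum>k\<le>N. z t s ^ k * (\<Sum>j\<le>N. y t s ^ j * (\<Sum>i\<le>N. x t s ^ i * r i j k))) = 0)"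
proof -
  \<comment> \<open>The scaled monomials have degree at most \<open>N m\<close>; the choice \<open>N = m\<^sup>2\<close> makes the
    number of grid points \<open>(N m + 1)\<^sup>2 \<le> (N + 1)\<^sup>2 N\<close> smaller than that of the monomials.\<close>
  define m where "m = Suc (d + e + f + (a + b + c) * degree h)"
  define N where "N = m * m"
  define h' where "h' n t s = poly h t ^ n" for n and t s :: 'a
  have h': "bipoly (n * degree h) (h' n)" for n unfolding h'_def by (intro bipoly_power bipoly_fst)
  define M where "M = (\<lambda>(i, j, k) t s. (X t s ^ i * Y t s ^ j * Z t s ^ k) *
     h' ((N - i) * a + (N - j) * b + (N - k) * c) t s)"
  define I where "I = {..N} \<times> {..N} \<times> {..N}"
  have M: "bipoly (N * m) (M v)" if "v \<in> I" for v
  proof -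
    obtain i j k where v: "v = (i, j, k)" by (cases v)
    have ijk: "i \<le> N" "j \<le> N" "k \<le> N" using that v by (auto simp: I_def)
    have "bipoly ((i * d + j * e + k * f) + ((N - i) * a + (N - j) * b + (N - k) * c) * degree h) (M v)"
      unfolding M_def v prod.case by (intro bipoly_mult bipoly_power x y z h')
    moreover have "i * d + j * e + k * f \<le> N * d + N * e + N * f"
      using ijk by (intro add_mono mult_right_mono) auto
    moreover have "((N - i) * a + (N - j) * b + (N - k) * c) * degree h \<le> (N * a + N * b + N * c) * degree h"
      by (intro add_mono mult_right_mono) auto
    moreover have "N * d + N * e + N * f + (N * a + N * b + N * c) * degree h \<le> N * m"
      by (simp add: m_def algebra_simps)
    ultimately show ?thesis by (meson add_mono bipoly_mono order_trans)
  qed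
  obtain A :: "'a set" where A: "finite A" "card A = Suc (N * m)"
    using infinite_arbitrarily_large[OF infinite_UNIV_char_0] by blast
  have "card (A \<times> A) < card I"
  proof -
    have "1 \<le> m" unfolding m_def by simp
    then have le: "Suc (N * m) \<le> Suc N * m" by simp
    have "Suc (N * m) * Suc (N * m) \<le> (Suc N * m) * (Suc N * m)" by (rule mult_le_mono[OF le le])
    also have "\<dots> = Suc N * (Suc N * N)" by (simp add: N_def algebra_simps)
    also have "\<dots> < Suc N * (Suc N * Suc N)" by (intro mult_strict_left_mono) auto
    finally show ?thesis using A by (simp add: I_def card_cartesian_product)
  qed
  then obtain r where r: "\<exists>v\<in>I. r v \<noteq> 0"
    "\<forall>q\<in>A \<times> A. (\<Sum>v\<in>I. (case q of (t, s) \<Rightarrow> M v t s) * r v) = 0"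
    using underdetermined_system[of "A \<times> A" I "\<lambda>q v. case q of (t, s) \<Rightarrow> M v t s"] A
    by (auto simp: I_def)
  have F: "bipoly (N * m) (\<lambda>t s. \<Sum>v\<in>I. M v t s * r v)"
  proof (rule bipoly_sum)
    fix v assume "v \<in> I"
    from bipoly_mult[OF M[OF this] bipoly_const[of "r v"]]
    show "bipoly (N * m) (\<lambda>t s. M v t s * r v)" by simp
  qed
  have 0: "(\<Sum>v\<in>I. M v t s * r v) = 0" for t s
    using bipoly_vanish_on_grid[OF F A(1), of t s] A(2) r(2) by auto
  show ?thesis
  proof (rule exI[of _ N], rule exI[of _ "\<lambda>i j k. r (i, j, k)"], rule conjI, goal_cases)
    case 1
    show ?case using r(1) by (auto simp: I_def)
  next
    case 2
    show ?case
    proof (intro allI impI)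
      fix t s assume t: "poly h t \<noteq> 0"
      define L where "L = N * a + N * b + N * c"
      have M_eq: "M (i, j, k) t s = poly h t ^ L * (x t s ^ i * y t s ^ j * z t s ^ k)"
        if "i \<le> N" "j \<le> N" "k \<le> N" for i j k
      proof -
        have "N * a = i * a + (N - i) * a" "N * b = j * b + (N - j) * b" "N * c = k * c + (N - k) * c"
          using that by (metis add_mult_distrib le_add_diff_inverse)+
        then have L: "L = (i * a + j * b + k * c) + ((N - i) * a + (N - j) * b + (N - k) * c)"
          unfolding L_def by presburger
        have "X t s ^ i * Y t s ^ j * Z t s ^ k = poly h t ^ (i * a + j * b + k * c) * (x t s ^ i * y t s ^ j * z t s ^ k)"
          unfolding x(2)[OF t, symmetric] y(2)[OF t, symmetric] z(2)[OF t, symmetric]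
          by (simp add: power_mult_distrib power_add power_mult[symmetric] mult_ac)
        then show ?thesis unfolding M_def prod.case h'_def L power_add by (simp add: mult_ac)
      qed
      have "(\<Sum>v\<in>I. M v t s * r v) = (\<Sum>i\<le>N. \<Sum>j\<le>N. \<Sum>k\<le>N. M (i, j, k) t s * r (i, j, k))"
        unfolding I_def by (simp add: sum.cartesian_product split_def)
      also have "\<dots> = (\<Sum>i\<le>N. \<Sum>j\<le>N. \<Sum>k\<le>N. poly h t ^ L * (z t s ^ k * (y t s ^ j * (x t s ^ i * r (i, j, k)))))"
        by (intro sum.cong refl) (simp add: M_eq mult_ac)
      also have "\<dots> = (\<Sum>k\<le>N. \<Sum>j\<le>N. \<Sum>i\<le>N. poly h t ^ L * (z t s ^ k * (y t s ^ j * (x t s ^ i * r (i, j, k)))))"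
        by (subst sum.swap, subst (2) sum.swap, subst sum.swap, rule refl)
      also have "\<dots> = poly h t ^ L * (\<Sum>k\<le>N. z t s ^ k * (\<Sum>j\<le>N. y t s ^ j * (\<Sum>i\<le>N. x t s ^ i * r (i, j, k))))"
        by (simp add: sum_distrib_left)
      finally show "(\<Sum>k\<le>N. z t s ^ k * (\<Sum>j\<le>N. y t s ^ j * (\<Sum>i\<le>N. x t s ^ i * r (i, j, k)))) = 0"
        using 0[of t s] t by simp
    qed
  qed
qed

text \<open>A relation \<open>\<Sum>\<^sub>k x\<^sup>k A\<^sub>k = 0\<close> on an irreducible set may be divided by \<open>x\<^sup>m\<close> if \<open>x\<close> is not identically zero there;
  where \<open>x\<close> does vanish, only the coefficient of lowest order is left.\<close>

lemma leading_term_vanishes: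
  fixes Z :: "('a::idom ^ 'n::finite) set"
  assumes Z: "zariski_irreducible Z" "Y \<subseteq> Z"
    and x: "polyfun UNIV x" "\<And>p. p \<in> Y \<Longrightarrow> x (vec_nth p) = 0" "q \<in> Z" "x (vec_nth q) \<noteq> 0"
    and A: "\<And>k. polyfun UNIV (A k)"
    and sum: "\<And>p. p \<in> Z \<Longrightarrow> (\<Sum>k\<le>N. x (vec_nth p) ^ k * A k (vec_nth p)) = 0"
    and low: "m \<le> N" "\<And>k c. k < m \<Longrightarrow> A k c = 0"
    and p: "p \<in> Y"
  shows "A m (vec_nth p) = 0"
proof -
  define B where "B c = (\<Sum>k\<in>{m<..N}. x c ^ (k - Suc m) * A k c)" for c
  have split: "(\<Sum>k\<le>N. x c ^ k * A k c) = x c ^ m * (A m c + x c * B c)" for c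
  proof -
    have "{..N} = {..<m} \<union> ({m} \<union> {m<..N})" using low(1) by auto
    then have "(\<Sum>k\<le>N. x c ^ k * A k c) = (\<Sum>k<m. x c ^ k * A k c) + (\<Sum>k\<in>{m} \<union> {m<..N}. x c ^ k * A k c)"
      by (simp only:) (rule sum.union_disjoint; auto)
    also have "(\<Sum>k<m. x c ^ k * A k c) = 0" using low(2) by simp
    also have "(\<Sum>k\<in>{m} \<union> {m<..N}. x c ^ k * A k c) = x c ^ m * A m c + (\<Sum>k\<in>{m<..N}. x c ^ k * A k c)"
      by (subst sum.union_disjoint) auto
    also have "(\<Sum>k\<in>{m<..N}. x c ^ k * A k c) = (\<Sum>k\<in>{m<..N}. x c ^ m * (x c * (x c ^ (k - Suc m) * A k c)))"
    proof (rule sum.cong[OF refl])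
      fix k assume "k \<in> {m<..N}"
      then have "x c ^ k = x c ^ m * (x c * x c ^ (k - Suc m))"
        by (simp add: power_Suc[symmetric] power_add[symmetric] del: power_Suc)
      then show "x c ^ k * A k c = x c ^ m * (x c * (x c ^ (k - Suc m) * A k c))" by (simp add: mult_ac)
    qed
    finally show ?thesis by (simp add: B_def sum_distrib_left distrib_left)
  qed
  have "A m (vec_nth p) + x (vec_nth p) * B (vec_nth p) = 0"
  proof (rule zariski_irreducibleD[OF Z(1), of "\<lambda>c. x c ^ m" "\<lambda>c. A m c + x c * B c" q])
    show "polyfun UNIV (\<lambda>c. x c ^ m)" using x by (intro polyfun_intros)
    show "polyfun UNIV (\<lambda>c. A m c + x c * B c)" unfolding B_def using x A by (intro polyfun_intros)
  qed (use sum split x Z p in auto)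
  then show ?thesis using x(2)[OF p] by simp
qed

text \<open>Choose \<open>x\<close>, \<open>y\<close>, \<open>z\<close> vanishing on \<open>Z\<^sub>0\<close>, \<open>Z\<^sub>1\<close>, \<open>Z\<^sub>2\<close> and not on the next set of the chain. Restricting a
  polynomial relation between them from \<open>Z\<^sub>3\<close> to \<open>Z\<^sub>2\<close>, \<open>Z\<^sub>1\<close>, \<open>Z\<^sub>0\<close> removes one variable at a time and leaves
  its lexicographically smallest coefficient, which is nonzero by choice.\<close>

lemma no_chain_of_length_3:
  fixes V :: "('a::idom ^ 'n::finite) set"
  assumes dep: "\<And>x y z. polyfun UNIV x \<Longrightarrow> polyfun UNIV y \<Longrightarrow> polyfun UNIV z \<Longrightarrow>
     \<exists>N r. (\<exists>i\<le>N. \<exists>j\<le>N. \<exists>k\<le>N. r i j k \<noteq> 0) \<and> (\<forall>p\<in>V.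
     (\<Sum>k\<le>N. z (vec_nth p) ^ k * (\<Sum>j\<le>N. y (vec_nth p) ^ j * (\<Sum>i\<le>N. x (vec_nth p) ^ i * r i j k))) = 0)"
    and Z: "\<And>i. i \<le> 3 \<Longrightarrow> zariski_closed (Z i) \<and> zariski_irreducible (Z i) \<and> Z i \<subseteq> V"
    and chain: "Z 0 \<subset> Z 1" "Z 1 \<subset> Z 2" "Z 2 \<subset> Z (3::nat)"
  shows False
proof -
  have sep: "\<exists>x p. polyfun UNIV x \<and> (\<forall>p\<in>Z i. x (vec_nth p) = 0) \<and> p \<in> Z (Suc i) \<and> x (vec_nth p) \<noteq> 0"
    if i: "i \<le> 3" "Z i \<subset> Z (Suc i)" for i
  proof -
    have "zariski_closed (Z i)" "\<not> Z (Suc i) \<subseteq> Z i" using Z[OF i(1)] i(2) by auto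
    then show ?thesis by (rule separating_polyfun) blast
  qed
  obtain x p1 where x: "polyfun UNIV x" "\<forall>p\<in>Z 0. x (vec_nth p) = 0" "p1 \<in> Z 1" "x (vec_nth p1) \<noteq> 0"
    using sep[of 0] chain(1) by auto
  obtain y p2 where y: "polyfun UNIV y" "\<forall>p\<in>Z 1. y (vec_nth p) = 0" "p2 \<in> Z 2" "y (vec_nth p2) \<noteq> 0"
    using sep[of 1] chain(2) by (auto simp: numeral_2_eq_2)
  obtain z p3 where z: "polyfun UNIV z" "\<forall>p\<in>Z 2. z (vec_nth p) = 0" "p3 \<in> Z 3" "z (vec_nth p3) \<noteq> 0"
    using sep[of 2] chain(3) by (auto simp: numeral_3_eq_3 numeral_2_eq_2)
  from dep[OF x(1) y(1) z(1)] obtain N r where Nr: "(\<exists>i\<le>N. \<exists>j\<le>N. \<exists>k\<le>N. r i j k \<noteq> 0) \<and> (\<forall>p\<in>V.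
     (\<Sum>k\<le>N. z (vec_nth p) ^ k * (\<Sum>j\<le>N. y (vec_nth p) ^ j * (\<Sum>i\<le>N. x (vec_nth p) ^ i * r i j k))) = 0)"
    by (elim exE)
  have r: "\<exists>k\<le>N. \<exists>j\<le>N. \<exists>i\<le>N. r i j k \<noteq> 0" using conjunct1[OF Nr] by blast
  note sum = conjunct2[OF Nr]
  have least: "\<exists>k. Q k \<and> (\<forall>l<k. \<not> Q l)" if "\<exists>k. Q k" for Q :: "nat \<Rightarrow> bool"
    using that exists_least_iff[of Q] by blast
  obtain k where k: "k \<le> N" "\<exists>j\<le>N. \<exists>i\<le>N. r i j k \<noteq> 0"
    and "\<forall>l<k. \<not> (l \<le> N \<and> (\<exists>j\<le>N. \<exists>i\<le>N. r i j l \<noteq> 0))"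
    using least[OF r] by blast
  then have k_low: "r i j l = 0" if "l < k" "i \<le> N" "j \<le> N" for i j l
    using that by (meson less_le_trans less_imp_le)
  obtain j where j: "j \<le> N" "\<exists>i\<le>N. r i j k \<noteq> 0" and "\<forall>l<j. \<not> (l \<le> N \<and> (\<exists>i\<le>N. r i l k \<noteq> 0))"
    using least[OF k(2)] by blast
  then have j_low: "r i l k = 0" if "l < j" "i \<le> N" for i l
    using that by (meson less_le_trans less_imp_le)
  obtain i where i: "i \<le> N" "r i j k \<noteq> 0" and "\<forall>l<i. \<not> (l \<le> N \<and> r l j k \<noteq> 0)"
    using least[OF j(2)] by blast
  then have i_low: "r l j k = 0" if "l < i" for l
    using that by (meson less_le_trans less_imp_le)
  obtain p0 where p0: "p0 \<in> Z 0" using Z[of 0] unfolding zariski_irreducible_def by blast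
  have 2: "(\<Sum>j\<le>N. y (vec_nth p) ^ j * (\<Sum>i\<le>N. x (vec_nth p) ^ i * r i j k)) = 0" if p: "p \<in> Z 2" for p
  proof (rule leading_term_vanishes[of "Z 3" "Z 2" z p3 "\<lambda>k c. \<Sum>j\<le>N. y c ^ j * (\<Sum>i\<le>N. x c ^ i * r i j k)" N k])
    show "polyfun UNIV (\<lambda>c. \<Sum>j\<le>N. y c ^ j * (\<Sum>i\<le>N. x c ^ i * r i j k))" for k
      using x(1) y(1) by (intro polyfun_intros)
    show "(\<Sum>k\<le>N. z (vec_nth p) ^ k * (\<Sum>j\<le>N. y (vec_nth p) ^ j * (\<Sum>i\<le>N. x (vec_nth p) ^ i * r i j k))) = 0"
      if "p \<in> Z 3" for p using sum Z[of 3] that by blast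
  qed (use Z[of 3] chain z p k k_low in auto)
  have 1: "(\<Sum>i\<le>N. x (vec_nth p) ^ i * r i j k) = 0" if p: "p \<in> Z 1" for p
  proof (rule leading_term_vanishes[of "Z 2" "Z 1" y p2 "\<lambda>j c. \<Sum>i\<le>N. x c ^ i * r i j k" N j])
    show "polyfun UNIV (\<lambda>c. \<Sum>i\<le>N. x c ^ i * r i j k)" for j
      using x(1) by (intro polyfun_intros)
  qed (use Z[of 2] chain y p j j_low 2 in auto)
  have "r i j k = 0"
  proof (rule leading_term_vanishes[of "Z 1" "Z 0" x p1 "\<lambda>i c. r i j k" N i p0])
    show "polyfun UNIV (\<lambda>c. r i j k)" for i by (rule polyfun.const)
  qed (use Z[of 1] chain x p0 i i_low 1 in auto)
  then show False using i by simp
qed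

context smooth_parametrized_curve
begin

lemma polyfun_on_velocity_bipoly:
  assumes "polyfun UNIV \<phi>"
  shows "\<exists>d X a. bipoly d X \<and> (\<forall>t s. poly H t \<noteq> 0 \<longrightarrow>
     \<phi> (vec_nth (join_vec (P t) (s *s velocity t))) * poly H t ^ a = X t s)"
  using assms
proof (induction rule: polyfun.induct)
  case (const b)
  show ?case using bipoly_const[of b] by (intro exI[of _ 0] exI[of _ "\<lambda>t s. b"]) auto
next
  case (var v)
  show ?case
  proof (cases v)
    case (Inl i)
    then show ?thesis using bipoly_fst[of "G i"]
      by (intro exI[of _ "degree (G i)"] exI[of _ "\<lambda>t s. poly (G i) t"] exI[of _ 1]) (auto simp: frac_point_def)
  next
    case (Inr i)
    then show ?thesis using bipoly_mult[OF bipoly_snd bipoly_fst[of "W i"]]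
      by (intro exI[of _ "1 + degree (W i)"] exI[of _ "\<lambda>t s. s * poly (W i) t"] exI[of _ 0])
        (auto simp: velocity_def)
  qed
next
  case (add f g)
  then obtain d X a e Y b where X: "bipoly d X" "\<And>t s. poly H t \<noteq> 0 \<Longrightarrow>
      f (vec_nth (join_vec (P t) (s *s velocity t))) * poly H t ^ a = X t s"
    and Y: "bipoly e Y" "\<And>t s. poly H t \<noteq> 0 \<Longrightarrow>
      g (vec_nth (join_vec (P t) (s *s velocity t))) * poly H t ^ b = Y t s" by blast
  let ?d = "(d + b * degree H) + (e + a * degree H)"
  let ?X = "\<lambda>t s. X t s * poly H t ^ b + Y t s * poly H t ^ a"
  have "bipoly ?d ?X"
    by (intro bipoly_add; rule bipoly_mono[OF bipoly_mult[OF _ bipoly_power[OF bipoly_fst]]]) (use X Y in auto)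
  moreover have "(f (vec_nth (join_vec (P t) (s *s velocity t))) + g (vec_nth (join_vec (P t) (s *s velocity t)))) *
      poly H t ^ (a + b) = ?X t s" if "poly H t \<noteq> 0" for t s
    unfolding X(2)[OF that, symmetric] Y(2)[OF that, symmetric] by (simp add: power_add algebra_simps)
  ultimately show ?case by blast
next
  case (mult f g)
  then obtain d X a e Y b where X: "bipoly d X" "\<And>t s. poly H t \<noteq> 0 \<Longrightarrow>
      f (vec_nth (join_vec (P t) (s *s velocity t))) * poly H t ^ a = X t s"
    and Y: "bipoly e Y" "\<And>t s. poly H t \<noteq> 0 \<Longrightarrow>
      g (vec_nth (join_vec (P t) (s *s velocity t))) * poly H t ^ b = Y t s" by blast
  have "f (vec_nth (join_vec (P t) (s *s velocity t))) * g (vec_nth (join_vec (P t) (s *s velocity t))) *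
      poly H t ^ (a + b) = X t s * Y t s" if "poly H t \<noteq> 0" for t s
    unfolding X(2)[OF that, symmetric] Y(2)[OF that, symmetric] by (simp add: power_add algebra_simps)
  then show ?case using bipoly_mult[OF X(1) Y(1)] by blast
qed

lemma tangent_bundle_dependence:
  assumes x: "polyfun UNIV x" and y: "polyfun UNIV y" and z: "polyfun UNIV z"
  shows "\<exists>N r. (\<exists>i\<le>N. \<exists>j\<le>N. \<exists>k\<le>N. r i j k \<noteq> 0) \<and> (\<forall>p\<in>tangent_bundle C.
     (\<Sum>k\<le>N. z (vec_nth p) ^ k * (\<Sum>j\<le>N. y (vec_nth p) ^ j * (\<Sum>i\<le>N. x (vec_nth p) ^ i * r i j k))) = 0)"
proof -
  let ?p = "\<lambda>t s. vec_nth (join_vec (P t) (s *s velocity t))"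
  obtain d X a where X: "bipoly d X" "\<And>t s. poly H t \<noteq> 0 \<Longrightarrow> x (?p t s) * poly H t ^ a = X t s"
    using polyfun_on_velocity_bipoly[OF x] by blast
  obtain e Y b where Y: "bipoly e Y" "\<And>t s. poly H t \<noteq> 0 \<Longrightarrow> y (?p t s) * poly H t ^ b = Y t s"
    using polyfun_on_velocity_bipoly[OF y] by blast
  obtain f Z c where Z: "bipoly f Z" "\<And>t s. poly H t \<noteq> 0 \<Longrightarrow> z (?p t s) * poly H t ^ c = Z t s"
    using polyfun_on_velocity_bipoly[OF z] by blast
  obtain N r where r: "\<exists>i\<le>N. \<exists>j\<le>N. \<exists>k\<le>N. r i j k \<noteq> 0" and sum: "\<And>t s. poly H t \<noteq> 0 \<Longrightarrow>
     (\<Sum>k\<le>N. z (?p t s) ^ k * (\<Sum>j\<le>N. y (?p t s) ^ j * (\<Sum>i\<le>N. x (?p t s) ^ i * r i j k))) = 0"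
    using algebraic_dependence[of d X H "\<lambda>t s. x (?p t s)" a e Y "\<lambda>t s. y (?p t s)" b f Z "\<lambda>t s. z (?p t s)" c] X Y Z
    by blast
  have "(\<Sum>k\<le>N. z (vec_nth p) ^ k * (\<Sum>j\<le>N. y (vec_nth p) ^ j * (\<Sum>i\<le>N. x (vec_nth p) ^ i * r i j k))) = 0"
    if p: "p \<in> tangent_bundle C" for p
    by (rule tangent_bundle_dense[where \<phi> = "\<lambda>q. \<Sum>k\<le>N. z q ^ k * (\<Sum>j\<le>N. y q ^ j * (\<Sum>i\<le>N. x q ^ i * r i j k))", OF _ _ p])
      (use x y z sum defined in \<open>auto intro!: polyfun_intros\<close>)
  then show ?thesis using r by blast
qed

text \<open>A point, the tangent line over it, and the whole bundle form a chain of length 2; a longer chain is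
  excluded by algebraic dependence.\<close>

lemma tangent_bundle_dim: "zariski_dim (tangent_bundle C) = enat 2"
proof -
  obtain u where u: "u \<in> U" by (rule U_nonempty)
  obtain u' where u': "u' \<in> U" "u' \<noteq> u"
    using ex_new_if_finite[OF infinite_UNIV_char_0, of "insert u (- U)"] cofinite by auto
  have P: "P u' \<noteq> P u" using inj u u' by (metis inj_onD)
  define L where "L = (\<lambda>s. join_vec (P u) (s *s velocity u)) ` UNIV"
  define Z where "Z k = (if k = 0 then {join_vec (P u) 0} else if k = 1 then L else tangent_bundle C)" for k :: nat
  have L_eq: "L = tangent_bundle C \<inter> {z. \<forall>\<phi>\<in>range (\<lambda>i c. c (Inl i) - P u $ i). \<phi> (vec_nth z) = 0}"
  proof (intro set_eqI iffI)
    fix z assume "z \<in> L"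
    then show "z \<in> tangent_bundle C \<inter> {z. \<forall>\<phi>\<in>range (\<lambda>i c. c (Inl i) - P u $ i). \<phi> (vec_nth z) = 0}"
      using velocity_tangent[OF u] by (auto simp: L_def)
  next
    fix z assume z: "z \<in> tangent_bundle C \<inter> {z. \<forall>\<phi>\<in>range (\<lambda>i c. c (Inl i) - P u $ i). \<phi> (vec_nth z) = 0}"
    then obtain x y where xy: "z = join_vec x y" "x \<in> C" "y \<in> tangent_space C x" by (blast elim: tangent_bundle_cases)
    have "x = P u" using z xy(1) by (auto simp: vec_eq_iff)
    then show "z \<in> L" using xy tangent_space_P[OF u] by (auto simp: L_def)
  qed
  have "zariski_closed L" unfolding L_eq
    by (intro zariski_closed_Int tangent_bundle_closed closed zariski_closed_zeros) (auto intro!: polyfun_intros)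
  moreover have "zariski_irreducible L"
  proof (rule zariski_irreducibleI)
    show "L \<noteq> {}" by (simp add: L_def)
    fix \<phi> \<psi> x y assume \<phi>: "polyfun UNIV \<phi>" "x \<in> L" "\<phi> (vec_nth x) \<noteq> 0" and \<psi>: "polyfun UNIV \<psi>" "y \<in> L" "\<psi> (vec_nth y) \<noteq> 0"
    define n where "n v = (case v of Inl i \<Rightarrow> [:P u $ i:] | Inr i \<Rightarrow> [:0, velocity u $ i:])" for v
    have n: "vec_nth (join_vec (P u) (s *s velocity u)) = (\<lambda>v. poly (n v) s)" for s
      by (auto simp: fun_eq_iff vec_nth_join_vec n_def split: sum.splits)
    obtain p where p: "\<And>s. poly p s = \<phi> (\<lambda>v. poly (n v) s)" using polyfun_subst_poly[OF \<phi>(1), of n] by blast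
    obtain q where q: "\<And>s. poly q s = \<psi> (\<lambda>v. poly (n v) s)" using polyfun_subst_poly[OF \<psi>(1), of n] by blast
    have "p \<noteq> 0" using \<phi>(2,3) p n by (auto simp: L_def)
    moreover have "q \<noteq> 0" using \<psi>(2,3) q n by (auto simp: L_def)
    ultimately obtain s where "poly (p * q) s \<noteq> 0" using poly_eq_0_of_cofinite[of "{}" "p * q"] by auto
    then show "\<exists>z\<in>L. \<phi> (vec_nth z) \<noteq> 0 \<and> \<psi> (vec_nth z) \<noteq> 0"
      by (intro bexI[of _ "join_vec (P u) (s *s velocity u)"]) (auto simp: L_def n p q)
  qed
  moreover have "L \<subseteq> tangent_bundle C" unfolding L_eq by blast
  moreover have "join_vec (P u) 0 \<in> L" unfolding L_def by (rule image_eqI[of _ _ 0]) simp_all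
  ultimately have Z: "zariski_closed (Z k) \<and> zariski_irreducible (Z k) \<and> Z k \<subseteq> tangent_bundle C" for k
    unfolding Z_def using zariski_closed_singleton zariski_irreducible_singleton tangent_bundle_irreducible
      tangent_bundle_closed[OF closed] by auto
  have "join_vec (P u) (1 *s velocity u) \<noteq> join_vec (P u) 0"
    using velocity_nonzero[OF u] by (metis join_vec_nth(2) vec_eq_iff vector_smult_lid)
  moreover have "join_vec (P u) (1 *s velocity u) \<in> L" unfolding L_def by blast
  ultimately have "Z 0 \<subset> Z 1" using \<open>join_vec (P u) 0 \<in> L\<close> unfolding Z_def by auto
  moreover have "join_vec (P u') (0 *s velocity u') \<notin> L"
    using P unfolding L_def by (auto simp: vec_eq_iff) (metis join_vec_nth(1))
  then have "Z 1 \<subset> Z 2" using velocity_tangent[OF u'(1), of 0] \<open>L \<subseteq> _\<close> unfolding Z_def by auto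
  ultimately have chain: "Z k \<subset> Z (Suc k)" if "k < 2" for k using that by (cases k) (auto simp: numeral_2_eq_2)
  have upper: "d \<le> 2" if Y: "\<forall>i\<le>d. zariski_closed (Y i) \<and> zariski_irreducible (Y i) \<and> Y i \<subseteq> tangent_bundle C"
    "\<forall>i<d. Y i \<subset> Y (Suc i)" for d and Y :: "nat \<Rightarrow> ('a ^ ('n + 'n)) set"
  proof (rule ccontr)
    assume "\<not> ?thesis"
    then have d: "3 \<le> d" by simp
    show False
    proof (rule no_chain_of_length_3[OF tangent_bundle_dependence])
      show "zariski_closed (Y i) \<and> zariski_irreducible (Y i) \<and> Y i \<subseteq> tangent_bundle C" if "i \<le> 3" for i
        using Y(1) that d by simp
      show "Y 0 \<subset> Y 1" "Y 1 \<subset> Y 2" "Y 2 \<subset> Y 3"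
        using Y(2)[rule_format, of 0] Y(2)[rule_format, of 1] Y(2)[rule_format, of 2] d
        by (simp_all add: numeral_2_eq_2 numeral_3_eq_3)
    qed
  qed
  show ?thesis unfolding zariski_dim_def
  proof (rule Sup_eqI)
    fix e assume "e \<in> {enat d |d. \<exists>Z. (\<forall>i\<le>d. zariski_closed (Z i) \<and> zariski_irreducible (Z i) \<and> Z i \<subseteq> tangent_bundle C) \<and> (\<forall>i<d. Z i \<subset> Z (Suc i))}"
    then show "e \<le> enat 2" using upper by auto
  next
    fix e assume e: "\<And>f. f \<in> {enat d |d. \<exists>Z. (\<forall>i\<le>d. zariski_closed (Z i) \<and> zariski_irreducible (Z i) \<and> Z i \<subseteq> tangent_bundle C) \<and> (\<forall>i<d. Z i \<subset> Z (Suc i))} \<Longrightarrow> f \<le> e"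
    show "enat 2 \<le> e" by (rule e) (use Z chain in blast)
  qed
qed

end

section \<open>The degree of the tangent bundle\<close>

lemma sum_join_vec:
  fixes x y :: "'a::comm_semiring_1 ^ 'n::finite"
  shows "(\<Sum>j\<in>UNIV. c j * join_vec x y $ j) = (\<Sum>j\<in>UNIV. c (Inl j) * x $ j) + (\<Sum>j\<in>UNIV. c (Inr j) * y $ j)"
  by (simp add: UNIV_Plus_UNIV[symmetric] sum.Plus del: UNIV_Plus_UNIV)

text \<open>The bound \<open>2d - 1\<close> is the obvious one; the coefficient there is \<open>d a b - a d b = 0\<close>, where \<open>a\<close> and \<open>b\<close>
  are the coefficients of \<open>G\<^sub>i\<close> and \<open>H\<close> at \<open>d\<close>.\<close>

lemma degree_wronskian:
  fixes G :: "'n \<Rightarrow> 'a::{idom,ring_char_0} poly"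
  assumes "degree (G i) \<le> d" "degree H \<le> d" "d > 0"
  shows "degree (wronskian G H i) \<le> 2 * d - 2"
proof (rule degree_le, intro allI impI)
  fix k assume k: "2 * d - 2 < k"
  have top: "coeff (p * q) (m + n) = coeff p m * coeff q n" if "degree p \<le> m" "degree q \<le> n" for p q :: "'a poly" and m n
  proof -
    have "coeff p j * coeff q (m + n - j) = (if j = m then coeff p m * coeff q n else 0)" if "j \<le> m + n" for j
    proof (cases j m rule: linorder_cases)
      case less
      then have "coeff q (m + n - j) = 0" using \<open>degree q \<le> n\<close> by (intro coeff_eq_0) auto
      then show ?thesis using less by simp
    next
      case greater
      then have "coeff p j = 0" using \<open>degree p \<le> m\<close> by (intro coeff_eq_0) auto
      then show ?thesis using greater by simp
    qed auto
    then have "coeff (p * q) (m + n) = (\<Sum>j\<le>m + n. if j = m then coeff p m * coeff q n else 0)"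
      unfolding coeff_mult by (intro sum.cong) auto
    then show ?thesis by simp
  qed
  have d: "degree (pderiv (G i)) \<le> d - 1" "degree (pderiv H) \<le> d - 1"
    using assms by (auto simp: degree_pderiv)
  show "coeff (wronskian G H i) k = 0"
  proof (cases "k = 2 * d - 1")
    case True
    then have k: "k = (d - 1) + d" "k = d + (d - 1)" using assms(3) by auto
    have "coeff (pderiv (G i) * H) k = coeff (pderiv (G i)) (d - 1) * coeff H d"
      unfolding k(1) by (rule top[OF d(1) assms(2)])
    moreover have "coeff (G i * pderiv H) k = coeff (G i) d * coeff (pderiv H) (d - 1)"
      unfolding k(2) by (rule top[OF assms(1) d(2)])
    ultimately show ?thesis using assms(3) by (simp add: wronskian_def coeff_pderiv)
  next
    case False
    then have "degree (pderiv (G i) * H) < k" "degree (G i * pderiv H) < k"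
      using d assms k degree_mult_le[of "pderiv (G i)" H] degree_mult_le[of "G i" "pderiv H"] by linarith+
    then show ?thesis by (simp add: wronskian_def coeff_eq_0)
  qed
qed

context smooth_parametrized_curve
begin

definition lin_poly :: "nat \<Rightarrow> (nat \<times> ('n + 'n) option \<Rightarrow> 'a) \<Rightarrow> 'a poly" where
  "lin_poly k c = (\<Sum>j\<in>UNIV. smult (c (k, Some (Inl j))) (G j)) - smult (c (k, None)) H"

definition vel_poly :: "nat \<Rightarrow> (nat \<times> ('n + 'n) option \<Rightarrow> 'a) \<Rightarrow> 'a poly" where
  "vel_poly k c = (\<Sum>j\<in>UNIV. smult (c (k, Some (Inr j))) (W j))"

text \<open>On \<open>(P(t), s W(t))\<close> the \<open>k\<close>-th linear equation reads \<open>lin_poly k + s H vel_poly k = 0\<close>, up to the factor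
  \<open>1/H\<close>. The eliminant is the determinant of these two equations for \<open>s\<close>, without the factor \<open>H\<close>.\<close>

definition eliminant :: "(nat \<times> ('n + 'n) option \<Rightarrow> 'a) \<Rightarrow> 'a poly" where
  "eliminant c = lin_poly 0 c * vel_poly 1 c - lin_poly 1 c * vel_poly 0 c"

abbreviation params :: "(nat \<times> ('n + 'n) option) set" where "params \<equiv> {..<2} \<times> UNIV"

lemma poly_family_lin_poly: "k < 2 \<Longrightarrow> poly_family params (lin_poly k)"
  unfolding lin_poly_def[abs_def] by (intro poly_family_intros) (auto intro!: polyfun_intros)

lemma poly_family_vel_poly: "k < 2 \<Longrightarrow> poly_family params (vel_poly k)"
  unfolding vel_poly_def[abs_def] by (intro poly_family_intros) (auto intro!: polyfun_intros)

lemma poly_family_eliminant: "poly_family params eliminant"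
  unfolding eliminant_def[abs_def]
  by (intro poly_family_mult poly_family_diff poly_family_lin_poly poly_family_vel_poly) auto

lemma linear_section_iff:
  assumes "t \<in> U"
  shows "join_vec (P t) (s *s velocity t) \<in> linear_variety 2 c \<longleftrightarrow>
     (\<forall>k<2. poly (lin_poly k c) t + s * poly H t * poly (vel_poly k c) t = 0)"
proof -
  have H: "poly H t \<noteq> 0" using defined[OF assms] .
  have eq: "(\<Sum>j\<in>UNIV. c (k, Some j) * join_vec (P t) (s *s velocity t) $ j) - c (k, None) =
      (poly (lin_poly k c) t + s * poly H t * poly (vel_poly k c) t) / poly H t" for k
  proof -
    have "(\<Sum>j\<in>UNIV. c (k, Some (Inl j)) * P t $ j) = (\<Sum>j\<in>UNIV. c (k, Some (Inl j)) * poly (G j) t) / poly H t"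
      by (simp add: frac_point_def sum_divide_distrib)
    moreover have "(\<Sum>j\<in>UNIV. c (k, Some (Inr j)) * (s *s velocity t) $ j) = s * poly (vel_poly k c) t"
      by (simp add: velocity_def vel_poly_def poly_sum sum_distrib_left mult.left_commute)
    ultimately show ?thesis using H
      by (simp add: sum_join_vec lin_poly_def poly_sum add_divide_distrib diff_divide_distrib)
  qed
  show ?thesis unfolding linear_variety_def mem_Collect_eq
    by (subst eq_iff_diff_eq_0, unfold eq) (use H in simp)
qed

text \<open>Two affine equations for the one unknown \<open>s\<close> have a solution iff their determinant vanishes, and at
  most one solution, provided that they do not both have slope 0.\<close>

lemma eliminant_root_iff:
  assumes t: "t \<in> U" and v: "poly (vel_poly 0 c) t \<noteq> 0 \<or> poly (vel_poly 1 c) t \<noteq> 0"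
  shows "t \<in> roots (eliminant c) \<longleftrightarrow> (\<exists>s. join_vec (P t) (s *s velocity t) \<in> linear_variety 2 c)"
    and "join_vec (P t) (s *s velocity t) \<in> linear_variety 2 c \<Longrightarrow>
      join_vec (P t) (s' *s velocity t) \<in> linear_variety 2 c \<Longrightarrow> s = s'"
proof -
  define a0 a1 b0 b1 h where d: "a0 = poly (lin_poly 0 c) t" "a1 = poly (lin_poly 1 c) t"
    "b0 = poly (vel_poly 0 c) t" "b1 = poly (vel_poly 1 c) t" "h = poly H t"
  have h: "h \<noteq> 0" using defined[OF t] by (simp add: d)
  have b: "b0 \<noteq> 0 \<or> b1 \<noteq> 0" using v by (simp add: d)
  have iff: "join_vec (P t) (s *s velocity t) \<in> linear_variety 2 c \<longleftrightarrow> a0 + s * h * b0 = 0 \<and> a1 + s * h * b1 = 0" for s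
    unfolding linear_section_iff[OF t] by (auto simp: d less_2_cases_iff)
  have root: "t \<in> roots (eliminant c) \<longleftrightarrow> a0 * b1 - a1 * b0 = 0"
    by (simp add: roots_def eliminant_def d)
  show "t \<in> roots (eliminant c) \<longleftrightarrow> (\<exists>s. join_vec (P t) (s *s velocity t) \<in> linear_variety 2 c)"
    unfolding iff root
  proof
    assume eq: "a0 * b1 - a1 * b0 = 0"
    show "\<exists>s. a0 + s * h * b0 = 0 \<and> a1 + s * h * b1 = 0"
    proof (cases "b0 = 0")
      case False
      then show ?thesis using eq h by (intro exI[of _ "- a0 / (h * b0)"]) (simp add: field_simps)
    next
      case True
      then show ?thesis using eq h b by (intro exI[of _ "- a1 / (h * b1)"]) (simp add: field_simps)
    qed
  next
    assume "\<exists>s. a0 + s * h * b0 = 0 \<and> a1 + s * h * b1 = 0"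
    then obtain s where "a0 = - (s * h * b0)" "a1 = - (s * h * b1)" by (auto simp: add_eq_0_iff2)
    then show "a0 * b1 - a1 * b0 = 0" by (simp add: algebra_simps)
  qed
  assume "join_vec (P t) (s *s velocity t) \<in> linear_variety 2 c"
    "join_vec (P t) (s' *s velocity t) \<in> linear_variety 2 c"
  then have "a0 + s * h * b0 = a0 + s' * h * b0" "a1 + s * h * b1 = a1 + s' * h * b1"
    unfolding iff by simp_all
  then show "s = s'" using h b by auto
qed

lemma ex_vel_poly_nonzero:
  assumes "t \<in> U" shows "\<exists>c. poly (vel_poly k c) t \<noteq> 0"
proof -
  obtain i where i: "poly (W i) t \<noteq> 0" using immersed[OF assms] by blast
  have "vel_poly k (\<lambda>v. if v = (k, Some (Inr i)) then 1 else 0) = (\<Sum>j\<in>UNIV. if j = i then W j else 0)"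
    unfolding vel_poly_def by (intro sum.cong) auto
  then show ?thesis using i by (intro exI[of _ "\<lambda>v. if v = (k, Some (Inr i)) then 1 else 0"]) simp
qed

text \<open>For generic \<open>c\<close> the polynomial \<open>vel_poly 0\<close> has finitely many roots, and at each of those in \<open>U\<close> the vector \<open>W\<close> is
  nonzero. Changing only the coefficients that enter \<open>vel_poly 1\<close> one can make it nonzero at all of
  them, while staying in a prescribed open set.\<close>

lemma generically_vel_polys_no_common_root:
  "generically params (\<lambda>c. roots (vel_poly 0 c) \<inter> roots (vel_poly 1 c) \<subseteq> - U)"
proof (rule generic_no_common_root)
  show "poly_family params (vel_poly 0)" "poly_family params (vel_poly 1)" "finite (- U)"
    using poly_family_vel_poly cofinite by auto
  fix \<phi> :: "(nat \<times> ('n + 'n) option \<Rightarrow> 'a) \<Rightarrow> 'a" assume \<phi>: "polyfun params \<phi>" "\<exists>c. \<phi> c \<noteq> 0"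
  obtain u where u: "u \<in> U" by (rule U_nonempty)
  obtain c1 where "poly (vel_poly 0 c1) u \<noteq> 0" using ex_vel_poly_nonzero[OF u] by blast
  then have "generically params (\<lambda>c. poly (vel_poly 0 c) u \<noteq> 0)"
    by (intro generically_nonzero[OF polyfun_poly_family[OF poly_family_vel_poly]]) auto
  moreover have "generically params (\<lambda>c. \<phi> c \<noteq> 0)" using \<phi> generically_nonzero by blast
  ultimately obtain c where c: "\<phi> c \<noteq> 0" "poly (vel_poly 0 c) u \<noteq> 0"
    using generically_ex[OF generically_conj] by blast
  define V where "V = range (\<lambda>j. (1::nat, Some (Inr j) :: ('n + 'n) option))"
  \<comment> \<open>The parameters in \<open>V\<close> are varied, the others are kept.\<close>
  define upd where "upd b v = (if v \<in> V then b v else c v)" for b v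
  have upd: "polyfun V (\<lambda>b. upd b v)" for v
    by (cases "v \<in> V") (auto simp: upd_def intro: polyfun.intros)
  have "upd c = c" by (auto simp: upd_def)
  have 1: "generically V (\<lambda>b. \<phi> (upd b) \<noteq> 0)"
    by (rule generically_nonzero[where c = c])
      (use polyfun_substitute[OF \<phi>(1) upd] c(1) \<open>upd c = c\<close> in auto)
  define T where "T = insert u (roots (vel_poly 0 c) \<inter> U)"
  have "vel_poly 0 c \<noteq> 0" using c(2) by auto
  then have T: "finite T" by (simp add: T_def finite_roots)
  have 2: "generically V (\<lambda>b. \<forall>t\<in>T. poly (vel_poly 1 (upd b)) t \<noteq> 0)"
  proof (rule generically_ball[OF T])
    fix t assume "t \<in> T"
    then have t: "t \<in> U" using u by (auto simp: T_def)
    obtain b where b: "poly (vel_poly 1 b) t \<noteq> 0" using ex_vel_poly_nonzero[OF t] by blast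
    have "vel_poly 1 (upd b) = vel_poly 1 b" by (simp add: vel_poly_def upd_def V_def)
    moreover have "polyfun V (\<lambda>b. poly (vel_poly 1 (upd b)) t)"
      by (intro polyfun_poly_family poly_family_subst[OF poly_family_vel_poly] upd) auto
    ultimately show "generically V (\<lambda>b. poly (vel_poly 1 (upd b)) t \<noteq> 0)"
      using b by (intro generically_nonzero[where c = b]) auto
  qed
  obtain b where b: "\<phi> (upd b) \<noteq> 0" "\<forall>t\<in>T. poly (vel_poly 1 (upd b)) t \<noteq> 0"
    using generically_ex[OF generically_conj[OF 1 2]] by blast
  have "(0, w) \<notin> V" for w by (auto simp: V_def)
  then have "vel_poly 0 (upd b) = vel_poly 0 c" by (simp add: vel_poly_def upd_def)
  moreover have "vel_poly 1 (upd b) \<noteq> 0" using b(2) by (auto simp: T_def)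
  ultimately show "\<exists>c. \<phi> c \<noteq> 0 \<and> vel_poly 0 c \<noteq> 0 \<and> vel_poly 1 c \<noteq> 0 \<and>
      roots (vel_poly 0 c) \<inter> roots (vel_poly 1 c) \<subseteq> - U"
    using b \<open>vel_poly 0 c \<noteq> 0\<close> by (intro exI[of _ "upd b"]) (auto simp: T_def roots_def)
qed

lemma ex_eliminant_nonzero: "\<exists>c. eliminant c \<noteq> 0"
proof -
  obtain u where u: "u \<in> U" by (rule U_nonempty)
  obtain c where c: "poly (vel_poly 1 c) u \<noteq> 0" using ex_vel_poly_nonzero[OF u] by blast
  \<comment> \<open>The first equation is \<open>0 = 1\<close>, so the eliminant reduces to \<open>- H vel_poly 1\<close>.\<close>
  define b where "b v = (if fst v = 1 \<and> v \<noteq> (1, None) then c v else if v = (0, None) then 1 else 0)" for v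
  have "vel_poly 1 b = vel_poly 1 c" "vel_poly 0 b = 0" "lin_poly 0 b = - H"
    by (simp_all add: vel_poly_def lin_poly_def b_def)
  then have "poly (eliminant b) u = - poly H u * poly (vel_poly 1 c) u" by (simp add: eliminant_def)
  then have "poly (eliminant b) u \<noteq> 0" using c defined[OF u] by simp
  then show ?thesis by (intro exI[of _ b]) auto
qed

lemma degree_eliminant: "degree (eliminant c) \<le> 3 * D - 2"
proof -
  have "degree (lin_poly k c) \<le> D" for k
    unfolding lin_poly_def using deg_G deg_H
    by (intro degree_diff_le degree_sum_le) (auto intro: order_trans[OF degree_smult_le])
  moreover have "degree (vel_poly k c) \<le> 2 * D - 2" for k
    unfolding vel_poly_def using degree_wronskian[of G _ D H, OF deg_G deg_H D_pos]
    by (intro degree_sum_le) (auto intro: order_trans[OF degree_smult_le])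
  ultimately have "degree (lin_poly k c * vel_poly l c) \<le> D + (2 * D - 2)" for k l
    by (meson add_mono degree_mult_le order_trans)
  then have "degree (eliminant c) \<le> D + (2 * D - 2)" unfolding eliminant_def by (intro degree_diff_le)
  then show ?thesis using D_pos by simp
qed

text \<open>The finitely many fibres that are not parametrized are lines, and a generic linear variety of
  codimension 2 misses a given line.\<close>

lemma generically_avoids_missing_fibres:
  "generically params (\<lambda>c. \<forall>p\<in>C - P ` U. \<forall>y\<in>tangent_space C p. join_vec p y \<notin> linear_variety 2 c)"
proof (rule generically_ball[OF finite_missing])
  fix p assume "p \<in> C - P ` U"
  then have p: "p \<in> C" by blast
  have "\<exists>v. v \<in> tangent_space C p \<and> v \<noteq> 0"
  proof (rule ccontr)
    assume "\<not> ?thesis"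
    then have "tangent_space C p \<subseteq> {0}" by blast
    then have "vec.dim (tangent_space C p) = 0" by (simp add: vec.dim_eq_0)
    then show False using tangent_dim[OF p] by simp
  qed
  then obtain v where v: "v \<in> tangent_space C p" "v \<noteq> 0" by blast
  then obtain i where i: "v $ i \<noteq> 0" by (auto simp: vec_eq_iff)
  define a where "a k c = (\<Sum>j\<in>UNIV. c (k, Some (Inl j)) * p $ j) - c (k, None)" for k and c :: "nat \<times> ('n + 'n) option \<Rightarrow> 'a"
  define b where "b k c = (\<Sum>j\<in>UNIV. c (k, Some (Inr j)) * v $ j)" for k and c :: "nat \<times> ('n + 'n) option \<Rightarrow> 'a"
  show "generically params (\<lambda>c. \<forall>y\<in>tangent_space C p. join_vec p y \<notin> linear_variety 2 c)"
  proof (rule genericallyI)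
    show "polyfun params (\<lambda>c. a 0 c * b 1 c - a 1 c * b 0 c)"
      unfolding a_def b_def by (intro polyfun_intros) auto
    \<comment> \<open>The equations \<open>0 = 1\<close> and \<open>y\<^sub>i = 0\<close>.\<close>
    define c where "c w = (if w = (0, None) \<or> w = (1, Some (Inr i)) then 1 else 0 :: 'a)" for w :: "nat \<times> ('n + 'n) option"
    have "b 1 c = (\<Sum>j\<in>UNIV. if j = i then v $ j else 0)" unfolding b_def c_def by (intro sum.cong) auto
    then have "b 1 c = v $ i" by simp
    moreover have "b 0 c = 0" "a 0 c = - 1" by (simp_all add: a_def b_def c_def)
    ultimately show "a 0 c * b 1 c - a 1 c * b 0 c \<noteq> 0" using i by simp
  next
    fix c assume c: "a 0 c * b 1 c - a 1 c * b 0 c \<noteq> 0"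
    show "\<forall>y\<in>tangent_space C p. join_vec p y \<notin> linear_variety 2 c"
    proof (intro ballI notI)
      fix y assume y: "y \<in> tangent_space C p" "join_vec p y \<in> linear_variety 2 c"
      then obtain s where s: "y = s *s v" using tangent_space_eq[OF p v] by blast
      have "a k c + s * b k c = 0" if "k < 2" for k
      proof -
        have "(\<Sum>j\<in>UNIV. c (k, Some (Inl j)) * p $ j) + (\<Sum>j\<in>UNIV. c (k, Some (Inr j)) * y $ j) = c (k, None)"
          using y(2) that sum_join_vec[of "\<lambda>j. c (k, Some j)" p y] by (simp add: linear_variety_def)
        moreover have "(\<Sum>j\<in>UNIV. c (k, Some (Inr j)) * y $ j) = s * b k c"
          by (simp add: s b_def sum_distrib_left mult.left_commute)
        ultimately show ?thesis by (simp add: a_def algebra_simps)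
      qed
      from this[of 0] this[of 1] have "a 0 c = - (s * b 0 c)" "a 1 c = - (s * b 1 c)"
        by (auto simp: add_eq_0_iff2)
      then show False using c by (simp add: algebra_simps)
    qed
  qed
qed

text \<open>For generic \<open>c\<close> the section consists of the points \<open>(P(t), s W(t))\<close> with \<open>t\<close> a root of the eliminant in
  \<open>U\<close> and \<open>s\<close> determined by \<open>t\<close>.\<close>

lemma tangent_bundle_degree: "geom_degree (tangent_bundle C) \<le> 3 * D - 2"
proof -
  obtain c0 where c0: "eliminant c0 \<noteq> 0" using ex_eliminant_nonzero by blast
  obtain k where k: "generically params (\<lambda>c. eliminant c \<noteq> 0 \<and> card (roots (eliminant c) - (- U)) = k)"
    by (rule generic_number_of_roots_off_finite[OF poly_family_eliminant c0 cofinite])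
  have "geom_degree (tangent_bundle C) = k"
  proof (rule geom_degree_eqI[OF tangent_bundle_irreducible tangent_bundle_dim])
    show "generically params (\<lambda>c :: nat \<times> ('n + 'n) option \<Rightarrow> 'a. full_rank 2 c)"
      by (rule generically_full_rank_2[of "Inl undefined" "Inr undefined"]) simp
    show "generically params (\<lambda>c. finite (tangent_bundle C \<inter> linear_variety 2 c) \<and>
        card (tangent_bundle C \<inter> linear_variety 2 c) = k)"
      using generically_conj[OF k generically_conj[OF generically_vel_polys_no_common_root
            generically_avoids_missing_fibres]]
    proof (rule generically_mono)
      fix c assume c: "(eliminant c \<noteq> 0 \<and> card (roots (eliminant c) - (- U)) = k) \<and>
        roots (vel_poly 0 c) \<inter> roots (vel_poly 1 c) \<subseteq> - U \<and>
        (\<forall>p\<in>C - P ` U. \<forall>y\<in>tangent_space C p. join_vec p y \<notin> linear_variety 2 c)"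
      let ?S = "tangent_bundle C \<inter> linear_variety 2 c"
      let ?z = "\<lambda>t s. join_vec (P t) (s *s velocity t)"
      have v: "poly (vel_poly 0 c) t \<noteq> 0 \<or> poly (vel_poly 1 c) t \<noteq> 0" if "t \<in> U" for t
        using c that by (auto simp: roots_def)
      define T where "T = roots (eliminant c) - (- U)"
      have "\<exists>\<sigma>. \<forall>t\<in>T. ?z t (\<sigma> t) \<in> linear_variety 2 c"
        using eliminant_root_iff(1)[OF _ v] by (intro bchoice) (auto simp: T_def)
      then obtain \<sigma> where \<sigma>: "\<And>t. t \<in> T \<Longrightarrow> ?z t (\<sigma> t) \<in> linear_variety 2 c" by blast
      have "?S = (\<lambda>t. ?z t (\<sigma> t)) ` T"
      proof (intro set_eqI iffI)
        fix z assume z: "z \<in> ?S"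
        then obtain x y where xy: "z = join_vec x y" "x \<in> C" "y \<in> tangent_space C x"
          by (blast elim: tangent_bundle_cases)
        then have "x \<in> P ` U" using c z by blast
        then obtain t where t: "t \<in> U" "x = P t" by blast
        then obtain s where s: "y = s *s velocity t" using xy(3) tangent_space_P by blast
        have zs: "?z t s \<in> linear_variety 2 c" using z xy(1) t s by simp
        then have T: "t \<in> T" using eliminant_root_iff(1)[OF t(1) v[OF t(1)]] t(1) by (auto simp: T_def)
        then have "s = \<sigma> t" using eliminant_root_iff(2)[OF t(1) v[OF t(1)] zs \<sigma>] by blast
        then show "z \<in> (\<lambda>t. ?z t (\<sigma> t)) ` T" using T xy(1) t s by blast
      next
        fix z assume "z \<in> (\<lambda>t. ?z t (\<sigma> t)) ` T"
        then show "z \<in> ?S" using \<sigma> velocity_tangent by (auto simp: T_def)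
      qed
      moreover have "inj_on (\<lambda>t. ?z t (\<sigma> t)) T"
      proof (rule inj_onI)
        fix s t assume st: "s \<in> T" "t \<in> T" "?z s (\<sigma> s) = ?z t (\<sigma> t)"
        then have "P s = P t" by (metis join_vec_nth(1) vec_eq_iff)
        then show "s = t" using inj st by (auto simp: T_def inj_on_def)
      qed
      moreover have "finite T" using c finite_roots[of "eliminant c"] by (simp add: T_def)
      ultimately show "finite ?S \<and> card ?S = k" using c by (simp add: card_image T_def)
    qed
  qed
  moreover obtain c where c: "eliminant c \<noteq> 0" "card (roots (eliminant c) - (- U)) = k"
    using generically_ex[OF k] by blast
  have "k \<le> card (roots (eliminant c))"
    unfolding c(2)[symmetric] using finite_roots[OF c(1)] by (intro card_mono) auto
  moreover have "card (roots (eliminant c)) \<le> 3 * D - 2"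
    using card_roots_le[OF c(1)] degree_eliminant[of c] by linarith
  ultimately show ?thesis by simp
qed

end

section \<open>The degree bound\<close>

lemma zariski_dim_mono: "V \<subseteq> W \<Longrightarrow> zariski_dim V \<le> zariski_dim W"
  unfolding zariski_dim_def by (intro Sup_subset_mono) blast

lemma local_dim_irreducible:
  assumes "zariski_closed V" "zariski_irreducible V" "p \<in> V"
  shows "local_dim V p = zariski_dim V"
  unfolding local_dim_def
  by (rule antisym) (use assms zariski_dim_mono in \<open>auto intro!: Sup_least Sup_upper\<close>)

text \<open>A common denominator of least degree has no zero in common with all numerators, since a common linear
  factor could be cancelled.\<close>

lemma ex_common_denominator:
  fixes g h :: "'n::finite \<Rightarrow> 'a::field poly"
  assumes "\<And>i. h i \<noteq> 0"
  obtains G H where "H \<noteq> 0" "\<And>i. G i * h i = g i * H"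
    "\<And>t. poly H t = 0 \<Longrightarrow> \<exists>i. poly (G i) t \<noteq> 0"
proof -
  define Q where "Q H \<longleftrightarrow> H \<noteq> 0 \<and> (\<exists>G. \<forall>i. G i * h i = g i * H)" for H
  have "Q (\<Prod>i\<in>UNIV. h i)"
  proof -
    have "(g i * (\<Prod>j\<in>UNIV - {i}. h j)) * h i = g i * (\<Prod>j\<in>UNIV. h j)" for i
      by (simp add: prod.remove[of UNIV i h] mult_ac)
    then show ?thesis unfolding Q_def using assms
      by (auto intro!: exI[of _ "\<lambda>i. g i * (\<Prod>j\<in>UNIV - {i}. h j)"])
  qed
  then obtain H where H: "Q H" and min: "\<And>H'. Q H' \<Longrightarrow> degree H \<le> degree H'"
    using ex_has_least_nat[of Q _ degree] by blast
  obtain G where G: "\<And>i. G i * h i = g i * H" using H unfolding Q_def by blast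
  show ?thesis
  proof (rule that[of H G])
    fix t assume t: "poly H t = 0"
    show "\<exists>i. poly (G i) t \<noteq> 0"
    proof (rule ccontr)
      assume "\<not> ?thesis"
      then have "[:-t, 1:] dvd G i" for i by (simp add: poly_eq_0_iff_dvd)
      then obtain G' where G': "\<And>i. G i = [:-t, 1:] * G' i" unfolding dvd_def by metis
      obtain H' where H': "H = [:-t, 1:] * H'" using t by (metis poly_eq_0_iff_dvd dvdE)
      have "H' \<noteq> 0" using H H' by (auto simp: Q_def)
      have "G' i * h i = g i * H'" for i
      proof -
        have "[:-t, 1:] * (G' i * h i) = [:-t, 1:] * (g i * H')"
          using G[of i] unfolding G'[of i] H' by (simp only: mult_ac)
        then show ?thesis by (metis mult_left_cancel pCons_eq_0_iff one_neq_zero)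
      qed
      then have "degree H \<le> degree H'" using min \<open>H' \<noteq> 0\<close> unfolding Q_def by blast
      moreover have "degree H = Suc (degree H')"
        unfolding H' using \<open>H' \<noteq> 0\<close> by (subst degree_mult_eq) auto
      ultimately show False by simp
    qed
  qed (use H G in \<open>auto simp: Q_def\<close>)
qed

text \<open>Both sides are the derivative of the same rational function \<open>p/q = g/h\<close>, multiplied by \<open>q\<^sup>2 h\<^sup>2\<close>.\<close>

lemma wronskian_common_denominator:
  fixes p q g h :: "'a::idom poly"
  assumes "p * h = g * q"
  shows "(pderiv p * q - p * pderiv q) * h^2 = (pderiv g * h - g * pderiv h) * q^2"
proof -
  have d: "pderiv p * h = pderiv g * q + g * pderiv q - p * pderiv h"
    using arg_cong[OF assms, of pderiv] by (simp add: pderiv_mult algebra_simps)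
  have "(pderiv p * q - p * pderiv q) * h^2 = (pderiv p * h) * (q * h) - (p * h) * (pderiv q * h)"
    by (simp add: power2_eq_square algebra_simps)
  also have "\<dots> = (pderiv g * q + g * pderiv q) * (q * h) - (p * h) * (q * pderiv h) - (p * h) * (pderiv q * h)"
    unfolding d by (simp add: algebra_simps)
  also have "\<dots> = (pderiv g * h - g * pderiv h) * q^2"
    unfolding assms by (simp add: power2_eq_square algebra_simps)
  finally show ?thesis .
qed

theorem theorem26:
  fixes C :: "('a::{alg_closed_field, field_char_0} ^ 'n::finite) set"
    and g h :: "'n \<Rightarrow> 'a poly"
    and U :: "'a set"
  assumes "zariski_closed C" and "zariski_dim C = 1" and "zariski_smooth C"
    and "rational_parametrization g h C"
    and "zariski_open_line U" and "U \<noteq> {}" and "U \<subseteq> param_domain h"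
    and P1: "inj_on (param_map g h) U"
    and P2: "\<And>t. t \<in> U \<Longrightarrow> param_deriv g h t \<noteq> 0"
  shows "int (geom_degree (tangent_bundle C)) \<le> 3 * int (geom_degree C) - 2"
proof -
  have h: "\<And>i. h i \<noteq> 0" and img: "param_map g h ` param_domain h \<subseteq> C"
    and hull: "C \<subseteq> zariski_closed hull (param_map g h ` param_domain h)"
    using assms(4) unfolding rational_parametrization_def by auto
  obtain G H where H: "H \<noteq> 0" and GH: "\<And>i. G i * h i = g i * H"
    and free: "\<And>t. poly H t = 0 \<Longrightarrow> \<exists>i. poly (G i) t \<noteq> 0"
    using ex_common_denominator[of h g] h by metis
  have defined: "poly H t \<noteq> 0" if "t \<in> param_domain h" for t
  proof
    assume 0: "poly H t = 0"
    have "poly (G i) t * poly (h i) t = 0" for i using arg_cong[OF GH[of i], of "\<lambda>p. poly p t"] 0 by simp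
    then show False using free[OF 0] that by (auto simp: param_domain_def)
  qed
  have map_eq: "param_map g h t = frac_point G H t" if t: "t \<in> param_domain h" for t
  proof -
    have "poly (g i) t / poly (h i) t = poly (G i) t / poly H t" for i
      using arg_cong[OF GH[of i], of "\<lambda>p. poly p t"] defined[OF t] t
      by (simp add: param_domain_def frac_eq_eq)
    then show ?thesis by (simp add: param_map_def frac_point_def)
  qed
  define D where "D = Max (insert (degree H) (range (\<lambda>i. degree (G i))))"
  have deg: "degree H \<le> D" "degree (G i) \<le> D" for i unfolding D_def by (intro Max_ge; simp)+
  have "D \<in> insert (degree H) (range (\<lambda>i. degree (G i)))" unfolding D_def by (rule Max_in) auto
  then have D: "D = degree H \<or> (\<exists>i. D = degree (G i))" by blast
  have top: "\<exists>i. coeff (G i) D \<noteq> 0" if "coeff H D = 0"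
  proof -
    have "D \<noteq> degree H" using that H by auto
    then obtain i where "D = degree (G i)" using D by blast
    moreover have "D \<noteq> 0" using \<open>D \<noteq> degree H\<close> deg(1) by auto
    ultimately have "coeff (G i) D \<noteq> 0" by auto
    then show ?thesis ..
  qed
  have cofinite: "finite (- U)"
  proof -
    obtain S where S: "U = - {t. \<forall>p\<in>S. poly p t = 0}" using assms(5) unfolding zariski_open_line_def by blast
    then obtain t p where p: "p \<in> S" "poly p t \<noteq> 0" using assms(6) by blast
    then have "p \<noteq> 0" by auto
    moreover have "- U \<subseteq> roots p" using S p(1) by (auto simp: roots_def)
    ultimately show ?thesis using finite_roots finite_subset by blast
  qed
  interpret C: parametrized_curve C G H D U
  proof
    show "zariski_closed C" "zariski_dim C = 1" "finite (- U)" "degree H \<le> D" "\<And>i. degree (G i) \<le> D"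
      by fact+
    show "\<And>t. poly H t = 0 \<Longrightarrow> \<exists>i. poly (G i) t \<noteq> 0" by (rule free)
    show "coeff H D = 0 \<Longrightarrow> \<exists>i. coeff (G i) D \<noteq> 0" by (rule top)
    show "\<And>t. t \<in> U \<Longrightarrow> poly H t \<noteq> 0" using defined assms(7) by blast
    show "\<And>t. t \<in> U \<Longrightarrow> frac_point G H t \<in> C" using map_eq img assms(7) by (metis image_subset_iff subsetD)
    show "inj_on (frac_point G H) U"
      using P1 map_eq assms(7) by (metis inj_on_cong subsetD)
  next
    fix \<phi> x
    assume \<phi>: "polyfun UNIV \<phi>" "\<And>t. t \<in> U \<Longrightarrow> \<phi> (vec_nth (frac_point G H t)) = 0" and x: "x \<in> C"
    have "\<phi> (vec_nth (param_map g h t)) = 0" if t: "t \<in> param_domain h" for t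
      unfolding map_eq[OF t] vec_nth_frac_point
      by (rule polyfun_vanish_continuation[OF \<phi>(1) cofinite])
        (use \<phi>(2) defined[OF t] in \<open>auto simp: vec_nth_frac_point\<close>)
    then have "param_map g h ` param_domain h \<subseteq> {x. \<forall>\<psi>\<in>{\<phi>}. \<psi> (vec_nth x) = 0}" by auto
    moreover have "zariski_closed {x. \<forall>\<psi>\<in>{\<phi>}. \<psi> (vec_nth x) = 0}"
      by (rule zariski_closed_zeros) (use \<phi>(1) in simp)
    ultimately have "zariski_closed hull (param_map g h ` param_domain h) \<subseteq> {x. \<forall>\<psi>\<in>{\<phi>}. \<psi> (vec_nth x) = 0}"
      by (rule hull_minimal)
    then show "\<phi> (vec_nth x) = 0" using x hull by auto
  next
    fix t assume t: "t \<in> U"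
    then have "t \<in> param_domain h" using assms(7) by blast
    obtain i where "param_deriv g h t $ i \<noteq> 0" using P2[OF t] by (auto simp: vec_eq_iff)
    then have "poly (pderiv (g i) * h i - g i * pderiv (h i)) t \<noteq> 0" by (auto simp: param_deriv_def)
    then have "poly (wronskian G H i * (h i)^2) t \<noteq> 0"
      unfolding wronskian_def wronskian_common_denominator[OF GH] using defined[OF \<open>t \<in> param_domain h\<close>] by simp
    then show "\<exists>i. poly (wronskian G H i) t \<noteq> 0" by auto
  qed
  interpret C: smooth_parametrized_curve C G H D U
  proof
    fix p assume p: "p \<in> C"
    have "enat (vec.dim (tangent_space C p)) = local_dim C p"
      using assms(3) p unfolding zariski_smooth_def by blast
    also have "\<dots> = 1"
      using local_dim_irreducible[OF assms(1) C.curve_irreducible p] assms(2) by simp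
    finally show "vec.dim (tangent_space C p) = 1" by (simp add: one_enat_def)
  qed
  have "geom_degree (tangent_bundle C) \<le> 3 * D - 2" by (rule C.tangent_bundle_degree)
  also have "\<dots> \<le> 3 * geom_degree C - 2" using C.curve_degree by simp
  finally show ?thesis using C.curve_degree C.D_pos by linarith
qed

end
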